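(* Let $\theta,\rho\in\mathbb{R}$ with $|\theta|<1$, $|\rho|<1$, let $(V_n)_{n\ge1}$ be a sequence of independent and identically distributed real random variables with zero mean, variance $\sigma^2>0$ and finite moment of order $4$, let the initial values $X_0,\varepsilon_0$ be arbitrary, and for all $n\ge1$ let $X_n=\theta X_{n-1}+\varepsilon_n$ and $\varepsilon_n=\rho\varepsilon_{n-1}+V_n$. Let $\widehat{D}_n$ be the Durbin-Watson statistic defined in the context, and set $D^*=2(1-\rho^* )$ with $\rho^*=\frac{\theta\rho(\theta+\rho)}{1+\theta\rho}$, and $$\sigma_D^2=\frac{4(1-\theta\rho)}{(1+\theta\rho)^3}\Big((\theta+\rho)^2(1+\theta\rho)^2+(\theta\rho)^2(1-\theta^2)(1-\rho^2)\Big).$$ Then, as $n\to\infty$, $$\sqrt{n}\,\big(\widehat{D}_n-D^*\big)\longrightarrow\mathcal{N}(0,\sigma_D^2)\quad\text{in distribution}.$$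
   Context: For $n\ge1$ put $$\widehat{\theta}_n=\frac{\sum_{k=1}^n X_kX_{k-1}}{\sum_{k=1}^n X_{k-1}^2}.$$ At step $n$, the least squares residuals are $\widehat{\varepsilon}_0=X_0$ and $\widehat{\varepsilon}_k=X_k-\widehat{\theta}_nX_{k-1}$ for $1\le k\le n$ (they depend on $n$ through $\widehat\theta_n$). The Durbin-Watson statistic is $$\widehat{D}_n=\frac{\sum_{k=1}^n(\widehat{\varepsilon}_k-\widehat{\varepsilon}_{k-1})^2}{\sum_{k=0}^n\widehat{\varepsilon}_k^{\,2}}.$$ Convention: a quotient defining an estimator or $\widehat D_n$ is read as $0$ if its denominator vanishes. $\mathcal{N}(0,s^2)$ is the centered normal law with variance $s^2$ (the Dirac mass at $0$ if $s^2=0$). *)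

theory Defs
  imports "HOL-Probability.Probability"
begin

text \<open>Estimators are functions of an observed path \<open>x\<close>. A quotient with vanishing denominator
  has value 0, which here is HOL's own convention \<open>a / 0 = 0\<close>.\<close>

definition theta_hat :: "(nat \<Rightarrow> real) \<Rightarrow> nat \<Rightarrow> real" where
  "theta_hat x n = (\<Sum>k=1..n. x k * x (k - 1)) / (\<Sum>k=1..n. (x (k - 1))\<^sup>2)"

definition residual :: "(nat \<Rightarrow> real) \<Rightarrow> nat \<Rightarrow> nat \<Rightarrow> real" where
  "residual x n k = (if k = 0 then x 0 else x k - theta_hat x n * x (k - 1))"

definition durbin_watson :: "(nat \<Rightarrow> real) \<Rightarrow> nat \<Rightarrow> real" where
  "durbin_watson x n =
     (\<Sum>k=1..n. (residual x n k - residual x n (k - 1))\<^sup>2) / (\<Sum>k=0..n. (residual x n k)\<^sup>2)"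

definition rho_star :: "real \<Rightarrow> real \<Rightarrow> real" where
  "rho_star \<theta> \<rho> = \<theta> * \<rho> * (\<theta> + \<rho>) / (1 + \<theta> * \<rho>)"

definition D_star :: "real \<Rightarrow> real \<Rightarrow> real" where
  "D_star \<theta> \<rho> = 2 * (1 - rho_star \<theta> \<rho>)"

definition sigma2_D :: "real \<Rightarrow> real \<Rightarrow> real" where
  "sigma2_D \<theta> \<rho> = 4 * (1 - \<theta> * \<rho>) / (1 + \<theta> * \<rho>) ^ 3 *
     ((\<theta> + \<rho>)\<^sup>2 * (1 + \<theta> * \<rho>)\<^sup>2 + (\<theta> * \<rho>)\<^sup>2 * (1 - \<theta>\<^sup>2) * (1 - \<rho>\<^sup>2))"

text \<open>The argument is the variance, whereas \<^const>\<open>normal_density\<close> takes the standard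
  deviation. Variance 0 needs its own case because \<open>normal_density 0 0\<close> is identically 0.\<close>

definition centered_normal :: "real \<Rightarrow> real measure" where
  "centered_normal v =
     (if v = 0 then return borel 0 else density lborel (\<lambda>x. ennreal (normal_density 0 (sqrt v) x)))"

end

theory Submission
  imports Defs
begin

text \<open>
  Write \<open>A\<close>, \<open>B\<close>, \<open>C\<close> for the sums of products of the observations at lags 0, 1 and 2. The estimator
  is \<open>B / A\<close>, and the Durbin-Watson statistic is a smooth function of \<open>B / A\<close> and \<open>C / A\<close> up to a few
  boundary terms. These ratios converge to \<open>r\<^sub>1 = (\<theta> + \<rho>) / (1 + \<theta> * \<rho>)\<close> and
  \<open>r\<^sub>2 = (\<theta> + \<rho>) * r\<^sub>1 - \<theta> * \<rho>\<close>, which determine the centre \<open>D_star\<close>. Substituting the second order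
  autoregression satisfied by the observations shows that \<open>B - r\<^sub>1 A\<close> and \<open>C - r\<^sub>2 A\<close> are linear
  combinations of the martingales \<open>N\<^sub>1\<close>, \<open>N\<^sub>2\<close>, the sums of \<open>X(k - 1) V(k)\<close> and \<open>X(k - 2) V(k)\<close>, again up
  to boundary terms. A first order expansion (\<open>durbin_watson_linearization\<close>) therefore writes
  \<open>sqrt n * (D - D_star)\<close> as \<open>(p N\<^sub>1 + q N\<^sub>2) / sqrt n\<close> plus a term that vanishes in probability, and
  \<open>asymptotic_variance\<close> identifies the limiting variance.

  What remains is a central limit theorem for sums of \<open>Y(k) \<xi>(k)\<close>, where \<open>\<xi>\<close> is the noise and \<open>Y(k)\<close> is
  a linear form in the past (\<open>char_tendsto\<close>). Adding one summand multiplies the characteristic function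
  by \<open>1 - t\<^sup>2 \<sigma>\<^sup>2 v / (2 n)\<close>, except for the correlation between the exponential of the sum so far and
  \<open>Y(k)\<^sup>2 - v\<close>. On average over \<open>k\<close> these correlations vanish. The reason is that the exponential changes
  by \<open>O(1 / sqrt n)\<close> in one step, so that the recursion of the quadratic quantities \<open>e\<^sup>2\<close>, \<open>x e\<close>, \<open>x\<^sup>2\<close>
  carries over to the correlations; this recursion is a contraction driven by centred terms
  independent of the past, whose correlations are 0 (\<open>null_innovation\<close>, \<open>null_recursion\<close>).
  The same two facts for plain sums give the law of large numbers for \<open>A / n\<close>.

  The initial values are arbitrary, possibly dependent on the noise. They change the observations by
  a random factor times a summable deterministic sequence, hence all lag sums by amounts bounded in
  probability (\<open>product_sums_diff\<close>), and everything can be computed for the process started at 0.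
\<close>

section \<open>Stochastic order symbols and characteristic functions\<close>

lemma integrable_dominated:
  fixes f :: "'a \<Rightarrow> 'b::{banach, second_countable_topology}"
  assumes "f \<in> borel_measurable M" "integrable M g" "\<And>x. x \<in> space M \<Longrightarrow> norm (f x) \<le> g x"
  shows "integrable M f"
proof (rule Bochner_Integration.integrable_bound[OF assms(2,1)])
  show "AE x in M. norm (f x) \<le> norm (g x)"
    using assms(3) by (intro AE_I2) (simp add: order_trans[OF _ abs_ge_self])
qed

lemma norm_integral_le:
  fixes f :: "'a \<Rightarrow> 'b::{banach, second_countable_topology}"
  assumes "f \<in> borel_measurable M" "integrable M g" "\<And>x. x \<in> space M \<Longrightarrow> norm (f x) \<le> g x"
  shows "norm (integral\<^sup>L M f) \<le> integral\<^sup>L M g"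
proof -
  have "integrable M f" by (rule integrable_dominated[OF assms])
  have "norm (integral\<^sup>L M f) \<le> (\<integral>x. norm (f x) \<partial>M)" by (rule integral_norm_bound)
  also have "\<dots> \<le> integral\<^sup>L M g"
    by (rule integral_mono[OF integrable_norm[OF \<open>integrable M f\<close>] assms(2,3)])
  finally show ?thesis .
qed

context prob_space
begin

text \<open>With probability tending to one. The quantification over an event on which \<open>P n\<close> holds frees
  \<open>P n\<close> from measurability: pointwise estimates and identities between quotients can then be
  transferred to statements in probability without side conditions.\<close>

definition likely :: "(nat \<Rightarrow> 'a \<Rightarrow> bool) \<Rightarrow> bool" where
  "likely P \<longleftrightarrow>
     (\<forall>e>0. \<forall>\<^sub>F n in sequentially. \<exists>E\<in>events. prob E \<ge> 1 - e \<and> (\<forall>\<omega>\<in>E. P n \<omega>))"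

text \<open>The symbols \<open>o\<^sub>P(1)\<close> and \<open>O\<^sub>P(1)\<close> of asymptotic statistics.\<close>

definition o_prob :: "(nat \<Rightarrow> 'a \<Rightarrow> real) \<Rightarrow> bool" where
  "o_prob Z \<longleftrightarrow> (\<forall>d>0. likely (\<lambda>n \<omega>. \<bar>Z n \<omega>\<bar> \<le> d))"

definition O_prob :: "(nat \<Rightarrow> 'a \<Rightarrow> real) \<Rightarrow> bool" where
  "O_prob Z \<longleftrightarrow>
     (\<forall>e>0. \<exists>K. \<forall>\<^sub>F n in sequentially. \<exists>E\<in>events. prob E \<ge> 1 - e \<and> (\<forall>\<omega>\<in>E. \<bar>Z n \<omega>\<bar> \<le> K))"

lemma prob_Int_ge:
  assumes "E \<in> events" "F \<in> events" "prob E \<ge> 1 - e / 2" "prob F \<ge> 1 - e / 2"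
  shows "prob (E \<inter> F) \<ge> 1 - e"
proof -
  have "prob (E \<union> F) = prob E + prob (F - E)"
    using assms finite_measure_Union'[of E F] by (simp add: Diff_Int2)
  moreover have "prob F = prob (E \<inter> F) + prob (F - E)"
    using assms finite_measure_Diff'[of F E] by (simp add: Int_commute)
  moreover have "prob (E \<union> F) \<le> 1" by simp
  ultimately show ?thesis using assms by linarith
qed

lemma likely_eventually_mono:
  assumes "likely P" "\<forall>\<^sub>F n in sequentially. \<forall>\<omega>\<in>space M. P n \<omega> \<longrightarrow> Q n \<omega>"
  shows "likely Q"
  unfolding likely_def
proof (intro allI impI)
  fix e :: real assume "e > 0"
  then have "\<forall>\<^sub>F n in sequentially. \<exists>E\<in>events. prob E \<ge> 1 - e \<and> (\<forall>\<omega>\<in>E. P n \<omega>)"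
    using assms(1) by (auto simp: likely_def)
  with assms(2) show "\<forall>\<^sub>F n in sequentially. \<exists>E\<in>events. prob E \<ge> 1 - e \<and> (\<forall>\<omega>\<in>E. Q n \<omega>)"
    by eventually_elim (meson sets.sets_into_space subsetD)
qed

lemma likely_mono:
  assumes "likely P" "\<And>n \<omega>. \<omega> \<in> space M \<Longrightarrow> P n \<omega> \<Longrightarrow> Q n \<omega>"
  shows "likely Q"
  using assms by (intro likely_eventually_mono[OF assms(1)]) auto

lemma likely_conj:
  assumes "likely P" "likely Q"
  shows "likely (\<lambda>n \<omega>. P n \<omega> \<and> Q n \<omega>)"
  unfolding likely_def
proof (intro allI impI)
  fix e :: real assume "e > 0"
  then have "\<forall>\<^sub>F n in sequentially. \<exists>E\<in>events. prob E \<ge> 1 - e / 2 \<and> (\<forall>\<omega>\<in>E. P n \<omega>)"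
    "\<forall>\<^sub>F n in sequentially. \<exists>E\<in>events. prob E \<ge> 1 - e / 2 \<and> (\<forall>\<omega>\<in>E. Q n \<omega>)"
    using assms by (simp_all add: likely_def)
  then show "\<forall>\<^sub>F n in sequentially. \<exists>E\<in>events. prob E \<ge> 1 - e \<and> (\<forall>\<omega>\<in>E. P n \<omega> \<and> Q n \<omega>)"
  proof eventually_elim
    case (elim n)
    then obtain E F where "E \<in> events" "F \<in> events" "prob E \<ge> 1 - e / 2" "prob F \<ge> 1 - e / 2"
      "\<forall>\<omega>\<in>E. P n \<omega>" "\<forall>\<omega>\<in>F. Q n \<omega>" by blast
    then show ?case by (intro bexI[of _ "E \<inter> F"]) (auto simp: prob_Int_ge)
  qed
qed

lemma likely_eventually:
  assumes "\<forall>\<^sub>F n in sequentially. \<forall>\<omega>\<in>space M. P n \<omega>"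
  shows "likely P"
  unfolding likely_def
proof (intro allI impI)
  fix e :: real assume "e > 0"
  from assms show "\<forall>\<^sub>F n in sequentially. \<exists>E\<in>events. prob E \<ge> 1 - e \<and> (\<forall>\<omega>\<in>E. P n \<omega>)"
    by eventually_elim (rule bexI[of _ "space M"], use \<open>e > 0\<close> in \<open>auto simp: prob_space\<close>)
qed

lemma o_probD: "o_prob Z \<Longrightarrow> d > 0 \<Longrightarrow> likely (\<lambda>n \<omega>. \<bar>Z n \<omega>\<bar> \<le> d)"
  by (simp add: o_prob_def)

lemma o_prob_mono:
  assumes "o_prob Z" "likely (\<lambda>n \<omega>. \<bar>W n \<omega>\<bar> \<le> \<bar>Z n \<omega>\<bar>)"
  shows "o_prob W"
  unfolding o_prob_def
proof (intro allI impI)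
  fix d :: real assume "d > 0"
  then have "likely (\<lambda>n \<omega>. \<bar>Z n \<omega>\<bar> \<le> d)" using assms(1) by (simp add: o_prob_def)
  from likely_conj[OF this assms(2)] show "likely (\<lambda>n \<omega>. \<bar>W n \<omega>\<bar> \<le> d)"
    by (rule likely_mono) auto
qed

lemma o_prob_cong:
  assumes "o_prob Z" "likely (\<lambda>n \<omega>. W n \<omega> = Z n \<omega>)"
  shows "o_prob W"
  by (rule o_prob_mono[OF assms(1) likely_mono[OF assms(2)]]) auto

lemma O_prob_mono:
  assumes "O_prob Z" "likely (\<lambda>n \<omega>. \<bar>W n \<omega>\<bar> \<le> \<bar>Z n \<omega>\<bar>)"
  shows "O_prob W"
  unfolding O_prob_def
proof (intro allI impI)
  fix e :: real assume "e > 0"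
  then have "e / 2 > 0" by simp
  with assms(1) obtain K where
    "\<forall>\<^sub>F n in sequentially. \<exists>E\<in>events. prob E \<ge> 1 - e / 2 \<and> (\<forall>\<omega>\<in>E. \<bar>Z n \<omega>\<bar> \<le> K)"
    unfolding O_prob_def by blast
  moreover have
    "\<forall>\<^sub>F n in sequentially. \<exists>E\<in>events. prob E \<ge> 1 - e / 2 \<and> (\<forall>\<omega>\<in>E. \<bar>W n \<omega>\<bar> \<le> \<bar>Z n \<omega>\<bar>)"
    using assms(2) \<open>e / 2 > 0\<close> unfolding likely_def by blast
  ultimately have "\<forall>\<^sub>F n in sequentially. \<exists>E\<in>events. prob E \<ge> 1 - e \<and> (\<forall>\<omega>\<in>E. \<bar>W n \<omega>\<bar> \<le> K)"
  proof eventually_elim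
    case (elim n)
    then obtain E F where "E \<in> events" "F \<in> events" "prob E \<ge> 1 - e / 2" "prob F \<ge> 1 - e / 2"
      "\<forall>\<omega>\<in>E. \<bar>Z n \<omega>\<bar> \<le> K" "\<forall>\<omega>\<in>F. \<bar>W n \<omega>\<bar> \<le> \<bar>Z n \<omega>\<bar>" by blast
    then show ?case by (intro bexI[of _ "E \<inter> F"]) (fastforce simp: prob_Int_ge)+
  qed
  then show "\<exists>K. \<forall>\<^sub>F n in sequentially. \<exists>E\<in>events. prob E \<ge> 1 - e \<and> (\<forall>\<omega>\<in>E. \<bar>W n \<omega>\<bar> \<le> K)" ..
qed

lemma O_prob_cong:
  assumes "O_prob Z" "likely (\<lambda>n \<omega>. W n \<omega> = Z n \<omega>)"
  shows "O_prob W"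
  by (rule O_prob_mono[OF assms(1) likely_mono[OF assms(2)]]) auto

lemma O_prob_combine:
  assumes "O_prob Z" "O_prob W"
    and "\<And>K L n \<omega>. \<lbrakk>\<omega> \<in> space M; \<bar>Z n \<omega>\<bar> \<le> K; \<bar>W n \<omega>\<bar> \<le> L\<rbrakk> \<Longrightarrow> \<bar>U n \<omega>\<bar> \<le> f K L"
  shows "O_prob U"
  unfolding O_prob_def
proof (intro allI impI)
  fix e :: real assume "e > 0"
  then have "e / 2 > 0" by simp
  with assms(1,2) obtain K L where
    "\<forall>\<^sub>F n in sequentially. \<exists>E\<in>events. prob E \<ge> 1 - e / 2 \<and> (\<forall>\<omega>\<in>E. \<bar>Z n \<omega>\<bar> \<le> K)"
    "\<forall>\<^sub>F n in sequentially. \<exists>E\<in>events. prob E \<ge> 1 - e / 2 \<and> (\<forall>\<omega>\<in>E. \<bar>W n \<omega>\<bar> \<le> L)"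
    unfolding O_prob_def by meson
  then have "\<forall>\<^sub>F n in sequentially. \<exists>E\<in>events. prob E \<ge> 1 - e \<and> (\<forall>\<omega>\<in>E. \<bar>U n \<omega>\<bar> \<le> f K L)"
  proof eventually_elim
    case (elim n)
    then obtain E F where EF: "E \<in> events" "F \<in> events" "prob E \<ge> 1 - e / 2" "prob F \<ge> 1 - e / 2"
      "\<forall>\<omega>\<in>E. \<bar>Z n \<omega>\<bar> \<le> K" "\<forall>\<omega>\<in>F. \<bar>W n \<omega>\<bar> \<le> L" by blast
    have "\<bar>U n \<omega>\<bar> \<le> f K L" if "\<omega> \<in> E \<inter> F" for \<omega>
      using that EF sets.sets_into_space[OF EF(1)] by (intro assms(3)) auto
    with EF show ?case by (intro bexI[of _ "E \<inter> F"]) (auto simp: prob_Int_ge)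
  qed
  then show "\<exists>K. \<forall>\<^sub>F n in sequentially. \<exists>E\<in>events. prob E \<ge> 1 - e \<and> (\<forall>\<omega>\<in>E. \<bar>U n \<omega>\<bar> \<le> K)" ..
qed

lemma O_prob_add: "O_prob Z \<Longrightarrow> O_prob W \<Longrightarrow> O_prob (\<lambda>n \<omega>. Z n \<omega> + W n \<omega>)"
  by (erule O_prob_combine[where f="\<lambda>K L. K + L"]) auto

lemma O_prob_diff: "O_prob Z \<Longrightarrow> O_prob W \<Longrightarrow> O_prob (\<lambda>n \<omega>. Z n \<omega> - W n \<omega>)"
  by (erule O_prob_combine[where f="\<lambda>K L. K + L"]) auto

lemma O_prob_mult: "O_prob Z \<Longrightarrow> O_prob W \<Longrightarrow> O_prob (\<lambda>n \<omega>. Z n \<omega> * W n \<omega>)"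
  by (erule O_prob_combine[where f="\<lambda>K L. K * L"]) (auto simp: abs_mult intro!: mult_mono)

lemma O_prob_bounded:
  assumes "\<forall>\<^sub>F n in sequentially. \<forall>\<omega>\<in>space M. \<bar>Z n \<omega>\<bar> \<le> K"
  shows "O_prob Z"
  using likely_eventually[OF assms] unfolding O_prob_def likely_def by blast

lemma O_prob_const: "O_prob (\<lambda>n \<omega>. c)"
  by (rule O_prob_bounded[where K="\<bar>c\<bar>"]) auto

lemma O_prob_power2: "O_prob Z \<Longrightarrow> O_prob (\<lambda>n \<omega>. (Z n \<omega>)\<^sup>2)"
  unfolding power2_eq_square by (rule O_prob_mult)

lemma o_prob_imp_O_prob: "o_prob Z \<Longrightarrow> O_prob Z"
  unfolding o_prob_def likely_def O_prob_def by (meson zero_less_one)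

lemma o_prob_add:
  assumes "o_prob Z" "o_prob W"
  shows "o_prob (\<lambda>n \<omega>. Z n \<omega> + W n \<omega>)"
  unfolding o_prob_def
proof (intro allI impI)
  fix d :: real assume "d > 0"
  then have "likely (\<lambda>n \<omega>. \<bar>Z n \<omega>\<bar> \<le> d / 2)" "likely (\<lambda>n \<omega>. \<bar>W n \<omega>\<bar> \<le> d / 2)"
    using assms[THEN o_probD, of "d / 2"] by simp_all
  from likely_conj[OF this] show "likely (\<lambda>n \<omega>. \<bar>Z n \<omega> + W n \<omega>\<bar> \<le> d)"
    by (rule likely_mono) auto
qed

lemma o_prob_mult_O_prob:
  assumes "o_prob Z" "O_prob W"
  shows "o_prob (\<lambda>n \<omega>. Z n \<omega> * W n \<omega>)"
  unfolding o_prob_def likely_def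
proof (intro allI impI)
  fix d e :: real assume "d > 0" "e > 0"
  then have "e / 2 > 0" by simp
  with assms(2) obtain K where
    K: "\<forall>\<^sub>F n in sequentially. \<exists>E\<in>events. prob E \<ge> 1 - e / 2 \<and> (\<forall>\<omega>\<in>E. \<bar>W n \<omega>\<bar> \<le> K)"
    unfolding O_prob_def by meson
  \<comment> \<open>The bound must be positive to divide the tolerance by it.\<close>
  define L where "L = max K 1"
  then have "L > 0" "K \<le> L" by auto
  have "\<forall>\<^sub>F n in sequentially. \<exists>E\<in>events. prob E \<ge> 1 - e / 2 \<and> (\<forall>\<omega>\<in>E. \<bar>Z n \<omega>\<bar> \<le> d / L)"
    using assms(1) \<open>L > 0\<close> \<open>d > 0\<close> \<open>e / 2 > 0\<close> unfolding o_prob_def likely_def by (meson divide_pos_pos)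
  with K show "\<forall>\<^sub>F n in sequentially. \<exists>E\<in>events. prob E \<ge> 1 - e \<and> (\<forall>\<omega>\<in>E. \<bar>Z n \<omega> * W n \<omega>\<bar> \<le> d)"
  proof eventually_elim
    case (elim n)
    then obtain E F where EF: "E \<in> events" "F \<in> events" "prob E \<ge> 1 - e / 2" "prob F \<ge> 1 - e / 2"
      "\<forall>\<omega>\<in>E. \<bar>W n \<omega>\<bar> \<le> K" "\<forall>\<omega>\<in>F. \<bar>Z n \<omega>\<bar> \<le> d / L" by blast
    have "\<bar>Z n \<omega> * W n \<omega>\<bar> \<le> d" if "\<omega> \<in> E \<inter> F" for \<omega>
    proof -
      have "\<bar>Z n \<omega>\<bar> * \<bar>W n \<omega>\<bar> \<le> d / L * L"
        using that EF \<open>K \<le> L\<close> \<open>d > 0\<close> \<open>L > 0\<close> by (intro mult_mono) (auto intro: order_trans)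
      then show ?thesis using \<open>L > 0\<close> by (simp add: abs_mult)
    qed
    with EF show ?case by (intro bexI[of _ "E \<inter> F"]) (auto simp: prob_Int_ge)
  qed
qed

lemma o_prob_tendsto:
  assumes "c \<longlonglongrightarrow> 0"
  shows "o_prob (\<lambda>n \<omega>. c n)"
  unfolding o_prob_def
proof (intro allI impI likely_eventually)
  fix d :: real assume "d > 0"
  with assms have "\<forall>\<^sub>F n in sequentially. \<bar>c n\<bar> < d"
    by (auto simp: tendsto_iff dist_norm)
  then show "\<forall>\<^sub>F n in sequentially. \<forall>\<omega>\<in>space M. \<bar>c n\<bar> \<le> d"
    by eventually_elim auto
qed

lemma O_prob_div_sqrt: "O_prob Z \<Longrightarrow> o_prob (\<lambda>n \<omega>. Z n \<omega> / sqrt (real n))"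
  using o_prob_mult_O_prob[OF o_prob_tendsto[of "\<lambda>n. 1 / sqrt (real n)"], of Z]
    tendsto_divide_0[OF tendsto_const[of 1] filterlim_at_top_imp_at_infinity[OF
      filterlim_compose[OF sqrt_at_top filterlim_real_sequentially]]]
  by (simp add: field_simps)

lemma o_prob_nonzero:
  assumes "o_prob (\<lambda>n \<omega>. Z n \<omega> - c)" "c \<noteq> 0"
  shows "likely (\<lambda>n \<omega>. \<bar>Z n \<omega>\<bar> \<ge> \<bar>c\<bar> / 2)"
proof -
  have "likely (\<lambda>n \<omega>. \<bar>Z n \<omega> - c\<bar> \<le> \<bar>c\<bar> / 2)"
    using o_probD[OF assms(1), of "\<bar>c\<bar> / 2"] assms(2) by simp
  then show ?thesis by (rule likely_mono) linarith
qed

text \<open>Where \<open>\<bar>Z\<bar> \<ge> \<bar>c\<bar> / 2\<close>, which is likely, \<open>1 / Z\<close> differs from \<open>1 / c\<close> by at most \<open>2 / c\<^sup>2\<close>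
  times \<open>\<bar>Z - c\<bar>\<close>.\<close>

lemma o_prob_inverse:
  assumes "o_prob (\<lambda>n \<omega>. Z n \<omega> - c)" "c \<noteq> 0"
  shows "o_prob (\<lambda>n \<omega>. 1 / Z n \<omega> - 1 / c)"
proof (rule o_prob_mono)
  show "o_prob (\<lambda>n \<omega>. (Z n \<omega> - c) * (2 / c\<^sup>2))"
    by (rule o_prob_mult_O_prob[OF assms(1) O_prob_const])
  show "likely (\<lambda>n \<omega>. \<bar>1 / Z n \<omega> - 1 / c\<bar> \<le> \<bar>(Z n \<omega> - c) * (2 / c\<^sup>2)\<bar>)"
  proof (rule likely_mono[OF o_prob_nonzero[OF assms]])
    fix n \<omega> assume *: "\<bar>Z n \<omega>\<bar> \<ge> \<bar>c\<bar> / 2"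
    let ?z = "Z n \<omega>"
    have "?z \<noteq> 0" using * assms(2) by auto
    then have "\<bar>1 / ?z - 1 / c\<bar> = \<bar>?z - c\<bar> * (1 / (\<bar>?z\<bar> * \<bar>c\<bar>))"
      using assms(2) by (simp add: diff_frac_eq abs_mult abs_divide abs_minus_commute)
    also have "1 / (\<bar>?z\<bar> * \<bar>c\<bar>) \<le> 1 / (\<bar>c\<bar> / 2 * \<bar>c\<bar>)"
      using * assms(2) by (intro divide_left_mono mult_right_mono mult_pos_pos) auto
    also have "\<bar>c\<bar> / 2 * \<bar>c\<bar> = c\<^sup>2 / 2" by (simp add: power2_eq_square abs_mult_self_eq)
    finally have "\<bar>1 / ?z - 1 / c\<bar> \<le> \<bar>?z - c\<bar> * (2 / c\<^sup>2)"
      by (simp add: mult_left_mono)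
    then show "\<bar>1 / ?z - 1 / c\<bar> \<le> \<bar>(?z - c) * (2 / c\<^sup>2)\<bar>"
      unfolding abs_mult by simp
  qed
qed

lemma prob_abs_le_of_expectation:
  assumes "integrable M Z" "expectation (\<lambda>\<omega>. \<bar>Z \<omega>\<bar>) \<le> K" "d > 0"
  shows "{\<omega> \<in> space M. \<bar>Z \<omega>\<bar> \<le> d} \<in> events" "prob {\<omega> \<in> space M. \<bar>Z \<omega>\<bar> \<le> d} \<ge> 1 - K / d"
proof -
  have [measurable]: "Z \<in> borel_measurable M" using assms(1) by simp
  show ev: "{\<omega> \<in> space M. \<bar>Z \<omega>\<bar> \<le> d} \<in> events" by measurable
  have "prob {\<omega> \<in> space M. d \<le> \<bar>Z \<omega>\<bar>} \<le> expectation (\<lambda>\<omega>. \<bar>Z \<omega>\<bar>) / d"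
    by (rule integral_Markov_inequality_measure[where A="space M" and c=d, simplified])
      (use assms in auto)
  also have "\<dots> \<le> K / d" using assms by (simp add: divide_right_mono)
  finally have *: "prob {\<omega> \<in> space M. d \<le> \<bar>Z \<omega>\<bar>} \<le> K / d" .
  have "1 = prob (space M)" by (simp add: prob_space)
  also have "\<dots> \<le> prob ({\<omega> \<in> space M. \<bar>Z \<omega>\<bar> \<le> d} \<union> {\<omega> \<in> space M. d \<le> \<bar>Z \<omega>\<bar>})"
    by (intro finite_measure_mono) auto
  also have "\<dots> \<le> prob {\<omega> \<in> space M. \<bar>Z \<omega>\<bar> \<le> d} + prob {\<omega> \<in> space M. d \<le> \<bar>Z \<omega>\<bar>}"
    by (intro measure_Un_le) auto
  finally show "prob {\<omega> \<in> space M. \<bar>Z \<omega>\<bar> \<le> d} \<ge> 1 - K / d" using * by linarith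
qed

lemma O_prob_of_expectation:
  assumes "\<And>n. integrable M (Z n)" "\<And>n. expectation (\<lambda>\<omega>. \<bar>Z n \<omega>\<bar>) \<le> K"
  shows "O_prob Z"
  unfolding O_prob_def
proof (intro allI impI exI always_eventually)
  fix e :: real and n :: nat assume "e > 0"
  have "expectation (\<lambda>\<omega>. \<bar>Z n \<omega>\<bar>) \<ge> 0" by simp
  then have "K \<ge> 0" using assms(2)[of n] by linarith
  let ?d = "(K + 1) / e"
  have "?d > 0" using \<open>K \<ge> 0\<close> \<open>e > 0\<close> by simp
  have "K / ?d \<le> e" using \<open>K \<ge> 0\<close> \<open>e > 0\<close> by (simp add: field_simps)
  then have "prob {\<omega> \<in> space M. \<bar>Z n \<omega>\<bar> \<le> ?d} \<ge> 1 - e"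
    using prob_abs_le_of_expectation(2)[OF assms(1)[of n] assms(2)[of n] \<open>?d > 0\<close>] by linarith
  then show "\<exists>E\<in>events. prob E \<ge> 1 - e \<and> (\<forall>\<omega>\<in>E. \<bar>Z n \<omega>\<bar> \<le> ?d)"
    by (intro bexI[OF _ prob_abs_le_of_expectation(1)[OF assms(1)[of n] assms(2)[of n] \<open>?d > 0\<close>]]) auto
qed

lemma o_prob_of_expectation:
  assumes "\<And>n. integrable M (Z n)" "(\<lambda>n. expectation (\<lambda>\<omega>. \<bar>Z n \<omega>\<bar>)) \<longlonglongrightarrow> 0"
  shows "o_prob Z"
  unfolding o_prob_def likely_def
proof (intro allI impI)
  fix d e :: real assume "d > 0" "e > 0"
  then have "\<forall>\<^sub>F n in sequentially. expectation (\<lambda>\<omega>. \<bar>Z n \<omega>\<bar>) < d * e"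
    using assms(2) by (intro order_tendstoD(2)) auto
  then show "\<forall>\<^sub>F n in sequentially. \<exists>E\<in>events. prob E \<ge> 1 - e \<and> (\<forall>\<omega>\<in>E. \<bar>Z n \<omega>\<bar> \<le> d)"
  proof eventually_elim
    case (elim n)
    then have "expectation (\<lambda>\<omega>. \<bar>Z n \<omega>\<bar>) \<le> d * e" by simp
    note * = prob_abs_le_of_expectation[OF assms(1) this \<open>d > 0\<close>]
    show ?case using * \<open>d > 0\<close> by (intro bexI[OF _ *(1)]) auto
  qed
qed

lemma O_prob_random_variable:
  assumes [measurable]: "Z \<in> borel_measurable M"
  shows "O_prob (\<lambda>n. Z)"
  unfolding O_prob_def
proof (intro allI impI)
  fix e :: real assume "e > 0"
  let ?A = "\<lambda>m. {\<omega> \<in> space M. \<bar>Z \<omega>\<bar> \<le> real m}"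
  have "(\<lambda>m. prob (?A m)) \<longlonglongrightarrow> prob (\<Union>m. ?A m)"
    by (intro finite_Lim_measure_incseq) (auto simp: incseq_def)
  also have "(\<Union>m. ?A m) = space M" using real_arch_simple by auto
  finally have "\<forall>\<^sub>F m in sequentially. prob (?A m) > 1 - e"
    using \<open>e > 0\<close> by (intro order_tendstoD(1)) (auto simp: prob_space)
  then obtain m where "prob (?A m) > 1 - e" by (meson eventually_happens trivial_limit_sequentially)
  then show "\<exists>K. \<forall>\<^sub>F n in sequentially. \<exists>E\<in>events. prob E \<ge> 1 - e \<and> (\<forall>\<omega>\<in>E. \<bar>Z \<omega>\<bar> \<le> K)"
    by (intro exI[of _ "real m"] always_eventually allI bexI[of _ "?A m"]) auto
qed

text \<open>Slutsky's lemma at the level of characteristic functions: the two exponentials differ by at most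
  \<open>\<bar>t\<bar> * d\<close> where the variables are \<open>d\<close>-close, and by at most 2 on the unlikely rest.\<close>

lemma char_tendsto_if_o_prob_diff:
  fixes Z W :: "nat \<Rightarrow> 'a \<Rightarrow> real"
  assumes [measurable]: "\<And>n. Z n \<in> borel_measurable M" "\<And>n. W n \<in> borel_measurable M"
    and diff: "o_prob (\<lambda>n \<omega>. Z n \<omega> - W n \<omega>)"
    and lim: "(\<lambda>n. expectation (\<lambda>\<omega>. iexp (t * W n \<omega>))) \<longlonglongrightarrow> c"
  shows "(\<lambda>n. expectation (\<lambda>\<omega>. iexp (t * Z n \<omega>))) \<longlonglongrightarrow> c"
proof -
  have "(\<lambda>n. expectation (\<lambda>\<omega>. iexp (t * Z n \<omega>)) - expectation (\<lambda>\<omega>. iexp (t * W n \<omega>))) \<longlonglongrightarrow> 0"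
    unfolding tendsto_iff
  proof (intro allI impI)
    fix e :: real assume "e > 0"
    \<comment> \<open>The summand 1 keeps the denominator positive when \<open>t = 0\<close>.\<close>
    define d where "d = e / 4 / (\<bar>t\<bar> + 1)"
    have "d > 0" using \<open>e > 0\<close> by (simp add: d_def)
    have "\<bar>t\<bar> * d \<le> d * (\<bar>t\<bar> + 1)" using \<open>d > 0\<close> by (simp add: algebra_simps)
    also have "\<dots> = e / 4"
      by (rule iffD1[OF nonzero_eq_divide_eq d_def]) linarith
    finally have "\<bar>t\<bar> * d \<le> e / 4" .
    have "\<forall>\<^sub>F n in sequentially. \<exists>E\<in>events. prob E \<ge> 1 - e / 8 \<and> (\<forall>\<omega>\<in>E. \<bar>Z n \<omega> - W n \<omega>\<bar> \<le> d)"
      using diff \<open>d > 0\<close> \<open>e > 0\<close> by (simp add: o_prob_def likely_def)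
    then show "\<forall>\<^sub>F n in sequentially. dist (expectation (\<lambda>\<omega>. iexp (t * Z n \<omega>)) -
        expectation (\<lambda>\<omega>. iexp (t * W n \<omega>))) 0 < e"
    proof eventually_elim
      case (elim n)
      then obtain E where E[measurable]: "E \<in> events" and pE: "prob E \<ge> 1 - e / 8"
        and le: "\<And>\<omega>. \<omega> \<in> E \<Longrightarrow> \<bar>Z n \<omega> - W n \<omega>\<bar> \<le> d" by blast
      have int: "integrable M (\<lambda>\<omega>. iexp (t * Z n \<omega>))" "integrable M (\<lambda>\<omega>. iexp (t * W n \<omega>))"
        by (intro integrable_const_bound[where B=1]; simp)+
      have ind: "integrable M (indicator (space M - E) :: 'a \<Rightarrow> real)"
        by (intro integrable_real_indicator) (auto simp: emeasure_eq_measure)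
      have "expectation (\<lambda>\<omega>. iexp (t * Z n \<omega>)) - expectation (\<lambda>\<omega>. iexp (t * W n \<omega>))
          = expectation (\<lambda>\<omega>. iexp (t * Z n \<omega>) - iexp (t * W n \<omega>))"
        using int by simp
      also have "norm \<dots> \<le> expectation (\<lambda>\<omega>. \<bar>t\<bar> * d + 2 * indicator (space M - E) \<omega>)"
      proof (rule norm_integral_le)
        show "(\<lambda>\<omega>. iexp (t * Z n \<omega>) - iexp (t * W n \<omega>)) \<in> borel_measurable M" by measurable
        show "integrable M (\<lambda>\<omega>. \<bar>t\<bar> * d + 2 * indicator (space M - E) \<omega> :: real)"
          using ind by (rule Bochner_Integration.integrable_add[OF integrable_const integrable_mult_right])
        fix \<omega> assume "\<omega> \<in> space M"
        have "iexp (t * Z n \<omega>) - iexp (t * W n \<omega>)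
            = iexp (t * W n \<omega>) * (iexp (t * (Z n \<omega> - W n \<omega>)) - 1)"
          by (simp add: right_diff_distrib exp_add[symmetric])
        then have eq: "norm (iexp (t * Z n \<omega>) - iexp (t * W n \<omega>)) = norm (iexp (t * (Z n \<omega> - W n \<omega>)) - 1)"
          by (simp add: norm_mult)
        show "norm (iexp (t * Z n \<omega>) - iexp (t * W n \<omega>)) \<le> \<bar>t\<bar> * d + 2 * indicator (space M - E) \<omega>"
        proof (cases "\<omega> \<in> E")
          case True
          have "norm (iexp (t * (Z n \<omega> - W n \<omega>)) - 1) \<le> \<bar>t * (Z n \<omega> - W n \<omega>)\<bar>"
            using iexp_approx1[of "t * (Z n \<omega> - W n \<omega>)" 0] by simp
          also have "\<dots> \<le> \<bar>t\<bar> * d" using le[OF True] by (simp add: abs_mult mult_left_mono)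
          finally show ?thesis using eq by (simp add: indicator_def)
        next
          case False
          have "norm (iexp (t * (Z n \<omega> - W n \<omega>)) - 1) \<le> 1 + 1"
            by (rule norm_triangle_le_diff) simp
          then have "norm (iexp (t * Z n \<omega>) - iexp (t * W n \<omega>)) \<le> 2" using eq by simp
          moreover have "0 \<le> \<bar>t\<bar> * d" using \<open>d > 0\<close> by simp
          moreover have "indicator (space M - E) \<omega> = (1::real)" using False \<open>\<omega> \<in> space M\<close> by simp
          ultimately show ?thesis by linarith
        qed
      qed
      also have "\<dots> = \<bar>t\<bar> * d + 2 * prob (space M - E)"
        using ind by (simp add: prob_space)
      also have "prob (space M - E) \<le> e / 8" using pE by (simp add: prob_compl)
      finally show ?case using \<open>\<bar>t\<bar> * d \<le> e / 4\<close> \<open>e > 0\<close> by simp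
    qed
  qed
  from tendsto_add[OF this lim] show ?thesis by simp
qed

end

text \<open>Scaling the standard normal law gives one description for both cases of the definition: for
  \<open>v = 0\<close> it collapses to the point mass.\<close>

lemma centered_normal_distr:
  assumes "v \<ge> 0"
  shows "centered_normal v = distr std_normal_distribution borel (\<lambda>x. sqrt v * x)"
proof (cases "v = 0")
  case True
  interpret real_distribution std_normal_distribution by (rule real_dist_normal_dist)
  have "distr std_normal_distribution borel (\<lambda>x. 0) = return borel (0::real)"
    by (rule distr_const) auto
  then show ?thesis using True by (simp add: centered_normal_def)
next
  case False
  interpret real_distribution std_normal_distribution by (rule real_dist_normal_dist)
  have "distributed std_normal_distribution lborel (\<lambda>x. x) std_normal_density"
    unfolding distributed_def by (auto simp: distr_id2 sets_lborel)
  from normal_density_affine[OF this, of "sqrt v" 0] False assms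
  have "distributed std_normal_distribution lborel (\<lambda>x. x * sqrt v) (normal_density 0 (sqrt v))"
    by (simp add: mult.commute)
  then have "distr std_normal_distribution lborel (\<lambda>x. sqrt v * x) = density lborel (normal_density 0 (sqrt v))"
    by (simp add: distributed_def mult.commute)
  moreover have "distr std_normal_distribution lborel (\<lambda>x. sqrt v * x) = distr std_normal_distribution borel (\<lambda>x. sqrt v * x)"
    by (rule distr_cong) auto
  ultimately show ?thesis using False by (simp add: centered_normal_def)
qed

lemma real_distribution_centered_normal:
  assumes "v \<ge> 0"
  shows "real_distribution (centered_normal v)"
proof -
  interpret real_distribution std_normal_distribution by (rule real_dist_normal_dist)
  show ?thesis unfolding centered_normal_distr[OF assms] by (rule real_distribution_distr) simp
qed

lemma char_centered_normal:
  assumes "v \<ge> 0"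
  shows "char (centered_normal v) t = complex_of_real (exp (- (t\<^sup>2 * v / 2)))"
proof -
  have "char (centered_normal v) t = char std_normal_distribution (t * sqrt v)"
    unfolding centered_normal_distr[OF assms] char_def
    by (subst integral_distr) (auto simp: mult.assoc)
  also have "\<dots> = complex_of_real (exp (- (t\<^sup>2 * v / 2)))"
    unfolding char_std_normal_distribution using assms by (simp add: power_mult_distrib)
  finally show ?thesis .
qed

section \<open>Algebra and linearization of the Durbin-Watson statistic\<close>

lemma sum_atLeast1_lessThan: "(\<Sum>k=1..n. f k (k - 1)) = (\<Sum>k<n. f (Suc k) k)" for f :: "nat \<Rightarrow> nat \<Rightarrow> real"
  by (simp add: sum.atLeast1_atMost_eq)

lemma sum_lessThan_shift: "(\<Sum>k<n. f k) = f 0 - f n + (\<Sum>k<n. f (Suc k))" for f :: "nat \<Rightarrow> real"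
  by (induction n) auto

text \<open>The products of a path at lags 0, 1 and 2, from which all statistics below are built. Since
  \<open>0 - 1 = 0\<close> on \<open>nat\<close>, the lag-2 sum starts with the spurious summand \<open>x 1 * x 0\<close>; it does not
  depend on \<open>n\<close> and joins the other boundary terms.\<close>

definition sum0 :: "(nat \<Rightarrow> real) \<Rightarrow> nat \<Rightarrow> real" where "sum0 x n = (\<Sum>k<n. (x k)\<^sup>2)"
definition sum1 :: "(nat \<Rightarrow> real) \<Rightarrow> nat \<Rightarrow> real" where "sum1 x n = (\<Sum>k<n. x (Suc k) * x k)"
definition sum2 :: "(nat \<Rightarrow> real) \<Rightarrow> nat \<Rightarrow> real" where "sum2 x n = (\<Sum>k<n. x (Suc k) * x (k - 1))"

lemma theta_hat_eq: "theta_hat x n = sum1 x n / sum0 x n"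
  unfolding theta_hat_def sum0_def sum1_def
  using sum_atLeast1_lessThan[of "\<lambda>i j. x i * x j"] sum_atLeast1_lessThan[of "\<lambda>i j. (x j)\<^sup>2"] by simp

text \<open>By the normal equation \<open>theta_hat * sum0 = sum1\<close> the term quadratic in \<open>theta_hat\<close> cancels
  half of the cross term. The term \<open>(x n)\<^sup>2\<close> remains because \<open>sum0\<close> stops at \<open>n - 1\<close>.\<close>

lemma sum_residual_squares:
  assumes "sum0 x n \<noteq> 0"
  shows "(\<Sum>k=0..n. (residual x n k)\<^sup>2) = sum0 x n * (1 - (theta_hat x n)\<^sup>2) + (x n)\<^sup>2"
proof -
  define h where "h = theta_hat x n"
  have hA: "h * sum0 x n = sum1 x n" using assms by (simp add: h_def theta_hat_eq)
  have "(\<Sum>k=0..n. (residual x n k)\<^sup>2) = (x 0)\<^sup>2 + (\<Sum>k<n. (x (Suc k) - h * x k)\<^sup>2)"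
    unfolding atLeast0AtMost lessThan_Suc_atMost[symmetric] sum.lessThan_Suc_shift
    by (simp add: residual_def h_def)
  also have "(\<Sum>k<n. (x (Suc k) - h * x k)\<^sup>2)
      = (\<Sum>k<n. (x (Suc k))\<^sup>2) - 2 * h * sum1 x n + h\<^sup>2 * sum0 x n"
    unfolding sum0_def sum1_def sum_distrib_left sum_subtractf[symmetric] sum.distrib[symmetric]
    by (rule sum.cong) (auto simp: power2_eq_square algebra_simps)
  also have "(\<Sum>k<n. (x (Suc k))\<^sup>2) = sum0 x n - (x 0)\<^sup>2 + (x n)\<^sup>2"
    using sum_lessThan_shift[of "\<lambda>k. (x k)\<^sup>2" n] by (simp add: sum0_def)
  finally show ?thesis unfolding hA[symmetric] h_def[symmetric] by (simp add: power2_eq_square algebra_simps)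
qed

lemma sum_residual_products:
  assumes "sum0 x n \<noteq> 0"
  defines "h \<equiv> theta_hat x n"
  shows "(\<Sum>k<n. residual x n (Suc k) * residual x n k)
    = h\<^sup>2 * sum1 x n - h * sum2 x n - h\<^sup>2 * (x n * x (n - 1)) + h * (x 0 * x 1)"
proof -
  have "n > 0" using assms(1) by (cases n) (auto simp: sum0_def)
  have hA: "h * sum0 x n = sum1 x n" using assms(1) by (simp add: h_def theta_hat_eq)
  \<comment> \<open>The residual at 0 is \<open>x 0\<close>, not \<open>x 0 - h * x (0 - 1)\<close>; the summand \<open>k = 0\<close> compensates this.\<close>
  have "(\<Sum>k<n. residual x n (Suc k) * residual x n k)
      = (\<Sum>k<n. (x (Suc k) - h * x k) * (x k - h * x (k - 1)) + (if k = 0 then h * x 0 * (x 1 - h * x 0) else 0))"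
    by (rule sum.cong) (auto simp: residual_def h_def algebra_simps)
  also have "\<dots> = (\<Sum>k<n. (x (Suc k) - h * x k) * (x k - h * x (k - 1))) + h * x 0 * (x 1 - h * x 0)"
    using \<open>n > 0\<close> by (simp add: sum.distrib)
  also have "(\<Sum>k<n. (x (Suc k) - h * x k) * (x k - h * x (k - 1)))
      = sum1 x n - h * sum2 x n - h * sum0 x n + h\<^sup>2 * (\<Sum>k<n. x k * x (k - 1))"
    unfolding sum0_def sum1_def sum2_def sum_distrib_left sum_subtractf[symmetric] sum.distrib[symmetric]
    by (rule sum.cong) (auto simp: power2_eq_square algebra_simps)
  also have "(\<Sum>k<n. x k * x (k - 1)) = sum1 x n - x n * x (n - 1) + x 0 * x 0"
    using sum_lessThan_shift[of "\<lambda>k. x k * x (k - 1)" n] by (simp add: sum1_def)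
  finally show ?thesis unfolding hA by (simp add: power2_eq_square algebra_simps)
qed

text \<open>Expanding the squares in the numerator gives twice the denominator, minus twice the lag-1 products
  of the residuals, minus the squares of the two end residuals.\<close>

lemma durbin_watson_eq:
  assumes "sum0 x n \<noteq> 0" "(\<Sum>k=0..n. (residual x n k)\<^sup>2) \<noteq> 0"
  shows "durbin_watson x n = 2 - (2 * (\<Sum>k<n. residual x n (Suc k) * residual x n k) +
     (x 0)\<^sup>2 + (x n - theta_hat x n * x (n - 1))\<^sup>2) / (\<Sum>k=0..n. (residual x n k)\<^sup>2)"
proof -
  let ?r = "residual x n" and ?J = "\<Sum>k=0..n. (residual x n k)\<^sup>2"
  have "n > 0" using assms(1) by (cases n) (auto simp: sum0_def)
  have J: "?J = (\<Sum>k<n. (?r k)\<^sup>2) + (?r n)\<^sup>2"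
    by (simp add: atLeast0AtMost lessThan_Suc_atMost[symmetric])
  have "(\<Sum>k=1..n. (?r k - ?r (k - 1))\<^sup>2) = (\<Sum>k<n. (?r (Suc k) - ?r k)\<^sup>2)"
    by (rule sum_atLeast1_lessThan)
  also have "\<dots> = (\<Sum>k<n. (?r (Suc k))\<^sup>2) + (\<Sum>k<n. (?r k)\<^sup>2) - 2 * (\<Sum>k<n. ?r (Suc k) * ?r k)"
    unfolding sum_distrib_left sum_subtractf[symmetric] sum.distrib[symmetric]
    by (rule sum.cong) (auto simp: power2_eq_square algebra_simps)
  also have "(\<Sum>k<n. (?r (Suc k))\<^sup>2) = (\<Sum>k<n. (?r k)\<^sup>2) - (?r 0)\<^sup>2 + (?r n)\<^sup>2"
    using sum_lessThan_shift[of "\<lambda>k. (?r k)\<^sup>2" n] by simp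
  finally have "(\<Sum>k=1..n. (?r k - ?r (k - 1))\<^sup>2)
      = 2 * ?J - (2 * (\<Sum>k<n. ?r (Suc k) * ?r k) + (?r 0)\<^sup>2 + (?r n)\<^sup>2)"
    using J by simp
  moreover have "?r 0 = x 0" "?r n = x n - theta_hat x n * x (n - 1)"
    using \<open>n > 0\<close> by (auto simp: residual_def)
  ultimately show ?thesis unfolding durbin_watson_def using assms(2) by (simp add: diff_divide_distrib)
qed


text \<open>The statistic is a function of the two ratios \<open>sum1 / sum0\<close> and \<open>sum2 / sum0\<close>, expanded here around
  \<open>r\<^sub>1\<close> and \<open>r\<^sub>2\<close>. The assumption on \<open>r\<close> says that the zeroth order term vanishes, and the factor of
  \<open>- 2\<close> in the first line is linear in the centred sums \<open>b\<close> and \<open>c\<close>. As \<open>b = \<delta> * sum0\<close> exactly, the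
  terms with \<open>\<delta>\<close> are of second order: with \<open>b\<close> and \<open>c\<close> of size \<open>sqrt n\<close>, \<open>\<delta>\<close> has size \<open>1 / sqrt n\<close>
  and these products stay bounded.\<close>

lemma durbin_watson_expansion:
  fixes x :: "nat \<Rightarrow> real" and r\<^sub>1 r\<^sub>2 r :: real
  assumes A: "sum0 x n \<noteq> 0" and J: "(\<Sum>k=0..n. (residual x n k)\<^sup>2) \<noteq> 0"
    and r: "r\<^sub>1 ^ 3 - r\<^sub>1 * r\<^sub>2 = r * (1 - r\<^sub>1\<^sup>2)"
  defines "b \<equiv> sum1 x n - r\<^sub>1 * sum0 x n" and "c \<equiv> sum2 x n - r\<^sub>2 * sum0 x n"
    and "h \<equiv> theta_hat x n"
  defines "\<delta> \<equiv> h - r\<^sub>1"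
  shows "(durbin_watson x n - 2 * (1 - r)) * (\<Sum>k=0..n. (residual x n k)\<^sup>2)
    = - 2 * ((3 * r\<^sub>1\<^sup>2 + 2 * r * r\<^sub>1 - r\<^sub>2) * b - r\<^sub>1 * c)
      - 2 * ((3 * r\<^sub>1 + r) * (b * \<delta>) + b * \<delta> * \<delta> - c * \<delta>
          - h\<^sup>2 * (x n * x (n - 1)) + h * (x 0 * x 1) - r * (x n)\<^sup>2)
      - (x 0)\<^sup>2 - (x n - h * x (n - 1))\<^sup>2"
proof -
  let ?J = "\<Sum>k=0..n. (residual x n k)\<^sup>2" and ?I = "\<Sum>k<n. residual x n (Suc k) * residual x n k"
  define a where "a = sum0 x n"
  have a: "h * a = sum1 x n" using A by (simp add: h_def theta_hat_eq a_def)
  then have b: "b = \<delta> * a" by (simp add: b_def \<delta>_def a_def algebra_simps)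
  have h: "h = r\<^sub>1 + \<delta>" by (simp add: \<delta>_def)
  have "(durbin_watson x n - 2 * (1 - r)) * ?J
      = - 2 * (?I - r * ?J) - (x 0)\<^sup>2 - (x n - h * x (n - 1))\<^sup>2"
    using J unfolding durbin_watson_eq[OF A J] h_def by (simp add: field_simps)
  also have "?I - r * ?J = h\<^sup>2 * (h * a) - h * (r\<^sub>2 * a + c) - r * (a * (1 - h\<^sup>2))
      - h\<^sup>2 * (x n * x (n - 1)) + h * (x 0 * x 1) - r * (x n)\<^sup>2"
    unfolding sum_residual_squares[OF A] sum_residual_products[OF A] h_def[symmetric] a
    by (simp add: c_def a_def algebra_simps)
  also have "h\<^sup>2 * (h * a) - h * (r\<^sub>2 * a + c) - r * (a * (1 - h\<^sup>2))
      = a * (r\<^sub>1 ^ 3 - r\<^sub>1 * r\<^sub>2 - r * (1 - r\<^sub>1\<^sup>2))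
        + (3 * r\<^sub>1\<^sup>2 + 2 * r * r\<^sub>1 - r\<^sub>2) * b - r\<^sub>1 * c
        + (3 * r\<^sub>1 + r) * (b * \<delta>) + b * \<delta> * \<delta> - c * \<delta>"
    unfolding b h by (simp add: power2_eq_square power3_eq_cube algebra_simps)
  finally show ?thesis using r by (simp add: algebra_simps)
qed

context prob_space
begin

lemma O_prob_le:
  assumes "O_prob Z" "\<And>n \<omega>. \<omega> \<in> space M \<Longrightarrow> \<bar>W n \<omega>\<bar> \<le> \<bar>Z n \<omega>\<bar>"
  shows "O_prob W"
  by (rule O_prob_mono[OF assms(1) likely_eventually]) (use assms(2) in auto)

lemma O_prob_scale: "O_prob Z \<Longrightarrow> O_prob (\<lambda>n \<omega>. c * Z n \<omega>)"
  by (rule O_prob_mult[OF O_prob_const])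

lemma o_prob_scale: "o_prob Z \<Longrightarrow> o_prob (\<lambda>n \<omega>. c * Z n \<omega>)"
  using o_prob_mult_O_prob[OF _ O_prob_const, of Z c] by (simp add: mult.commute)

lemma O_prob_div_real: "O_prob Z \<Longrightarrow> o_prob (\<lambda>n \<omega>. Z n \<omega> / real n)"
  using o_prob_mult_O_prob[OF o_prob_tendsto[OF lim_inverse_n], of Z] by (simp add: field_simps)

lemma O_prob_of_o_prob_diff: "o_prob (\<lambda>n \<omega>. Z n \<omega> - c) \<Longrightarrow> O_prob Z"
  using O_prob_add[OF o_prob_imp_O_prob O_prob_const, of "\<lambda>n \<omega>. Z n \<omega> - c" c] by simp

lemma likely_gt0: "likely (\<lambda>n \<omega>. n > 0)"
  by (rule likely_eventually) (use eventually_gt_at_top[of 0] in \<open>auto elim: eventually_mono\<close>)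

text \<open>The delta method for the Durbin-Watson statistic. It needs of the process only that single values
  are bounded in probability, a law of large numbers for \<open>sum0\<close>, and that the centred lag sums are
  linear in two sequences \<open>N\<^sub>1\<close>, \<open>N\<^sub>2\<close> of size \<open>sqrt n\<close> up to bounded errors.
  The number \<open>j\<close> is the limit of the mean squared residual, by which the numerator is divided.\<close>

theorem durbin_watson_linearization:
  fixes X N\<^sub>1 N\<^sub>2 :: "nat \<Rightarrow> 'a \<Rightarrow> real" and g r\<^sub>1 r\<^sub>2 r \<beta> \<gamma> :: real
  defines "A \<equiv> \<lambda>n \<omega>. sum0 (\<lambda>k. X k \<omega>) n"
    and "B \<equiv> \<lambda>n \<omega>. sum1 (\<lambda>k. X k \<omega>) n - r\<^sub>1 * sum0 (\<lambda>k. X k \<omega>) n"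
    and "C \<equiv> \<lambda>n \<omega>. sum2 (\<lambda>k. X k \<omega>) n - r\<^sub>2 * sum0 (\<lambda>k. X k \<omega>) n"
  assumes X: "O_prob (\<lambda>n \<omega>. X n \<omega>)" "O_prob (\<lambda>n \<omega>. X (n - 1) \<omega>)" "O_prob (\<lambda>n \<omega>. X 0 \<omega>)" "O_prob (\<lambda>n \<omega>. X 1 \<omega>)"
    and lln: "o_prob (\<lambda>n \<omega>. A n \<omega> / real n - g)" and g: "g > 0" and r1: "r\<^sub>1\<^sup>2 \<noteq> 1"
    and r: "r\<^sub>1 ^ 3 - r\<^sub>1 * r\<^sub>2 = r * (1 - r\<^sub>1\<^sup>2)"
    and N: "O_prob (\<lambda>n \<omega>. N\<^sub>1 n \<omega> / sqrt (real n))" "O_prob (\<lambda>n \<omega>. N\<^sub>2 n \<omega> / sqrt (real n))"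
    and B: "O_prob (\<lambda>n \<omega>. B n \<omega> - \<beta> * N\<^sub>1 n \<omega>)"
    and C: "O_prob (\<lambda>n \<omega>. C n \<omega> - (\<gamma> * N\<^sub>1 n \<omega> + N\<^sub>2 n \<omega>))"
  defines "j \<equiv> g * (1 - r\<^sub>1\<^sup>2)"
  defines "p \<equiv> - 2 * ((3 * r\<^sub>1\<^sup>2 + 2 * r * r\<^sub>1 - r\<^sub>2) * \<beta> - r\<^sub>1 * \<gamma>) / j" and "q \<equiv> 2 * r\<^sub>1 / j"
  shows "o_prob (\<lambda>n \<omega>. sqrt (real n) * (durbin_watson (\<lambda>k. X k \<omega>) n - 2 * (1 - r))
    - (p * N\<^sub>1 n \<omega> + q * N\<^sub>2 n \<omega>) / sqrt (real n))"
proof -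
  let ?s = "\<lambda>n::nat. sqrt (real n)"
  have "j \<noteq> 0" using g r1 by (simp add: j_def)
  have "g \<noteq> 0" using g by simp
  define h where "h n \<omega> = theta_hat (\<lambda>k. X k \<omega>) n" for n \<omega>
  define \<delta> where "\<delta> n \<omega> = h n \<omega> - r\<^sub>1" for n \<omega>
  define J where "J n \<omega> = (\<Sum>k=0..n. (residual (\<lambda>k. X k \<omega>) n k)\<^sup>2)" for n \<omega>
  define \<kappa> where "\<kappa> = 3 * r\<^sub>1\<^sup>2 + 2 * r * r\<^sub>1 - r\<^sub>2"
  have Bs: "O_prob (\<lambda>n \<omega>. B n \<omega> / ?s n)"
    using O_prob_add[OF o_prob_imp_O_prob[OF O_prob_div_sqrt[OF B]] O_prob_scale[OF N(1), of \<beta>]]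
    by (simp add: diff_divide_distrib)
  have Cs: "O_prob (\<lambda>n \<omega>. C n \<omega> / ?s n)"
    using O_prob_add[OF o_prob_imp_O_prob[OF O_prob_div_sqrt[OF C]]
        O_prob_add[OF O_prob_scale[OF N(1), of \<gamma>] N(2)]]
    by (simp add: diff_divide_distrib add_divide_distrib)
  have A0: "likely (\<lambda>n \<omega>. A n \<omega> \<noteq> 0 \<and> n > 0)"
    by (rule likely_mono[OF likely_conj[OF o_prob_nonzero[OF lln \<open>g \<noteq> 0\<close>] likely_gt0]]) (use g in auto)
  have invA: "O_prob (\<lambda>n \<omega>. 1 / (A n \<omega> / real n))"
    by (rule O_prob_of_o_prob_diff[OF o_prob_inverse[OF lln \<open>g \<noteq> 0\<close>]])
  have \<delta>s: "O_prob (\<lambda>n \<omega>. \<delta> n \<omega> * ?s n)"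
  proof (rule O_prob_cong[OF O_prob_mult[OF Bs invA]], rule likely_mono[OF A0])
    fix n \<omega> assume *: "A n \<omega> \<noteq> 0 \<and> n > 0"
    then have "\<delta> n \<omega> = B n \<omega> / A n \<omega>"
      by (simp add: \<delta>_def h_def theta_hat_eq A_def B_def field_simps)
    moreover define s where "s = ?s n"
    moreover have "s > 0" "real n = s * s" using * by (auto simp: s_def)
    ultimately show "\<delta> n \<omega> * ?s n = B n \<omega> / ?s n * (1 / (A n \<omega> / real n))"
      using * by simp
  qed
  have \<delta>o: "o_prob \<delta>"
    by (rule o_prob_cong[OF O_prob_div_sqrt[OF \<delta>s] likely_mono[OF likely_gt0]]) auto
  note \<delta>O = o_prob_imp_O_prob[OF \<delta>o]
  have hO: "O_prob h" by (rule O_prob_of_o_prob_diff[of _ r\<^sub>1]) (use \<delta>o in \<open>simp add: \<delta>_def[abs_def]\<close>)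
  have B\<delta>: "O_prob (\<lambda>n \<omega>. B n \<omega> * \<delta> n \<omega>)" and C\<delta>: "O_prob (\<lambda>n \<omega>. C n \<omega> * \<delta> n \<omega>)"
    by (rule O_prob_cong[OF O_prob_mult[OF Bs \<delta>s] likely_mono[OF likely_gt0]], simp)
      (rule O_prob_cong[OF O_prob_mult[OF Cs \<delta>s] likely_mono[OF likely_gt0]], simp)
  define R where "R n \<omega> = - 2 * ((3 * r\<^sub>1 + r) * (B n \<omega> * \<delta> n \<omega>) + B n \<omega> * \<delta> n \<omega> * \<delta> n \<omega> - C n \<omega> * \<delta> n \<omega>
          - (h n \<omega>)\<^sup>2 * (X n \<omega> * X (n - 1) \<omega>) + h n \<omega> * (X 0 \<omega> * X 1 \<omega>) - r * (X n \<omega>)\<^sup>2)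
      - (X 0 \<omega>)\<^sup>2 - (X n \<omega> - h n \<omega> * X (n - 1) \<omega>)\<^sup>2" for n \<omega>
  have RO: "O_prob R" unfolding R_def
    by (intro O_prob_diff O_prob_add O_prob_scale O_prob_mult[OF B\<delta> \<delta>O] B\<delta> C\<delta>
        O_prob_mult[OF O_prob_power2[OF hO] O_prob_mult[OF X(1,2)]] O_prob_mult[OF hO O_prob_mult[OF X(3,4)]]
        O_prob_power2 X O_prob_mult[OF hO X(2)])
  define G where "G n \<omega> = - 2 * (\<kappa> * B n \<omega> - r\<^sub>1 * C n \<omega>) + R n \<omega>" for n \<omega>
  have expansion: "(durbin_watson (\<lambda>k. X k \<omega>) n - 2 * (1 - r)) * J n \<omega> = G n \<omega>"
    if "A n \<omega> \<noteq> 0" "J n \<omega> \<noteq> 0" for n \<omega>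
    using durbin_watson_expansion[OF that[unfolded A_def J_def] r]
    unfolding G_def R_def B_def C_def h_def \<delta>_def J_def \<kappa>_def by linarith
  have GN: "O_prob (\<lambda>n \<omega>. G n \<omega> - j * (p * N\<^sub>1 n \<omega> + q * N\<^sub>2 n \<omega>))"
  proof -
    have jp: "j * p = - 2 * (\<kappa> * \<beta> - r\<^sub>1 * \<gamma>)" "j * q = 2 * r\<^sub>1"
      using \<open>j \<noteq> 0\<close> by (simp_all add: p_def q_def \<kappa>_def)
    have "G n \<omega> - j * (p * N\<^sub>1 n \<omega> + q * N\<^sub>2 n \<omega>)
        = - 2 * \<kappa> * (B n \<omega> - \<beta> * N\<^sub>1 n \<omega>) + 2 * r\<^sub>1 * (C n \<omega> - (\<gamma> * N\<^sub>1 n \<omega> + N\<^sub>2 n \<omega>)) + R n \<omega>" for n \<omega>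
    proof -
      have "j * (p * N\<^sub>1 n \<omega> + q * N\<^sub>2 n \<omega>) = (j * p) * N\<^sub>1 n \<omega> + (j * q) * N\<^sub>2 n \<omega>"
        by (simp add: algebra_simps)
      then show ?thesis unfolding jp G_def by (simp add: algebra_simps)
    qed
    then show ?thesis by (simp only:) (intro O_prob_add O_prob_scale B C RO)
  qed
  have Gs: "O_prob (\<lambda>n \<omega>. G n \<omega> / ?s n)"
    using O_prob_add[OF o_prob_imp_O_prob[OF O_prob_div_sqrt[OF GN]]
      O_prob_add[OF O_prob_scale[OF N(1), of "j * p"] O_prob_scale[OF N(2), of "j * q"]]]
    by (simp add: diff_divide_distrib add_divide_distrib algebra_simps)
  have Jo: "o_prob (\<lambda>n \<omega>. J n \<omega> / real n - j)"
  proof (rule o_prob_cong)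
    show "o_prob (\<lambda>n \<omega>. (A n \<omega> / real n - g) * (1 - (h n \<omega>)\<^sup>2)
        + (- g) * (\<delta> n \<omega> * (h n \<omega> + r\<^sub>1)) + (X n \<omega>)\<^sup>2 / real n)"
      by (intro o_prob_add o_prob_scale o_prob_mult_O_prob[OF lln] o_prob_mult_O_prob[OF \<delta>o]
          O_prob_diff O_prob_add O_prob_const O_prob_power2 hO O_prob_div_real X)
    show "likely (\<lambda>n \<omega>. J n \<omega> / real n - j = (A n \<omega> / real n - g) * (1 - (h n \<omega>)\<^sup>2)
        + (- g) * (\<delta> n \<omega> * (h n \<omega> + r\<^sub>1)) + (X n \<omega>)\<^sup>2 / real n)"
    proof (rule likely_mono[OF A0])
      fix n \<omega> assume *: "A n \<omega> \<noteq> 0 \<and> n > 0"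
      have "J n \<omega> = A n \<omega> * (1 - (h n \<omega>)\<^sup>2) + (X n \<omega>)\<^sup>2"
        using sum_residual_squares[of "\<lambda>k. X k \<omega>" n] * by (simp add: J_def A_def h_def)
      then have "J n \<omega> / real n = A n \<omega> / real n * (1 - (h n \<omega>)\<^sup>2) + (X n \<omega>)\<^sup>2 / real n"
        by (simp add: add_divide_distrib)
      then show "J n \<omega> / real n - j = (A n \<omega> / real n - g) * (1 - (h n \<omega>)\<^sup>2)
        + (- g) * (\<delta> n \<omega> * (h n \<omega> + r\<^sub>1)) + (X n \<omega>)\<^sup>2 / real n"
        by (simp add: j_def \<delta>_def power2_eq_square algebra_simps)
    qed
  qed
  have main: "o_prob (\<lambda>n \<omega>. (1 / (J n \<omega> / real n) - 1 / j) * (G n \<omega> / ?s n)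
      + 1 / j * ((G n \<omega> - j * (p * N\<^sub>1 n \<omega> + q * N\<^sub>2 n \<omega>)) / ?s n))"
    by (intro o_prob_add o_prob_scale o_prob_mult_O_prob[OF o_prob_inverse[OF Jo \<open>j \<noteq> 0\<close>] Gs] O_prob_div_sqrt GN)
  show ?thesis
  proof (rule o_prob_cong[OF main], rule likely_mono[OF likely_conj[OF A0 o_prob_nonzero[OF Jo \<open>j \<noteq> 0\<close>]]])
    fix n \<omega> assume *: "(A n \<omega> \<noteq> 0 \<and> n > 0) \<and> \<bar>J n \<omega> / real n\<bar> \<ge> \<bar>j\<bar> / 2"
    then have "J n \<omega> \<noteq> 0" using \<open>j \<noteq> 0\<close> by auto
    define s where "s = ?s n"
    have s: "s > 0" "real n = s * s" using * by (auto simp: s_def)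
    have D: "durbin_watson (\<lambda>k. X k \<omega>) n - 2 * (1 - r) = G n \<omega> / J n \<omega>"
      using expansion[of n \<omega>] * \<open>J n \<omega> \<noteq> 0\<close> by (simp add: eq_divide_eq)
    show "?s n * (durbin_watson (\<lambda>k. X k \<omega>) n - 2 * (1 - r)) - (p * N\<^sub>1 n \<omega> + q * N\<^sub>2 n \<omega>) / ?s n
      = (1 / (J n \<omega> / real n) - 1 / j) * (G n \<omega> / ?s n)
        + 1 / j * ((G n \<omega> - j * (p * N\<^sub>1 n \<omega> + q * N\<^sub>2 n \<omega>)) / ?s n)"
      unfolding D s_def[symmetric] s(2) using s(1) \<open>j \<noteq> 0\<close> \<open>J n \<omega> \<noteq> 0\<close>
      by (simp add: field_simps)
  qed
qed

end

section \<open>Independent noise and uniformly bounded moments\<close>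

lemma abs_power4_sum_le: "\<bar>a + b\<bar> ^ 4 \<le> 8 * \<bar>a::real\<bar> ^ 4 + 8 * \<bar>b\<bar> ^ 4"
proof -
  have sq: "(x + y)\<^sup>2 \<le> 2 * x\<^sup>2 + 2 * y\<^sup>2" for x y :: real
    using zero_le_power2[of "x - y"] by (simp add: power2_eq_square algebra_simps)
  have "((a + b)\<^sup>2)\<^sup>2 \<le> (2 * a\<^sup>2 + 2 * b\<^sup>2)\<^sup>2"
    by (intro power_mono sq) auto
  also have "\<dots> \<le> 2 * (2 * a\<^sup>2)\<^sup>2 + 2 * (2 * b\<^sup>2)\<^sup>2" by (rule sq)
  finally show ?thesis by (simp add: power_even_abs power_mult_distrib flip: power_mult)
qed

text \<open>Convexity of the fourth power, applied to \<open>a\<close> with weight \<open>l\<close> and to \<open>b / (1 - l)\<close> with weight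
  \<open>1 - l\<close>. Keeping the factor \<open>l < 1\<close> in front of \<open>a\<close> is what makes moments of a stable
  autoregression bounded.\<close>

lemma power4_convex_combination:
  fixes a b l :: real
  assumes "0 \<le> l" "l < 1"
  shows "\<bar>l * a + b\<bar> ^ 4 \<le> l * \<bar>a\<bar> ^ 4 + \<bar>b\<bar> ^ 4 / (1 - l) ^ 3"
proof -
  define c where "c = b / (1 - l)"
  have b: "b = (1 - l) * c" using assms by (simp add: c_def)
  have sq: "(l * x + (1 - l) * y)\<^sup>2 \<le> l * x\<^sup>2 + (1 - l) * y\<^sup>2" for x y :: real
  proof -
    have "l * x\<^sup>2 + (1 - l) * y\<^sup>2 - (l * x + (1 - l) * y)\<^sup>2 = l * (1 - l) * (x - y)\<^sup>2"
      by (simp add: power2_eq_square algebra_simps)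
    also have "\<dots> \<ge> 0" using assms by simp
    finally show ?thesis by simp
  qed
  have "((l * a + (1 - l) * c)\<^sup>2)\<^sup>2 \<le> (l * a\<^sup>2 + (1 - l) * c\<^sup>2)\<^sup>2"
    using assms by (intro power_mono sq) auto
  also have "\<dots> \<le> l * (a\<^sup>2)\<^sup>2 + (1 - l) * (c\<^sup>2)\<^sup>2" by (rule sq)
  finally have "(l * a + b) ^ 4 \<le> l * a ^ 4 + (1 - l) * c ^ 4" by (simp add: b flip: power_mult)
  also have "(1 - l) * c ^ 4 = b ^ 4 / (1 - l) ^ 3"
    using assms by (simp add: c_def power_divide power4_eq_xxxx power3_eq_cube)
  finally show ?thesis by (simp add: power_even_abs)
qed

locale iid_noise = prob_space M for M :: "'a measure" +
  fixes \<xi> :: "nat \<Rightarrow> 'a \<Rightarrow> real" and \<sigma> :: real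
  assumes indep: "indep_vars (\<lambda>_. borel) \<xi> UNIV"
    and ident: "\<And>k. distr M borel (\<xi> k) = distr M borel (\<xi> 0)"
    and fourth: "integrable M (\<lambda>\<omega>. \<xi> 0 \<omega> ^ 4)"
    and mean: "expectation (\<xi> 0) = 0"
    and second: "expectation (\<lambda>\<omega>. (\<xi> 0 \<omega>)\<^sup>2) = \<sigma>\<^sup>2"
begin

lemma noise_measurable [measurable]: "\<xi> k \<in> borel_measurable M"
  using indep by (simp add: indep_vars_def)

lemma
  fixes g :: "real \<Rightarrow> 'b::{banach, second_countable_topology}"
  assumes [measurable]: "g \<in> borel_measurable borel"
  shows expectation_noise: "expectation (\<lambda>\<omega>. g (\<xi> k \<omega>)) = expectation (\<lambda>\<omega>. g (\<xi> 0 \<omega>))"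
    and integrable_noise: "integrable M (\<lambda>\<omega>. g (\<xi> k \<omega>)) \<longleftrightarrow> integrable M (\<lambda>\<omega>. g (\<xi> 0 \<omega>))"
  using ident[of k] by (simp_all flip: integral_distr[of "\<xi> _" M borel g] integrable_distr_eq[of "\<xi> _" M borel g])

text \<open>The information before time \<open>k\<close>. It excludes \<open>\<xi> k\<close>, so that an adapted factor \<open>Z k\<close> is
  independent of the noise \<open>\<xi> k\<close> it is multiplied with.\<close>

definition past :: "nat \<Rightarrow> 'a measure" where
  "past k = vimage_algebra (space M) (\<lambda>\<omega>. \<lambda>j\<in>{..<k}. \<xi> j \<omega>) (PiM {..<k} (\<lambda>_. borel))"

lemma space_past [simp]: "space (past k) = space M"
  by (simp add: past_def)


lemma noise_past: "j < k \<Longrightarrow> \<xi> j \<in> borel_measurable (past k)"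
proof -
  assume "j < k"
  have "(\<lambda>\<omega>. \<lambda>j\<in>{..<k}. \<xi> j \<omega>) \<in> measurable (past k) (PiM {..<k} (\<lambda>_. borel))"
    unfolding past_def by (rule measurable_vimage_algebra1) (auto simp: space_PiM)
  then have "(\<lambda>\<omega>. (\<lambda>j\<in>{..<k}. \<xi> j \<omega>) j) \<in> measurable (past k) borel"
    by (rule measurable_compose[OF _ measurable_component_singleton]) (use \<open>j < k\<close> in auto)
  with \<open>j < k\<close> show ?thesis by (simp add: restrict_def)
qed

lemma measurable_from_past:
  assumes "sigma_algebra (space M) (sets N)" "space N = space M" "\<And>j. j < k \<Longrightarrow> \<xi> j \<in> borel_measurable N"
    and "f \<in> measurable (past k) L"
  shows "f \<in> measurable N L"
proof -
  have "(\<lambda>\<omega>. \<omega>) \<in> measurable N (past k)"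
    unfolding past_def
  proof (rule measurable_vimage_algebra2)
    show "(\<lambda>x. \<lambda>j\<in>{..<k}. \<xi> j x) \<in> N \<rightarrow>\<^sub>M Pi\<^sub>M {..<k} (\<lambda>_. borel)"
      using assms(3) by (intro measurable_restrict) auto
  qed (use assms(2) in simp)
  from measurable_compose[OF this assms(4)] show ?thesis by simp
qed

lemma past_measurable: "f \<in> measurable (past k) L \<Longrightarrow> f \<in> measurable M L"
  by (rule measurable_from_past) (auto intro: sets.sigma_algebra_axioms)

lemma past_mono:
  assumes "j \<le> k" "f \<in> measurable (past j) L"
  shows "f \<in> measurable (past k) L"
  by (rule measurable_from_past[OF _ _ _ assms(2)])
    (use assms sets.sigma_algebra_axioms[of "past k"] in \<open>auto intro: noise_past\<close>)

text \<open>\<open>past k\<close> is generated by the block of noise variables below \<open>k\<close>, and disjoint blocks of an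
  independent family are independent.\<close>

lemma indep_var_past:
  fixes Z :: "'a \<Rightarrow> 'b" and g :: "real \<Rightarrow> 'b"
  assumes Z: "Z \<in> measurable (past k) N" and g: "g \<in> measurable borel L"
  shows "indep_var N Z L (\<lambda>\<omega>. g (\<xi> k \<omega>))"
proof -
  let ?R = "\<lambda>A \<omega>. restrict (\<lambda>i. \<xi> i \<omega>) A" and ?P = "\<lambda>A. PiM A (\<lambda>_. borel :: real measure)"
  have "indep_var (?P {..<k}) (?R {..<k}) (?P {k}) (?R {k})"
    by (rule indep_var_restrict[OF indep]) auto
  then have 1: "indep_set (sigma_sets (space M) {?R {..<k} -` A \<inter> space M |A. A \<in> sets (?P {..<k})})
      (sigma_sets (space M) {?R {k} -` A \<inter> space M |A. A \<in> sets (?P {k})})"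
    unfolding indep_var_eq by auto
  have gk: "(\<lambda>f. g (f k)) \<in> measurable (?P {k}) L"
    using measurable_compose[OF measurable_component_singleton[of k "{k}" "\<lambda>_. borel"] g] by simp
  have 2: "random_variable L (\<lambda>\<omega>. g (\<xi> k \<omega>))" by (rule measurable_compose[OF noise_measurable g])
  have "{(\<lambda>\<omega>. g (\<xi> k \<omega>)) -` A \<inter> space M |A. A \<in> sets L}
      \<subseteq> {?R {k} -` A \<inter> space M |A. A \<in> sets (?P {k})}"
  proof clarify
    fix A assume "A \<in> sets L"
    have "(\<lambda>\<omega>. g (\<xi> k \<omega>)) -` A \<inter> space M
        = ?R {k} -` ((\<lambda>f. g (f k)) -` A \<inter> space (?P {k})) \<inter> space M"
      by (auto simp: space_PiM)
    then show "\<exists>B. (\<lambda>\<omega>. g (\<xi> k \<omega>)) -` A \<inter> space M = ?R {k} -` B \<inter> space M \<and> B \<in> sets (?P {k})"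
      using measurable_sets[OF gk \<open>A \<in> sets L\<close>] by blast
  qed
  then have 3: "sigma_sets (space M) {(\<lambda>\<omega>. g (\<xi> k \<omega>)) -` A \<inter> space M |A. A \<in> sets L}
      \<subseteq> sigma_sets (space M) {?R {k} -` A \<inter> space M |A. A \<in> sets (?P {k})}"
    by (rule sigma_sets_mono')
  have past: "sets (past k) = sigma_sets (space M) {?R {..<k} -` A \<inter> space M |A. A \<in> sets (?P {..<k})}"
    unfolding past_def sets_vimage_algebra by simp
  have "sigma_sets (space M) {Z -` A \<inter> space M |A. A \<in> sets N} \<subseteq> sets (past k)"
  proof -
    have "{Z -` A \<inter> space M |A. A \<in> sets N} \<subseteq> sets (past k)"
      using measurable_sets[OF Z] by auto
    then show ?thesis using sets.sigma_sets_subset[of _ "past k"] by simp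
  qed
  with 1 2 3 show ?thesis
    unfolding indep_var_eq indep_sets2_eq past[symmetric] using past_measurable[OF Z] by blast
qed

lemma
  fixes Z :: "'a \<Rightarrow> 'b::{real_normed_field, banach, second_countable_topology}"
  assumes Z: "Z \<in> borel_measurable (past k)" "integrable M Z"
    and g: "g \<in> borel_measurable borel" "integrable M (\<lambda>\<omega>. g (\<xi> 0 \<omega>))"
  shows integrable_past_mult: "integrable M (\<lambda>\<omega>. Z \<omega> * g (\<xi> k \<omega>))"
    and expectation_past_mult:
      "expectation (\<lambda>\<omega>. Z \<omega> * g (\<xi> k \<omega>)) = expectation Z * expectation (\<lambda>\<omega>. g (\<xi> 0 \<omega>))"
proof -
  have "integrable M (\<lambda>\<omega>. g (\<xi> k \<omega>))" by (rule iffD2[OF integrable_noise[OF g(1)] g(2)])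
  note * = indep_var_past[OF Z(1) g(1)] Z(2) this
  show "integrable M (\<lambda>\<omega>. Z \<omega> * g (\<xi> k \<omega>))" by (rule indep_var_integrable[OF *])
  show "expectation (\<lambda>\<omega>. Z \<omega> * g (\<xi> k \<omega>)) = expectation Z * expectation (\<lambda>\<omega>. g (\<xi> 0 \<omega>))"
    using indep_var_lebesgue_integral[OF *] expectation_noise[OF g(1), of k] by simp
qed

definition adapted :: "(nat \<Rightarrow> 'a \<Rightarrow> real) \<Rightarrow> bool" where
  "adapted Z \<longleftrightarrow> (\<forall>k. Z k \<in> borel_measurable (past k))"

definition L_bounded :: "nat \<Rightarrow> (nat \<Rightarrow> 'a \<Rightarrow> real) \<Rightarrow> bool" where
  "L_bounded p Z \<longleftrightarrow> (\<forall>k. Z k \<in> borel_measurable M) \<and>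
     (\<exists>K. \<forall>k. integrable M (\<lambda>\<omega>. \<bar>Z k \<omega>\<bar> ^ p) \<and> expectation (\<lambda>\<omega>. \<bar>Z k \<omega>\<bar> ^ p) \<le> K)"

lemma L_boundedD:
  assumes "L_bounded p Z"
  shows "\<exists>K\<ge>0. \<forall>k. integrable M (\<lambda>\<omega>. \<bar>Z k \<omega>\<bar> ^ p) \<and> expectation (\<lambda>\<omega>. \<bar>Z k \<omega>\<bar> ^ p) \<le> K"
proof -
  obtain K where K: "\<forall>k. integrable M (\<lambda>\<omega>. \<bar>Z k \<omega>\<bar> ^ p) \<and> expectation (\<lambda>\<omega>. \<bar>Z k \<omega>\<bar> ^ p) \<le> K"
    using assms by (auto simp: L_bounded_def)
  have "0 \<le> expectation (\<lambda>\<omega>. \<bar>Z 0 \<omega>\<bar> ^ p)" by simp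
  also have "\<dots> \<le> K" using K by blast
  finally show ?thesis using K by blast
qed

lemma L_bounded_measurable: "L_bounded p Z \<Longrightarrow> Z k \<in> borel_measurable M"
  by (simp add: L_bounded_def)

text \<open>The common source of the closure properties below: each of them reduces to a pointwise inequality
  between powers.\<close>

lemma L_bounded_dominated:
  assumes "L_bounded p Z" "L_bounded q W" "\<And>k. U k \<in> borel_measurable M" "a \<ge> 0" "b \<ge> 0"
    and "\<And>k \<omega>. \<bar>U k \<omega>\<bar> ^ r \<le> a * \<bar>Z k \<omega>\<bar> ^ p + b * \<bar>W k \<omega>\<bar> ^ q"
  shows "L_bounded r U"
proof -
  obtain K where K: "\<And>k. integrable M (\<lambda>\<omega>. \<bar>Z k \<omega>\<bar> ^ p)" "\<And>k. expectation (\<lambda>\<omega>. \<bar>Z k \<omega>\<bar> ^ p) \<le> K"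
    using L_boundedD[OF assms(1)] by blast
  obtain L where L: "\<And>k. integrable M (\<lambda>\<omega>. \<bar>W k \<omega>\<bar> ^ q)" "\<And>k. expectation (\<lambda>\<omega>. \<bar>W k \<omega>\<bar> ^ q) \<le> L"
    using L_boundedD[OF assms(2)] by blast
  have int: "integrable M (\<lambda>\<omega>. \<bar>U k \<omega>\<bar> ^ r)" for k
    by (rule integrable_dominated[where g="\<lambda>\<omega>. a * \<bar>Z k \<omega>\<bar> ^ p + b * \<bar>W k \<omega>\<bar> ^ q"])
      (use assms K L in auto)
  have "expectation (\<lambda>\<omega>. \<bar>U k \<omega>\<bar> ^ r) \<le> a * K + b * L" for k
  proof -
    have "expectation (\<lambda>\<omega>. \<bar>U k \<omega>\<bar> ^ r) \<le> expectation (\<lambda>\<omega>. a * \<bar>Z k \<omega>\<bar> ^ p + b * \<bar>W k \<omega>\<bar> ^ q)"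
      by (intro integral_mono int assms(6)) (use K L in auto)
    also have "\<dots> = a * expectation (\<lambda>\<omega>. \<bar>Z k \<omega>\<bar> ^ p) + b * expectation (\<lambda>\<omega>. \<bar>W k \<omega>\<bar> ^ q)"
      using K L by simp
    also have "\<dots> \<le> a * K + b * L" using K L assms by (intro add_mono mult_left_mono) auto
    finally show ?thesis .
  qed
  with int assms(3) show ?thesis unfolding L_bounded_def by blast
qed

lemma L_bounded_const: "L_bounded p (\<lambda>k \<omega>. c)"
  by (auto simp: L_bounded_def prob_space)

lemma L_bounded_reindex: "L_bounded p Z \<Longrightarrow> L_bounded p (\<lambda>k. Z (f k))"
  by (auto simp: L_bounded_def)

lemma L_bounded_scale: "L_bounded p Z \<Longrightarrow> L_bounded p (\<lambda>k \<omega>. c * Z k \<omega>)"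
  by (rule L_bounded_dominated[where p=p and q=p and Z=Z and W=Z and a="\<bar>c\<bar> ^ p" and b=0])
    (auto simp: L_bounded_measurable abs_mult power_mult_distrib intro!: borel_measurable_times)

lemma L2_bounded_add:
  assumes "L_bounded 2 Z" "L_bounded 2 W"
  shows "L_bounded 2 (\<lambda>k \<omega>. Z k \<omega> + W k \<omega>)"
proof (rule L_bounded_dominated[OF assms, where a=2 and b=2])
  fix k \<omega>
  show "\<bar>Z k \<omega> + W k \<omega>\<bar>\<^sup>2 \<le> 2 * \<bar>Z k \<omega>\<bar>\<^sup>2 + 2 * \<bar>W k \<omega>\<bar>\<^sup>2"
    using zero_le_power2[of "Z k \<omega> - W k \<omega>"] by (simp add: power2_eq_square algebra_simps)
qed (use assms[THEN L_bounded_measurable] in measurable)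

lemma L4_bounded_add:
  assumes "L_bounded 4 Z" "L_bounded 4 W"
  shows "L_bounded 4 (\<lambda>k \<omega>. Z k \<omega> + W k \<omega>)"
  by (rule L_bounded_dominated[OF assms, where a=8 and b=8])
    (use assms[THEN L_bounded_measurable] abs_power4_sum_le in auto)

lemma abs_mult_le_sum_squares: "\<bar>a * b\<bar> \<le> \<bar>a::real\<bar>\<^sup>2 + \<bar>b\<bar>\<^sup>2"
proof -
  have "2 * (\<bar>a\<bar> * \<bar>b\<bar>) \<le> \<bar>a\<bar>\<^sup>2 + \<bar>b\<bar>\<^sup>2"
    using sum_squares_bound[of "\<bar>a\<bar>" "\<bar>b\<bar>"] by simp
  moreover have "0 \<le> \<bar>a\<bar> * \<bar>b\<bar>" by simp
  ultimately show ?thesis unfolding abs_mult by linarith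
qed

lemma L_bounded_mult:
  assumes "L_bounded (2 * p) Z" "L_bounded (2 * p) W"
  shows "L_bounded p (\<lambda>k \<omega>. Z k \<omega> * W k \<omega>)"
proof (rule L_bounded_dominated[OF assms, where a=1 and b=1])
  fix k \<omega>
  show "\<bar>Z k \<omega> * W k \<omega>\<bar> ^ p \<le> 1 * \<bar>Z k \<omega>\<bar> ^ (2 * p) + 1 * \<bar>W k \<omega>\<bar> ^ (2 * p)"
    using abs_mult_le_sum_squares[of "\<bar>Z k \<omega>\<bar> ^ p" "\<bar>W k \<omega>\<bar> ^ p"]
    by (simp add: abs_mult power_mult_distrib power_mult[symmetric] mult.commute)
qed (use assms[THEN L_bounded_measurable] in measurable)

lemma L4_bounded_mult: "L_bounded 4 Z \<Longrightarrow> L_bounded 4 W \<Longrightarrow> L_bounded 2 (\<lambda>k \<omega>. Z k \<omega> * W k \<omega>)"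
  using L_bounded_mult[of 2 Z W] by simp

lemma power_le_one_plus:
  fixes x :: real assumes "p \<le> q" "x \<ge> 0" shows "x ^ p \<le> 1 + x ^ q"
proof (cases "x \<le> 1")
  case True then show ?thesis using assms power_le_one[of x p] zero_le_power[of x q] by linarith
next
  case False then have "x ^ p \<le> x ^ q" using assms by (intro power_increasing) auto
  then show ?thesis by simp
qed

lemma L_bounded_lower: "L_bounded q Z \<Longrightarrow> p \<le> q \<Longrightarrow> L_bounded p Z"
  by (rule L_bounded_dominated[where p=0 and q=q and Z="\<lambda>_ _. 1" and W=Z and a=1 and b=1])
    (auto simp: L_bounded_measurable L_bounded_const intro: power_le_one_plus)

lemma L_bounded_integrable: "L_bounded p Z \<Longrightarrow> p \<ge> 1 \<Longrightarrow> integrable M (Z k)"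
  using L_bounded_lower[of p Z 1] by (auto simp: L_bounded_def integrable_abs_iff)

lemma L_bounded_noise: "L_bounded 4 \<xi>"
proof -
  have *: "(\<lambda>x::real. \<bar>x\<bar> ^ 4) \<in> borel_measurable borel" by measurable
  have "integrable M (\<lambda>\<omega>. \<bar>\<xi> k \<omega>\<bar> ^ 4)" for k
    by (rule iffD2[OF integrable_noise[OF *]]) (use fourth in \<open>simp add: power_even_abs\<close>)
  moreover have "expectation (\<lambda>\<omega>. \<bar>\<xi> k \<omega>\<bar> ^ 4) \<le> expectation (\<lambda>\<omega>. \<bar>\<xi> 0 \<omega>\<bar> ^ 4)" for k
    by (rule order_eq_refl[OF expectation_noise[OF *]])
  ultimately show ?thesis unfolding L_bounded_def using noise_measurable by blast
qed

text \<open>By convexity the fourth moments satisfy \<open>m (Suc k) \<le> \<bar>l\<bar> * m k + C\<close>, and the fixed point of this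
  contraction bounds them all.\<close>

lemma L4_bounded_autoregression:
  assumes rec: "\<And>k \<omega>. Z (Suc k) \<omega> = l * Z k \<omega> + W k \<omega>" and init: "\<And>\<omega>. Z 0 \<omega> = 0"
    and "\<bar>l\<bar> < 1" and W: "L_bounded 4 W"
  shows "L_bounded 4 Z"
proof -
  obtain K where K: "K \<ge> 0" "\<And>k. integrable M (\<lambda>\<omega>. \<bar>W k \<omega>\<bar> ^ 4)"
    "\<And>k. expectation (\<lambda>\<omega>. \<bar>W k \<omega>\<bar> ^ 4) \<le> K" using L_boundedD[OF W] by blast
  note Wm [measurable] = L_bounded_measurable[OF W]
  define C where "C = K / (1 - \<bar>l\<bar>) ^ 3"
  have "C \<ge> 0" using K assms by (simp add: C_def)
  have Zm[measurable]: "Z k \<in> borel_measurable M" for k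
  proof (induction k)
    case 0
    have "Z 0 = (\<lambda>_. 0)" using init by auto
    then show ?case by simp
  next
    case (Suc k)
    have "(\<lambda>\<omega>. l * Z k \<omega> + W k \<omega>) \<in> borel_measurable M" using Suc by measurable
    moreover have "Z (Suc k) = (\<lambda>\<omega>. l * Z k \<omega> + W k \<omega>)" using rec by auto
    ultimately show ?case by simp
  qed
  have bound: "\<bar>Z (Suc k) \<omega>\<bar> ^ 4 \<le> \<bar>l\<bar> * \<bar>Z k \<omega>\<bar> ^ 4 + \<bar>W k \<omega>\<bar> ^ 4 / (1 - \<bar>l\<bar>) ^ 3" for k \<omega>
  proof -
    have "\<bar>l * Z k \<omega> + W k \<omega>\<bar> ^ 4 \<le> \<bar>\<bar>l\<bar> * \<bar>Z k \<omega>\<bar> + \<bar>W k \<omega>\<bar>\<bar> ^ 4"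
      by (intro power_mono) (auto simp: abs_mult[symmetric] intro: abs_triangle_ineq)
    also have "\<dots> \<le> \<bar>l\<bar> * \<bar>Z k \<omega>\<bar> ^ 4 + \<bar>W k \<omega>\<bar> ^ 4 / (1 - \<bar>l\<bar>) ^ 3"
      using power4_convex_combination[of "\<bar>l\<bar>" "\<bar>Z k \<omega>\<bar>" "\<bar>W k \<omega>\<bar>"] assms by simp
    finally show ?thesis by (simp add: rec)
  qed
  have "integrable M (\<lambda>\<omega>. \<bar>Z k \<omega>\<bar> ^ 4) \<and> expectation (\<lambda>\<omega>. \<bar>Z k \<omega>\<bar> ^ 4) \<le> C / (1 - \<bar>l\<bar>)" for k
  proof (induction k)
    case 0 then show ?case using init \<open>C \<ge> 0\<close> assms by simp
  next
    case (Suc k)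
    have int: "integrable M (\<lambda>\<omega>. \<bar>l\<bar> * \<bar>Z k \<omega>\<bar> ^ 4 + \<bar>W k \<omega>\<bar> ^ 4 / (1 - \<bar>l\<bar>) ^ 3)"
      using Suc K by auto
    have int': "integrable M (\<lambda>\<omega>. \<bar>Z (Suc k) \<omega>\<bar> ^ 4)"
      by (rule integrable_dominated[OF _ int]) (use bound in auto)
    have "expectation (\<lambda>\<omega>. \<bar>Z (Suc k) \<omega>\<bar> ^ 4)
        \<le> expectation (\<lambda>\<omega>. \<bar>l\<bar> * \<bar>Z k \<omega>\<bar> ^ 4 + \<bar>W k \<omega>\<bar> ^ 4 / (1 - \<bar>l\<bar>) ^ 3)"
      by (intro integral_mono int int' bound)
    also have "\<dots> = \<bar>l\<bar> * expectation (\<lambda>\<omega>. \<bar>Z k \<omega>\<bar> ^ 4) + expectation (\<lambda>\<omega>. \<bar>W k \<omega>\<bar> ^ 4) / (1 - \<bar>l\<bar>) ^ 3"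
      using Suc K by simp
    also have "\<dots> \<le> \<bar>l\<bar> * (C / (1 - \<bar>l\<bar>)) + K / (1 - \<bar>l\<bar>) ^ 3"
      using Suc K assms by (intro add_mono mult_left_mono divide_right_mono) auto
    also have "\<dots> = C / (1 - \<bar>l\<bar>)" using assms by (simp add: C_def[symmetric] field_simps)
    finally show ?case using int' by simp
  qed
  then show ?thesis unfolding L_bounded_def using Zm by blast
qed

lemma adapted_autoregression:
  assumes rec: "\<And>k \<omega>. Z (Suc k) \<omega> = l * Z k \<omega> + W k \<omega>" and init: "\<And>\<omega>. Z 0 \<omega> = 0"
    and W: "\<And>k. W k \<in> borel_measurable (past (Suc k))"
  shows "adapted Z"
  unfolding adapted_def
proof
  fix k show "Z k \<in> borel_measurable (past k)"
  proof (induction k)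
    case 0
    have "Z 0 = (\<lambda>_. 0)" using init by auto
    then show ?case by simp
  next
    case (Suc k)
    have "(\<lambda>\<omega>. l * Z k \<omega> + W k \<omega>) \<in> borel_measurable (past (Suc k))"
      using past_mono[OF _ Suc, of "Suc k"] W[of k] by measurable
    moreover have "Z (Suc k) = (\<lambda>\<omega>. l * Z k \<omega> + W k \<omega>)" using rec by auto
    ultimately show ?case by simp
  qed
qed

text \<open>Independence makes the moment of the product the product of the moments. This keeps the exponent
  \<open>p\<close>, whereas the Cauchy-Schwarz inequality would halve it; fourth moments of the noise suffice for
  this reason.\<close>

lemma L_bounded_adapted_mult:
  assumes Z: "adapted Z" "L_bounded p Z" and g: "g \<in> borel_measurable borel" "integrable M (\<lambda>\<omega>. \<bar>g (\<xi> 0 \<omega>)\<bar> ^ p)"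
  shows "L_bounded p (\<lambda>k \<omega>. Z k \<omega> * g (\<xi> k \<omega>))"
proof -
  obtain K where K: "K \<ge> 0" "\<And>k. integrable M (\<lambda>\<omega>. \<bar>Z k \<omega>\<bar> ^ p)"
    "\<And>k. expectation (\<lambda>\<omega>. \<bar>Z k \<omega>\<bar> ^ p) \<le> K" using L_boundedD[OF Z(2)] by blast
  have Zp: "(\<lambda>\<omega>. \<bar>Z k \<omega>\<bar> ^ p) \<in> borel_measurable (past k)" for k
  proof -
    have [measurable]: "Z k \<in> borel_measurable (past k)" using Z(1) by (simp add: adapted_def)
    show ?thesis by measurable
  qed
  have gp: "(\<lambda>x. \<bar>g x\<bar> ^ p) \<in> borel_measurable borel" using g(1) by measurable
  note * = Zp K(2) gp g(2)
  have m: "(\<lambda>\<omega>. Z k \<omega> * g (\<xi> k \<omega>)) \<in> borel_measurable M" for k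
    using L_bounded_measurable[OF Z(2)] g(1) by measurable
  show ?thesis unfolding L_bounded_def abs_mult power_mult_distrib
    using integrable_past_mult[OF *] expectation_past_mult[OF *] K(3) m
    by (auto intro!: exI[of _ "K * expectation (\<lambda>\<omega>. \<bar>g (\<xi> 0 \<omega>)\<bar> ^ p)"] mult_right_mono)
qed

end

section \<open>A central limit theorem for noise with adapted factors\<close>

context iid_noise
begin

lemma adapted_measurable: "adapted Z \<Longrightarrow> Z k \<in> borel_measurable (past k)"
  by (simp add: adapted_def)

lemma innovation_sum_measurable:
  assumes Z: "adapted Z" and g: "g \<in> borel_measurable borel"
  shows "(\<lambda>\<omega>. \<Sum>k<n. Z k \<omega> * g (\<xi> k \<omega>)) \<in> borel_measurable (past n)"
proof (intro borel_measurable_sum borel_measurable_times)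
  fix k assume "k \<in> {..<n}"
  then show "Z k \<in> borel_measurable (past n)" "(\<lambda>\<omega>. g (\<xi> k \<omega>)) \<in> borel_measurable (past n)"
    using past_mono[OF _ adapted_measurable[OF Z], of k n] measurable_compose[OF noise_past g] by auto
qed

text \<open>The summands are orthogonal: \<open>g (\<xi> n)\<close> is centred and independent of everything else in a mixed
  product. The variance of the sum is therefore the sum of the variances.\<close>

lemma innovation_sum_second_moment:
  assumes Z: "adapted Z" "L_bounded 2 Z"
    and g: "g \<in> borel_measurable borel" "integrable M (\<lambda>\<omega>. \<bar>g (\<xi> 0 \<omega>)\<bar>\<^sup>2)"
    and g0: "expectation (\<lambda>\<omega>. g (\<xi> 0 \<omega>)) = 0"
  shows "\<exists>K\<ge>0. \<forall>n. integrable M (\<lambda>\<omega>. (\<Sum>k<n. Z k \<omega> * g (\<xi> k \<omega>))\<^sup>2) \<and>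
     expectation (\<lambda>\<omega>. (\<Sum>k<n. Z k \<omega> * g (\<xi> k \<omega>))\<^sup>2) \<le> real n * K"
proof -
  let ?D = "\<lambda>k \<omega>. Z k \<omega> * g (\<xi> k \<omega>)" and ?T = "\<lambda>n \<omega>. \<Sum>k<n. Z k \<omega> * g (\<xi> k \<omega>)"
  have D: "L_bounded 2 ?D" by (rule L_bounded_adapted_mult[OF Z g])
  then obtain K where K: "K \<ge> 0" "\<And>k. integrable M (\<lambda>\<omega>. \<bar>?D k \<omega>\<bar>\<^sup>2)"
    "\<And>k. expectation (\<lambda>\<omega>. \<bar>?D k \<omega>\<bar>\<^sup>2) \<le> K"
    using L_boundedD[of 2 ?D] by blast
  have g1: "integrable M (\<lambda>\<omega>. g (\<xi> 0 \<omega>))"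
  proof (rule integrable_dominated[where g="\<lambda>\<omega>. 1 + \<bar>g (\<xi> 0 \<omega>)\<bar>\<^sup>2"])
    show "norm (g (\<xi> 0 \<omega>)) \<le> 1 + \<bar>g (\<xi> 0 \<omega>)\<bar>\<^sup>2" for \<omega>
      using power_le_one_plus[of 1 2 "\<bar>g (\<xi> 0 \<omega>)\<bar>"] by simp
  qed (use g in auto)
  have "integrable M (\<lambda>\<omega>. (?T n \<omega>)\<^sup>2) \<and> expectation (\<lambda>\<omega>. (?T n \<omega>)\<^sup>2) \<le> real n * K" for n
  proof (induction n)
    case 0 then show ?case by simp
  next
    case (Suc n)
    have T: "?T n \<in> borel_measurable (past n)" by (rule innovation_sum_measurable[OF Z(1) g(1)])
    have TZ: "(\<lambda>\<omega>. ?T n \<omega> * Z n \<omega>) \<in> borel_measurable (past n)"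
      by (rule borel_measurable_times[OF T adapted_measurable[OF Z(1)]])
    have Z2: "integrable M (\<lambda>\<omega>. \<bar>Z n \<omega>\<bar>\<^sup>2)" using L_boundedD[OF Z(2)] by blast
    have TZ1: "integrable M (\<lambda>\<omega>. ?T n \<omega> * Z n \<omega>)"
    proof (rule integrable_dominated[where g="\<lambda>\<omega>. (?T n \<omega>)\<^sup>2 + \<bar>Z n \<omega>\<bar>\<^sup>2"])
      show "norm (?T n \<omega> * Z n \<omega>) \<le> (?T n \<omega>)\<^sup>2 + \<bar>Z n \<omega>\<bar>\<^sup>2" for \<omega>
        using abs_mult_le_sum_squares[of "?T n \<omega>" "Z n \<omega>"] by (simp only: real_norm_def power2_abs)
    qed (use past_measurable[OF TZ] Suc Z2 in auto)
    have eq: "(?T (Suc n) \<omega>)\<^sup>2 = (?T n \<omega>)\<^sup>2 + 2 * (?T n \<omega> * Z n \<omega> * g (\<xi> n \<omega>)) + \<bar>?D n \<omega>\<bar>\<^sup>2" for \<omega>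
      by (simp add: power2_sum algebra_simps)
    note cross = integrable_past_mult[OF TZ TZ1 g(1) g1] expectation_past_mult[OF TZ TZ1 g(1) g1]
    have int: "integrable M (\<lambda>\<omega>. (?T n \<omega>)\<^sup>2 + 2 * (?T n \<omega> * Z n \<omega> * g (\<xi> n \<omega>)))"
      using Suc.IH cross(1) by (intro Bochner_Integration.integrable_add integrable_mult_right) auto
    have "expectation (\<lambda>\<omega>. (?T n \<omega>)\<^sup>2 + 2 * (?T n \<omega> * Z n \<omega> * g (\<xi> n \<omega>)) + \<bar>?D n \<omega>\<bar>\<^sup>2)
        = expectation (\<lambda>\<omega>. (?T n \<omega>)\<^sup>2 + 2 * (?T n \<omega> * Z n \<omega> * g (\<xi> n \<omega>))) + expectation (\<lambda>\<omega>. \<bar>?D n \<omega>\<bar>\<^sup>2)"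
      by (rule Bochner_Integration.integral_add[OF int K(2)])
    also have "expectation (\<lambda>\<omega>. (?T n \<omega>)\<^sup>2 + 2 * (?T n \<omega> * Z n \<omega> * g (\<xi> n \<omega>))) = expectation (\<lambda>\<omega>. (?T n \<omega>)\<^sup>2)"
      using Suc.IH cross g0 by (subst Bochner_Integration.integral_add) auto
    also have "expectation (\<lambda>\<omega>. (?T n \<omega>)\<^sup>2) + expectation (\<lambda>\<omega>. \<bar>?D n \<omega>\<bar>\<^sup>2) \<le> real n * K + K"
      using Suc.IH K(3)[of n] by (intro add_mono) auto
    also have "\<dots> = real (Suc n) * K" by (simp add: algebra_simps)
    finally show ?case unfolding eq
      using Bochner_Integration.integrable_add[OF int K(2)] by simp
  qed
  with K(1) show ?thesis by blast
qed

lemma L1_le_of_second_moment: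
  assumes "T \<in> borel_measurable M" "integrable M (\<lambda>\<omega>. (T \<omega>)\<^sup>2)" "expectation (\<lambda>\<omega>. (T \<omega>)\<^sup>2) \<le> real n * K"
    "n > 0"
  shows "integrable M T" "expectation (\<lambda>\<omega>. \<bar>T \<omega>\<bar>) \<le> (K + 1) * sqrt (real n)"
proof -
  \<comment> \<open>The inequality \<open>\<bar>T\<bar> \<le> T\<^sup>2 / c + c\<close> is best at the order \<open>c = sqrt n\<close> of \<open>T\<close>.\<close>
  define c where "c = sqrt (real n)"
  have c: "c > 0" "real n = c * c" using assms(4) by (auto simp: c_def)
  have bound: "\<bar>T \<omega>\<bar> \<le> (T \<omega>)\<^sup>2 / c + c" for \<omega>
  proof -
    have "\<bar>T \<omega>\<bar> * c \<le> (T \<omega>)\<^sup>2 + c * c"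
      using abs_mult_le_sum_squares[of "T \<omega>" c] c(1) by (simp add: abs_mult power2_eq_square)
    then have "\<bar>T \<omega>\<bar> \<le> ((T \<omega>)\<^sup>2 + c * c) / c" using c(1) by (simp add: pos_le_divide_eq)
    then show ?thesis using c(1) by (simp add: add_divide_distrib)
  qed
  have int: "integrable M (\<lambda>\<omega>. (T \<omega>)\<^sup>2 / c + c)" using assms(2) by simp
  show T: "integrable M T" by (rule integrable_dominated[OF assms(1) int]) (simp add: bound)
  have "expectation (\<lambda>\<omega>. \<bar>T \<omega>\<bar>) \<le> expectation (\<lambda>\<omega>. (T \<omega>)\<^sup>2 / c + c)"
    by (rule integral_mono[OF integrable_abs[OF T] int bound])
  also have "\<dots> = expectation (\<lambda>\<omega>. (T \<omega>)\<^sup>2) / c + c" using assms(2) by (simp add: prob_space)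
  also have "\<dots> \<le> c * c * K / c + c"
    using assms(3) c by (intro add_right_mono divide_right_mono) auto
  also have "\<dots> = (K + 1) * c" using c(1) by (simp add: algebra_simps)
  finally show "expectation (\<lambda>\<omega>. \<bar>T \<omega>\<bar>) \<le> (K + 1) * sqrt (real n)" by (simp add: c_def)
qed

end

lemma tendsto_0_of_le:
  fixes f g :: "nat \<Rightarrow> real"
  assumes "\<And>n. f n \<ge> 0" "\<And>n. n > 0 \<Longrightarrow> f n \<le> g n" "g \<longlonglongrightarrow> 0"
  shows "f \<longlonglongrightarrow> 0"
proof (rule tendsto_sandwich[OF _ _ tendsto_const assms(3)])
  show "\<forall>\<^sub>F n in sequentially. 0 \<le> f n" using assms(1) by simp
  show "\<forall>\<^sub>F n in sequentially. f n \<le> g n"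
    using eventually_gt_at_top[of 0] by eventually_elim (rule assms(2))
qed

text \<open>The setting of the central limit theorem: sums of \<open>Y k * \<xi> k\<close> with an adapted factor \<open>Y\<close>.\<close>

locale noise_transform = iid_noise +
  fixes Y :: "nat \<Rightarrow> 'a \<Rightarrow> real"
  assumes Y_adapted: "adapted Y" and Y_L4: "L_bounded 4 Y"
begin

text \<open>Its expectation at \<open>k = n\<close> is the characteristic function of the normalized sum. The number \<open>k\<close> of
  summands varies separately from the normalization \<open>n\<close>, so that one summand can be added at a time.\<close>

definition phase :: "real \<Rightarrow> nat \<Rightarrow> nat \<Rightarrow> 'a \<Rightarrow> complex" where
  "phase t n k \<omega> = iexp (t / sqrt (real n) * (\<Sum>j<k. Y j \<omega> * \<xi> j \<omega>))"

definition phase_corr :: "real \<Rightarrow> nat \<Rightarrow> (nat \<Rightarrow> 'a \<Rightarrow> real) \<Rightarrow> nat \<Rightarrow> real" where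
  "phase_corr t n Q k = cmod (expectation (\<lambda>\<omega>. phase t n k \<omega> * of_real (Q k \<omega>)))"

text \<open>Sequences that average out, even when each term is weighted with the phase reached at its time.
  The second clause states the latter and drives the central limit theorem; the last clause is a law
  of large numbers in mean. Both are preserved by the same operations, so one proof of nullity
  serves both purposes.\<close>

definition null :: "(nat \<Rightarrow> 'a \<Rightarrow> real) \<Rightarrow> bool" where
  "null Q \<longleftrightarrow> L_bounded 2 Q \<and>
     (\<forall>t. (\<lambda>n. (\<Sum>k<n. phase_corr t n Q k) / real n) \<longlonglongrightarrow> 0) \<and>
     (\<lambda>n. expectation (\<lambda>\<omega>. \<bar>\<Sum>k<n. Q k \<omega>\<bar>) / real n) \<longlonglongrightarrow> 0"

lemma phase_corr_nonneg: "phase_corr t n Q k \<ge> 0"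
  by (simp add: phase_corr_def)

lemma phase_past: "phase t n k \<in> borel_measurable (past k)"
proof -
  have [measurable]: "(\<lambda>\<omega>. \<Sum>j<k. Y j \<omega> * \<xi> j \<omega>) \<in> borel_measurable (past k)"
    using innovation_sum_measurable[OF Y_adapted, of "\<lambda>x. x" k] by simp
  show ?thesis unfolding phase_def by measurable
qed

lemma phase_measurable [measurable]: "phase t n k \<in> borel_measurable M"
  by (rule past_measurable[OF phase_past])

lemma norm_phase: "cmod (phase t n k \<omega>) = 1"
  by (simp add: phase_def)

lemma integrable_phase_mult:
  assumes "integrable M Z"
  shows "integrable M (\<lambda>\<omega>. phase t n k \<omega> * complex_of_real (Z \<omega>))"
proof (rule integrable_dominated[OF _ integrable_abs[OF assms]])
  have [measurable]: "Z \<in> borel_measurable M" using assms by simp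
  show "(\<lambda>\<omega>. phase t n k \<omega> * complex_of_real (Z \<omega>)) \<in> borel_measurable M" by measurable
qed (simp add: norm_mult norm_phase)

lemma norm_expectation_phase_mult:
  assumes "integrable M Z"
  shows "cmod (expectation (\<lambda>\<omega>. phase t n k \<omega> * complex_of_real (Z \<omega>))) \<le> expectation (\<lambda>\<omega>. \<bar>Z \<omega>\<bar>)"
proof (rule norm_integral_le[OF _ integrable_abs[OF assms]])
  have [measurable]: "Z \<in> borel_measurable M" using assms by simp
  show "(\<lambda>\<omega>. phase t n k \<omega> * complex_of_real (Z \<omega>)) \<in> borel_measurable M" by measurable
qed (simp add: norm_mult norm_phase)

lemma phase_Suc: "phase t n (Suc k) \<omega> = phase t n k \<omega> * iexp (t / sqrt (real n) * (Y k \<omega> * \<xi> k \<omega>))"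
  by (simp add: phase_def distrib_left exp_add)

lemma Y_noise_L4: "L_bounded 4 (\<lambda>k \<omega>. Y k \<omega> * \<xi> k \<omega>)"
  using L_bounded_adapted_mult[OF Y_adapted Y_L4, of "\<lambda>x. x"] fourth by (simp add: power_even_abs)

text \<open>One more summand turns the phase by an angle of order \<open>1 / sqrt n\<close>.\<close>

lemma phase_step:
  assumes "L_bounded 2 Q"
  shows "\<exists>C\<ge>0. \<forall>t n k. cmod (expectation (\<lambda>\<omega>. phase t n (Suc k) \<omega> * of_real (Q (Suc k) \<omega>)) -
     expectation (\<lambda>\<omega>. phase t n k \<omega> * of_real (Q (Suc k) \<omega>))) \<le> \<bar>t\<bar> * C / sqrt (real n)"
proof -
  let ?D = "\<lambda>k \<omega>. Y k \<omega> * \<xi> k \<omega> * Q (Suc k) \<omega>"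
  have "L_bounded 2 (\<lambda>k \<omega>. Y k \<omega> * \<xi> k \<omega>)" by (rule L_bounded_lower[OF Y_noise_L4]) simp
  then have D: "L_bounded 1 ?D"
    using L_bounded_mult[of 1 "\<lambda>k \<omega>. Y k \<omega> * \<xi> k \<omega>" "\<lambda>k. Q (Suc k)"] L_bounded_reindex[OF assms, of Suc] by simp
  then obtain C where C: "C \<ge> 0" "\<And>k. integrable M (\<lambda>\<omega>. \<bar>?D k \<omega>\<bar>)" "\<And>k. expectation (\<lambda>\<omega>. \<bar>?D k \<omega>\<bar>) \<le> C"
    using L_boundedD[OF D] unfolding power_one_right by blast
  have "cmod (expectation (\<lambda>\<omega>. phase t n (Suc k) \<omega> * of_real (Q (Suc k) \<omega>)) -
     expectation (\<lambda>\<omega>. phase t n k \<omega> * of_real (Q (Suc k) \<omega>))) \<le> \<bar>t\<bar> * C / sqrt (real n)" for t n k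
  proof -
    have [measurable]: "Q (Suc k) \<in> borel_measurable M" by (rule L_bounded_measurable[OF assms])
    have Q: "integrable M (Q (Suc k))" by (rule L_bounded_integrable[OF assms]) simp
    have "expectation (\<lambda>\<omega>. phase t n (Suc k) \<omega> * of_real (Q (Suc k) \<omega>)) -
        expectation (\<lambda>\<omega>. phase t n k \<omega> * of_real (Q (Suc k) \<omega>))
      = expectation (\<lambda>\<omega>. phase t n (Suc k) \<omega> * of_real (Q (Suc k) \<omega>) - phase t n k \<omega> * of_real (Q (Suc k) \<omega>))"
      by (rule Bochner_Integration.integral_diff[OF integrable_phase_mult[OF Q] integrable_phase_mult[OF Q], symmetric])
    also have "cmod \<dots> \<le> expectation (\<lambda>\<omega>. \<bar>t\<bar> / sqrt (real n) * \<bar>?D k \<omega>\<bar>)"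
    proof (rule norm_integral_le)
      show "integrable M (\<lambda>\<omega>. \<bar>t\<bar> / sqrt (real n) * \<bar>?D k \<omega>\<bar>)" by (rule integrable_mult_right[OF C(2)])
      fix \<omega> assume "\<omega> \<in> space M"
      let ?x = "t / sqrt (real n) * (Y k \<omega> * \<xi> k \<omega>)"
      have "phase t n (Suc k) \<omega> * of_real (Q (Suc k) \<omega>) - phase t n k \<omega> * of_real (Q (Suc k) \<omega>)
          = phase t n k \<omega> * (iexp ?x - 1) * of_real (Q (Suc k) \<omega>)"
        by (simp add: phase_Suc algebra_simps)
      also have "cmod \<dots> = cmod (iexp ?x - 1) * \<bar>Q (Suc k) \<omega>\<bar>"
        by (simp only: norm_mult norm_phase norm_of_real mult_1_left)
      also have "\<dots> \<le> \<bar>?x\<bar> * \<bar>Q (Suc k) \<omega>\<bar>"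
        using iexp_approx1[of ?x 0] by (intro mult_right_mono) auto
      also have "\<dots> = \<bar>t\<bar> / sqrt (real n) * \<bar>?D k \<omega>\<bar>" by (simp add: abs_mult)
      finally show "cmod (phase t n (Suc k) \<omega> * of_real (Q (Suc k) \<omega>) - phase t n k \<omega> * of_real (Q (Suc k) \<omega>))
          \<le> \<bar>t\<bar> / sqrt (real n) * \<bar>?D k \<omega>\<bar>" .
    qed measurable
    also have "\<dots> = \<bar>t\<bar> / sqrt (real n) * expectation (\<lambda>\<omega>. \<bar>?D k \<omega>\<bar>)" by simp
    also have "\<dots> \<le> \<bar>t\<bar> / sqrt (real n) * C" by (intro mult_left_mono C(3)) simp
    finally show ?thesis by simp
  qed
  with C(1) show ?thesis by blast
qed

lemma null_L2: "null Q \<Longrightarrow> L_bounded 2 Q"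
  by (simp add: null_def)

lemma null_phase_corr: "null Q \<Longrightarrow> (\<lambda>n. (\<Sum>k<n. phase_corr t n Q k) / real n) \<longlonglongrightarrow> 0"
  by (simp add: null_def)

lemma null_mean: "null Q \<Longrightarrow> (\<lambda>n. expectation (\<lambda>\<omega>. \<bar>\<Sum>k<n. Q k \<omega>\<bar>) / real n) \<longlonglongrightarrow> 0"
  by (simp add: null_def)

lemma nullI:
  assumes "L_bounded 2 Q" "\<And>t. (\<lambda>n. (\<Sum>k<n. phase_corr t n Q k) / real n) \<longlonglongrightarrow> 0"
    "(\<lambda>n. expectation (\<lambda>\<omega>. \<bar>\<Sum>k<n. Q k \<omega>\<bar>) / real n) \<longlonglongrightarrow> 0"
  shows "null Q"
  using assms by (simp add: null_def)

lemma null_integrable: "null Q \<Longrightarrow> integrable M (Q k)"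
  by (rule L_bounded_integrable[OF null_L2]) auto

lemma tendsto_0_sqrt: "(\<lambda>n. c / sqrt (real n)) \<longlonglongrightarrow> 0"
  by (rule tendsto_divide_0[OF tendsto_const filterlim_at_top_imp_at_infinity[OF
      filterlim_compose[OF sqrt_at_top filterlim_real_sequentially]]])

lemma null_add:
  assumes "null Q" "null R"
  shows "null (\<lambda>k \<omega>. Q k \<omega> + R k \<omega>)"
proof (rule nullI)
  show "L_bounded 2 (\<lambda>k \<omega>. Q k \<omega> + R k \<omega>)" by (intro L2_bounded_add null_L2 assms)
  fix t
  have "phase_corr t n (\<lambda>k \<omega>. Q k \<omega> + R k \<omega>) k \<le> phase_corr t n Q k + phase_corr t n R k" for n k
  proof -
    have "expectation (\<lambda>\<omega>. phase t n k \<omega> * of_real (Q k \<omega> + R k \<omega>))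
        = expectation (\<lambda>\<omega>. phase t n k \<omega> * of_real (Q k \<omega>)) + expectation (\<lambda>\<omega>. phase t n k \<omega> * of_real (R k \<omega>))"
      unfolding of_real_add distrib_left
      by (rule Bochner_Integration.integral_add[OF integrable_phase_mult integrable_phase_mult])
        (intro null_integrable assms)+
    then show ?thesis by (simp only: phase_corr_def norm_triangle_ineq)
  qed
  then have le: "(\<Sum>k<n. phase_corr t n (\<lambda>k \<omega>. Q k \<omega> + R k \<omega>) k) / real n
      \<le> (\<Sum>k<n. phase_corr t n Q k) / real n + (\<Sum>k<n. phase_corr t n R k) / real n" for n
    unfolding add_divide_distrib[symmetric] sum.distrib[symmetric]
    by (intro divide_right_mono sum_mono) auto
  have "(\<lambda>n. (\<Sum>k<n. phase_corr t n Q k) / real n + (\<Sum>k<n. phase_corr t n R k) / real n) \<longlonglongrightarrow> 0 + 0"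
    by (intro tendsto_add null_phase_corr assms)
  then show "(\<lambda>n. (\<Sum>k<n. phase_corr t n (\<lambda>k \<omega>. Q k \<omega> + R k \<omega>) k) / real n) \<longlonglongrightarrow> 0"
    by (intro tendsto_0_of_le[OF _ le]) (simp_all add: sum_nonneg phase_corr_nonneg)
next
  have iQ: "integrable M (\<lambda>\<omega>. \<bar>\<Sum>k<n. Q k \<omega>\<bar>)" and iR: "integrable M (\<lambda>\<omega>. \<bar>\<Sum>k<n. R k \<omega>\<bar>)" for n
    by (intro integrable_abs Bochner_Integration.integrable_sum null_integrable assms)+
  have le: "expectation (\<lambda>\<omega>. \<bar>\<Sum>k<n. Q k \<omega> + R k \<omega>\<bar>) / real n
      \<le> expectation (\<lambda>\<omega>. \<bar>\<Sum>k<n. Q k \<omega>\<bar>) / real n + expectation (\<lambda>\<omega>. \<bar>\<Sum>k<n. R k \<omega>\<bar>) / real n" for n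
    unfolding add_divide_distrib[symmetric] Bochner_Integration.integral_add[OF iQ iR, symmetric]
  proof (intro divide_right_mono integral_mono)
    show "integrable M (\<lambda>\<omega>. \<bar>\<Sum>k<n. Q k \<omega> + R k \<omega>\<bar>)"
      by (rule integrable_abs[OF Bochner_Integration.integrable_sum[OF Bochner_Integration.integrable_add[
            OF null_integrable[OF assms(1)] null_integrable[OF assms(2)]]]])
    show "integrable M (\<lambda>\<omega>. \<bar>\<Sum>k<n. Q k \<omega>\<bar> + \<bar>\<Sum>k<n. R k \<omega>\<bar>)" using iQ iR by auto
  qed (simp_all add: sum.distrib abs_triangle_ineq)
  have "(\<lambda>n. expectation (\<lambda>\<omega>. \<bar>\<Sum>k<n. Q k \<omega>\<bar>) / real n + expectation (\<lambda>\<omega>. \<bar>\<Sum>k<n. R k \<omega>\<bar>) / real n) \<longlonglongrightarrow> 0 + 0"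
    by (intro tendsto_add null_mean assms)
  then show "(\<lambda>n. expectation (\<lambda>\<omega>. \<bar>\<Sum>k<n. Q k \<omega> + R k \<omega>\<bar>) / real n) \<longlonglongrightarrow> 0"
    by (intro tendsto_0_of_le[OF _ le]) simp_all
qed

lemma null_scale:
  assumes "null Q"
  shows "null (\<lambda>k \<omega>. c * Q k \<omega>)"
proof (rule nullI)
  show "L_bounded 2 (\<lambda>k \<omega>. c * Q k \<omega>)" by (intro L_bounded_scale null_L2 assms)
  fix t
  have "phase_corr t n (\<lambda>k \<omega>. c * Q k \<omega>) k = \<bar>c\<bar> * phase_corr t n Q k" for n k
    by (simp add: phase_corr_def mult.left_commute[of _ "complex_of_real c"] norm_mult)
  moreover have "(\<lambda>n. \<bar>c\<bar> * ((\<Sum>k<n. phase_corr t n Q k) / real n)) \<longlonglongrightarrow> \<bar>c\<bar> * 0"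
    by (intro tendsto_mult_left null_phase_corr assms)
  ultimately show "(\<lambda>n. (\<Sum>k<n. phase_corr t n (\<lambda>k \<omega>. c * Q k \<omega>) k) / real n) \<longlonglongrightarrow> 0"
    by (simp add: sum_distrib_left[symmetric])
next
  have "(\<lambda>n. \<bar>c\<bar> * (expectation (\<lambda>\<omega>. \<bar>\<Sum>k<n. Q k \<omega>\<bar>) / real n)) \<longlonglongrightarrow> \<bar>c\<bar> * 0"
    by (intro tendsto_mult_left null_mean assms)
  then show "(\<lambda>n. expectation (\<lambda>\<omega>. \<bar>\<Sum>k<n. c * Q k \<omega>\<bar>) / real n) \<longlonglongrightarrow> 0"
    by (simp add: sum_distrib_left[symmetric] abs_mult)
qed

text \<open>A centred function of fresh noise is uncorrelated with the phase, so its correlations vanish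
  identically. Its sums are of order \<open>sqrt n\<close> by orthogonality.\<close>

lemma null_innovation:
  assumes Z: "adapted Z" "L_bounded 2 Z"
    and g: "g \<in> borel_measurable borel" "integrable M (\<lambda>\<omega>. \<bar>g (\<xi> 0 \<omega>)\<bar>\<^sup>2)"
    and g0: "expectation (\<lambda>\<omega>. g (\<xi> 0 \<omega>)) = 0"
  shows "null (\<lambda>k \<omega>. Z k \<omega> * g (\<xi> k \<omega>))"
proof (rule nullI)
  show D: "L_bounded 2 (\<lambda>k \<omega>. Z k \<omega> * g (\<xi> k \<omega>))" by (rule L_bounded_adapted_mult[OF Z g])
  have gm[measurable]: "(\<lambda>\<omega>. g (\<xi> 0 \<omega>)) \<in> borel_measurable M" using g(1) by measurable
  have g1: "integrable M (\<lambda>\<omega>. complex_of_real (g (\<xi> 0 \<omega>)))"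
  proof (rule integrable_dominated[where g="\<lambda>\<omega>. 1 + \<bar>g (\<xi> 0 \<omega>)\<bar>\<^sup>2"])
    show "norm (complex_of_real (g (\<xi> 0 \<omega>))) \<le> 1 + \<bar>g (\<xi> 0 \<omega>)\<bar>\<^sup>2" for \<omega>
      using power_le_one_plus[of 1 2 "\<bar>g (\<xi> 0 \<omega>)\<bar>"] by simp
  qed (use g in auto)
  fix t
  have "expectation (\<lambda>\<omega>. phase t n k \<omega> * of_real (Z k \<omega> * g (\<xi> k \<omega>))) = 0" for n k
  proof -
    have "(\<lambda>\<omega>. phase t n k \<omega> * complex_of_real (Z k \<omega>)) \<in> borel_measurable (past k)"
      using phase_past adapted_measurable[OF Z(1)] by measurable
    from expectation_past_mult[OF this integrable_phase_mult[OF L_bounded_integrable[OF Z(2)]], of "\<lambda>x. complex_of_real (g x)"]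
    show ?thesis using g(1) g1 g0 by (simp add: mult.assoc)
  qed
  then show "(\<lambda>n. (\<Sum>k<n. phase_corr t n (\<lambda>k \<omega>. Z k \<omega> * g (\<xi> k \<omega>)) k) / real n) \<longlonglongrightarrow> 0"
    by (simp only: phase_corr_def norm_zero sum.neutral_const div_0 tendsto_const)
next
  let ?T = "\<lambda>n \<omega>. \<Sum>k<n. Z k \<omega> * g (\<xi> k \<omega>)"
  obtain K where K: "K \<ge> 0" "\<And>n. integrable M (\<lambda>\<omega>. (?T n \<omega>)\<^sup>2)" "\<And>n. expectation (\<lambda>\<omega>. (?T n \<omega>)\<^sup>2) \<le> real n * K"
    using innovation_sum_second_moment[OF assms] by blast
  have Tm: "?T n \<in> borel_measurable M" for n
    by (rule past_measurable[OF innovation_sum_measurable[OF Z(1) g(1)]])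
  have "expectation (\<lambda>\<omega>. \<bar>?T n \<omega>\<bar>) / real n \<le> (K + 1) / sqrt (real n)" if "n > 0" for n
  proof -
    have "expectation (\<lambda>\<omega>. \<bar>?T n \<omega>\<bar>) / real n \<le> (K + 1) * sqrt (real n) / real n"
      using L1_le_of_second_moment(2)[OF Tm K(2,3) that] by (intro divide_right_mono) auto
    also have "\<dots> = (K + 1) / sqrt (real n)"
      by (simp only: times_divide_eq_right[symmetric] sqrt_divide_self_eq) (simp add: real_div_sqrt divide_inverse)
    finally show ?thesis .
  qed
  then show "(\<lambda>n. expectation (\<lambda>\<omega>. \<bar>?T n \<omega>\<bar>) / real n) \<longlonglongrightarrow> 0"
    by (intro tendsto_0_of_le[OF _ _ tendsto_0_sqrt]) simp_all
qed

text \<open>Summing the recursion over time reproduces, up to boundary terms, \<open>l\<close> times the sum of \<open>Q\<close>, which is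
  absorbed on the left because \<open>\<bar>l\<bar> < 1\<close>. In the phase correlations the recursion holds up to the
  error \<open>1 / sqrt n\<close> of moving the phase one step, which is negligible in the average. For \<open>l = 0\<close>
  the lemma says that nullity survives a shift of time.\<close>

lemma null_recursion:
  assumes rec: "\<And>k \<omega>. Q (Suc k) \<omega> = l * Q k \<omega> + R k \<omega>" and "\<bar>l\<bar> < 1"
    and Q: "L_bounded 2 Q" and R: "null R"
  shows "null Q"
proof (rule nullI)
  have "L_bounded 1 Q" by (rule L_bounded_lower[OF Q]) simp
  then obtain q where q: "q \<ge> 0" "\<And>k. expectation (\<lambda>\<omega>. \<bar>Q k \<omega>\<bar>) \<le> q"
    using L_boundedD[of 1 Q] unfolding power_one_right by blast
  have iQ: "integrable M (Q k)" for k by (rule L_bounded_integrable[OF Q]) simp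
  note iR = null_integrable[OF R]
  show "L_bounded 2 Q" by (rule Q)
  fix t
  obtain C where C: "C \<ge> 0" "\<And>n k. cmod (expectation (\<lambda>\<omega>. phase t n (Suc k) \<omega> * of_real (Q (Suc k) \<omega>)) -
     expectation (\<lambda>\<omega>. phase t n k \<omega> * of_real (Q (Suc k) \<omega>))) \<le> \<bar>t\<bar> * C / sqrt (real n)"
    using phase_step[OF Q] by blast
  have step: "phase_corr t n Q (Suc k) \<le> \<bar>l\<bar> * phase_corr t n Q k + phase_corr t n R k + \<bar>t\<bar> * C / sqrt (real n)" for n k
  proof -
    have "expectation (\<lambda>\<omega>. phase t n k \<omega> * of_real (Q (Suc k) \<omega>))
        = expectation (\<lambda>\<omega>. of_real l * (phase t n k \<omega> * of_real (Q k \<omega>)) + phase t n k \<omega> * of_real (R k \<omega>))"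
      by (simp add: rec algebra_simps)
    also have "\<dots> = of_real l * expectation (\<lambda>\<omega>. phase t n k \<omega> * of_real (Q k \<omega>))
        + expectation (\<lambda>\<omega>. phase t n k \<omega> * of_real (R k \<omega>))"
      using integrable_phase_mult[OF iQ] integrable_phase_mult[OF iR]
      by (subst Bochner_Integration.integral_add) auto
    finally have "cmod (expectation (\<lambda>\<omega>. phase t n k \<omega> * of_real (Q (Suc k) \<omega>)))
        \<le> \<bar>l\<bar> * phase_corr t n Q k + phase_corr t n R k"
      using norm_triangle_ineq[of "of_real l * expectation (\<lambda>\<omega>. phase t n k \<omega> * of_real (Q k \<omega>))"
          "expectation (\<lambda>\<omega>. phase t n k \<omega> * of_real (R k \<omega>))"]
      by (simp only: phase_corr_def norm_mult norm_of_real)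
    moreover have "phase_corr t n Q (Suc k) \<le> cmod (expectation (\<lambda>\<omega>. phase t n k \<omega> * of_real (Q (Suc k) \<omega>)))
        + \<bar>t\<bar> * C / sqrt (real n)"
      unfolding phase_corr_def by (rule order_trans[OF norm_triangle_sub add_left_mono[OF C(2)]])
    ultimately show ?thesis by linarith
  qed
  have sum_le: "(\<Sum>k<n. phase_corr t n Q k) / real n
      \<le> (q / real n + (\<Sum>k<n. phase_corr t n R k) / real n + \<bar>t\<bar> * C / sqrt (real n)) / (1 - \<bar>l\<bar>)" if "n > 0" for n
  proof -
    let ?s = "\<Sum>k<n. phase_corr t n Q k"
    have "?s \<le> (\<Sum>k<Suc n. phase_corr t n Q k)" by (simp add: phase_corr_nonneg)
    also have "\<dots> = phase_corr t n Q 0 + (\<Sum>k<n. phase_corr t n Q (Suc k))" by (rule sum.lessThan_Suc_shift)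
    also have "phase_corr t n Q 0 \<le> q" 
      unfolding phase_corr_def by (rule order_trans[OF norm_expectation_phase_mult[OF iQ] q(2)])
    also have "(\<Sum>k<n. phase_corr t n Q (Suc k)) \<le> (\<Sum>k<n. \<bar>l\<bar> * phase_corr t n Q k + phase_corr t n R k + \<bar>t\<bar> * C / sqrt (real n))"
      by (intro sum_mono step)
    also have "\<dots> = \<bar>l\<bar> * ?s + (\<Sum>k<n. phase_corr t n R k) + real n * (\<bar>t\<bar> * C / sqrt (real n))"
      by (simp add: sum.distrib sum_distrib_left)
    finally have "?s * (1 - \<bar>l\<bar>) \<le> q + (\<Sum>k<n. phase_corr t n R k) + real n * (\<bar>t\<bar> * C / sqrt (real n))"
      by (simp add: algebra_simps)
    then have "?s * (1 - \<bar>l\<bar>) / real n \<le> (q + (\<Sum>k<n. phase_corr t n R k) + real n * (\<bar>t\<bar> * C / sqrt (real n))) / real n"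
      by (rule divide_right_mono) simp
    also have "\<dots> = q / real n + (\<Sum>k<n. phase_corr t n R k) / real n + \<bar>t\<bar> * C / sqrt (real n)"
      using that by (simp add: add_divide_distrib)
    finally show ?thesis using assms(2) by (simp add: pos_le_divide_eq)
  qed
  have "(\<lambda>n. (q / real n + (\<Sum>k<n. phase_corr t n R k) / real n + \<bar>t\<bar> * C / sqrt (real n)) / (1 - \<bar>l\<bar>))
      \<longlonglongrightarrow> (0 + 0 + 0) / (1 - \<bar>l\<bar>)"
    using assms(2) by (intro tendsto_divide tendsto_add tendsto_const tendsto_0_sqrt lim_const_over_n null_phase_corr R) simp
  then show "(\<lambda>n. (\<Sum>k<n. phase_corr t n Q k) / real n) \<longlonglongrightarrow> 0"
    by (intro tendsto_0_of_le[OF _ sum_le]) (simp_all add: sum_nonneg phase_corr_nonneg)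
next
  have "L_bounded 1 Q" by (rule L_bounded_lower[OF Q]) simp
  then obtain q where q: "q \<ge> 0" "\<And>k. expectation (\<lambda>\<omega>. \<bar>Q k \<omega>\<bar>) \<le> q"
    using L_boundedD[of 1 Q] unfolding power_one_right by blast
  have iQ: "integrable M (Q k)" for k by (rule L_bounded_integrable[OF Q]) simp
  note iR = null_integrable[OF R]
  have l: "1 - l > 0" using assms(2) by linarith
  have tel: "(1 - l) * (\<Sum>k<n. Q k \<omega>) = Q 0 \<omega> - Q n \<omega> + (\<Sum>k<n. R k \<omega>)" for n \<omega>
  proof (induction n)
    case (Suc n)
    have "(1 - l) * (\<Sum>k<Suc n. Q k \<omega>) = (1 - l) * (\<Sum>k<n. Q k \<omega>) + Q n \<omega> - l * Q n \<omega>"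
      by (simp add: algebra_simps)
    then show ?case using Suc rec[of n \<omega>] by simp
  qed simp
  have le: "expectation (\<lambda>\<omega>. \<bar>\<Sum>k<n. Q k \<omega>\<bar>) / real n
      \<le> (2 * q / real n + expectation (\<lambda>\<omega>. \<bar>\<Sum>k<n. R k \<omega>\<bar>) / real n) / (1 - l)" for n
  proof -
    have iS: "integrable M (\<lambda>\<omega>. \<bar>\<Sum>k<n. Q k \<omega>\<bar>)" "integrable M (\<lambda>\<omega>. \<bar>\<Sum>k<n. R k \<omega>\<bar>)"
      by (intro integrable_abs Bochner_Integration.integrable_sum iQ iR)+
    have i1: "integrable M (\<lambda>\<omega>. \<bar>Q 0 \<omega>\<bar> + \<bar>Q n \<omega>\<bar>)"
      by (intro Bochner_Integration.integrable_add integrable_abs iQ)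
    have "(1 - l) * expectation (\<lambda>\<omega>. \<bar>\<Sum>k<n. Q k \<omega>\<bar>) = expectation (\<lambda>\<omega>. \<bar>(1 - l) * (\<Sum>k<n. Q k \<omega>)\<bar>)"
      using l by (simp add: abs_mult)
    also have "\<dots> \<le> expectation (\<lambda>\<omega>. \<bar>Q 0 \<omega>\<bar> + \<bar>Q n \<omega>\<bar> + \<bar>\<Sum>k<n. R k \<omega>\<bar>)"
    proof (rule integral_mono)
      show "integrable M (\<lambda>\<omega>. \<bar>(1 - l) * (\<Sum>k<n. Q k \<omega>)\<bar>)"
        by (intro integrable_abs integrable_mult_right Bochner_Integration.integrable_sum iQ)
      show "integrable M (\<lambda>\<omega>. \<bar>Q 0 \<omega>\<bar> + \<bar>Q n \<omega>\<bar> + \<bar>\<Sum>k<n. R k \<omega>\<bar>)"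
        by (rule Bochner_Integration.integrable_add[OF i1 iS(2)])
    qed (unfold tel, linarith)
    also have "\<dots> = expectation (\<lambda>\<omega>. \<bar>Q 0 \<omega>\<bar>) + expectation (\<lambda>\<omega>. \<bar>Q n \<omega>\<bar>) + expectation (\<lambda>\<omega>. \<bar>\<Sum>k<n. R k \<omega>\<bar>)"
      unfolding Bochner_Integration.integral_add[OF i1 iS(2)]
        Bochner_Integration.integral_add[OF integrable_abs[OF iQ] integrable_abs[OF iQ]] ..
    also have "\<dots> \<le> 2 * q + expectation (\<lambda>\<omega>. \<bar>\<Sum>k<n. R k \<omega>\<bar>)"
      using q(2)[of 0] q(2)[of n] by linarith
    finally have "expectation (\<lambda>\<omega>. \<bar>\<Sum>k<n. Q k \<omega>\<bar>) \<le> (2 * q + expectation (\<lambda>\<omega>. \<bar>\<Sum>k<n. R k \<omega>\<bar>)) / (1 - l)"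
      using l by (simp add: pos_le_divide_eq mult.commute)
    then have "expectation (\<lambda>\<omega>. \<bar>\<Sum>k<n. Q k \<omega>\<bar>) / real n
        \<le> (2 * q + expectation (\<lambda>\<omega>. \<bar>\<Sum>k<n. R k \<omega>\<bar>)) / (1 - l) / real n"
      by (rule divide_right_mono) simp
    also have "\<dots> = (2 * q / real n + expectation (\<lambda>\<omega>. \<bar>\<Sum>k<n. R k \<omega>\<bar>) / real n) / (1 - l)"
      by (simp add: add_divide_distrib mult.commute)
    finally show ?thesis .
  qed
  have "(\<lambda>n. (2 * q / real n + expectation (\<lambda>\<omega>. \<bar>\<Sum>k<n. R k \<omega>\<bar>) / real n) / (1 - l)) \<longlonglongrightarrow> (0 + 0) / (1 - l)"
    using l by (intro tendsto_divide tendsto_add tendsto_const lim_const_over_n null_mean R) simp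
  then show "(\<lambda>n. expectation (\<lambda>\<omega>. \<bar>\<Sum>k<n. Q k \<omega>\<bar>) / real n) \<longlonglongrightarrow> 0"
    by (intro tendsto_0_of_le[OF _ le]) simp_all
qed


lemma norm_iexp_second_order:
  "cmod (iexp x - (1 + \<i> * of_real x - of_real (x\<^sup>2 / 2))) \<le> \<bar>x\<bar> ^ 3"
proof -
  have eq: "(\<Sum>k\<le>2. (\<i> * complex_of_real x) ^ k / fact k) = 1 + \<i> * of_real x - of_real (x\<^sup>2 / 2)"
    by (simp add: numeral_2_eq_2 power_mult_distrib)
  have "cmod (iexp x - (1 + \<i> * of_real x - of_real (x\<^sup>2 / 2))) \<le> \<bar>x\<bar> ^ 3 / fact 3"
    using iexp_approx1[of x 2] unfolding eq by (simp add: numeral_3_eq_3 numeral_2_eq_2)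
  also have "\<dots> \<le> \<bar>x\<bar> ^ 3 / 1" by (intro divide_left_mono) (auto simp: fact_ge_1)
  finally show ?thesis by simp
qed

lemma perturbed_geometric:
  fixes f :: "nat \<Rightarrow> complex"
  assumes "\<And>k. cmod (f (Suc k) - c * f k) \<le> b k" "cmod c \<le> 1"
  shows "cmod (f n - c ^ n * f 0) \<le> (\<Sum>k<n. b k)"
proof (induction n)
  case (Suc n)
  have "f (Suc n) - c ^ Suc n * f 0 = (f (Suc n) - c * f n) + c * (f n - c ^ n * f 0)"
    by (simp add: algebra_simps)
  also have "cmod \<dots> \<le> b n + cmod c * cmod (f n - c ^ n * f 0)"
    by (rule order_trans[OF norm_triangle_ineq]) (simp add: norm_mult assms(1))
  also have "\<dots> \<le> b n + 1 * (\<Sum>k<n. b k)"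
    using Suc assms(2) by (intro add_left_mono mult_mono) auto
  finally show ?case by simp
qed simp

text \<open>Second order expansion of one factor of the phase. The linear term vanishes in mean, and in the
  quadratic one \<open>(\<xi> k)\<^sup>2\<close> can be replaced by its mean \<open>\<sigma>\<^sup>2\<close>, both by independence. Replacing
  \<open>(Y k)\<^sup>2\<close> by the constant \<open>v\<close> costs exactly one phase correlation.\<close>

lemma char_step:
  assumes Q: "L_bounded 2 (\<lambda>k \<omega>. (Y k \<omega>)\<^sup>2 - v)"
  shows "\<exists>C\<ge>0. \<forall>t. \<forall>n>0. \<forall>k. cmod (expectation (phase t n (Suc k)) -
      of_real (1 - t\<^sup>2 * \<sigma>\<^sup>2 * v / (2 * real n)) * expectation (phase t n k))
    \<le> t\<^sup>2 * \<sigma>\<^sup>2 / (2 * real n) * phase_corr t n (\<lambda>k \<omega>. (Y k \<omega>)\<^sup>2 - v) k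
      + \<bar>t\<bar> ^ 3 * C / (real n * sqrt (real n))"
proof -
  let ?Q = "\<lambda>k \<omega>. (Y k \<omega>)\<^sup>2 - v"
  have "L_bounded 3 (\<lambda>k \<omega>. Y k \<omega> * \<xi> k \<omega>)" by (rule L_bounded_lower[OF Y_noise_L4]) simp
  then obtain C where C: "C \<ge> 0" "\<And>k. integrable M (\<lambda>\<omega>. \<bar>Y k \<omega> * \<xi> k \<omega>\<bar> ^ 3)"
    "\<And>k. expectation (\<lambda>\<omega>. \<bar>Y k \<omega> * \<xi> k \<omega>\<bar> ^ 3) \<le> C"
    using L_boundedD[of 3 "\<lambda>k \<omega>. Y k \<omega> * \<xi> k \<omega>"] by blast
  have "cmod (expectation (phase t n (Suc k)) -
      of_real (1 - t\<^sup>2 * \<sigma>\<^sup>2 * v / (2 * real n)) * expectation (phase t n k))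
    \<le> t\<^sup>2 * \<sigma>\<^sup>2 / (2 * real n) * phase_corr t n ?Q k + \<bar>t\<bar> ^ 3 * C / (real n * sqrt (real n))"
    if "n > 0" for t n k
  proof -
    define r where "r = sqrt (real n)"
    define \<tau> where "\<tau> = t / r"
    have r: "r > 0" "real n = r\<^sup>2" using that by (auto simp: r_def)
    let ?p = "phase t n k" and ?x = "\<lambda>\<omega>. \<tau> * (Y k \<omega> * \<xi> k \<omega>)"
    define R where "R \<omega> = ?p \<omega> * (iexp (?x \<omega>) - (1 + \<i> * of_real (?x \<omega>) - of_real ((?x \<omega>)\<^sup>2 / 2)))" for \<omega>
    have Ym[measurable]: "Y k \<in> borel_measurable M" by (rule L_bounded_measurable[OF Y_L4])
    have Yp[measurable]: "Y k \<in> borel_measurable (past k)" by (rule adapted_measurable[OF Y_adapted])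
    note phase_past[of t n k, measurable]
    have Y1: "integrable M (Y k)" by (rule L_bounded_integrable[OF Y_L4]) simp
    have "L_bounded 2 Y" by (rule L_bounded_lower[OF Y_L4]) simp
    from L_boundedD[OF this] have Y2: "integrable M (\<lambda>\<omega>. (Y k \<omega>)\<^sup>2)" by (simp only: power2_abs) blast
    have Q1: "integrable M (?Q k)" by (rule L_bounded_integrable[OF Q]) simp
    have x1: "integrable M (\<xi> 0)" by (rule L_bounded_integrable[OF L_bounded_noise]) simp
    have "L_bounded 2 \<xi>" by (rule L_bounded_lower[OF L_bounded_noise]) simp
    from L_boundedD[OF this] have x2: "integrable M (\<lambda>\<omega>. (\<xi> 0 \<omega>)\<^sup>2)" by (simp only: power2_abs) blast
    have ip: "integrable M ?p" using integrable_phase_mult[of "\<lambda>_. 1" t n k] by simp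
    have m1: "(\<lambda>\<omega>. ?p \<omega> * complex_of_real (Y k \<omega>)) \<in> borel_measurable (past k)" by measurable
    have i1: "integrable M (\<lambda>\<omega>. complex_of_real (\<xi> 0 \<omega>))" using x1 by simp
    have o: "(\<lambda>x. complex_of_real x) \<in> borel_measurable borel" "(\<lambda>x. complex_of_real (x\<^sup>2)) \<in> borel_measurable borel"
      by measurable
    note lin = integrable_past_mult[OF m1 integrable_phase_mult[OF Y1] o(1) i1]
      expectation_past_mult[OF m1 integrable_phase_mult[OF Y1] o(1) i1]
    have m2: "(\<lambda>\<omega>. ?p \<omega> * complex_of_real ((Y k \<omega>)\<^sup>2)) \<in> borel_measurable (past k)" by measurable
    have i2: "integrable M (\<lambda>\<omega>. complex_of_real ((\<xi> 0 \<omega>)\<^sup>2))" by (rule integrable_of_real[OF x2])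
    note quad = integrable_past_mult[OF m2 integrable_phase_mult[OF Y2] o(2) i2]
      expectation_past_mult[OF m2 integrable_phase_mult[OF Y2] o(2) i2]
    have E1: "expectation (\<lambda>\<omega>. complex_of_real (\<xi> 0 \<omega>)) = 0" using mean by simp
    have E2: "expectation (\<lambda>\<omega>. complex_of_real ((\<xi> 0 \<omega>)\<^sup>2)) = of_real (\<sigma>\<^sup>2)"
      unfolding integral_complex_of_real second ..
    have EY: "expectation (\<lambda>\<omega>. ?p \<omega> * of_real ((Y k \<omega>)\<^sup>2)) = expectation (\<lambda>\<omega>. ?p \<omega> * of_real (?Q k \<omega>)) + of_real v * expectation ?p"
    proof -
      have "expectation (\<lambda>\<omega>. ?p \<omega> * of_real ((Y k \<omega>)\<^sup>2)) = expectation (\<lambda>\<omega>. ?p \<omega> * of_real (?Q k \<omega>) + of_real v * ?p \<omega>)"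
        by (intro Bochner_Integration.integral_cong refl) (simp add: algebra_simps)
      also have "\<dots> = expectation (\<lambda>\<omega>. ?p \<omega> * of_real (?Q k \<omega>)) + expectation (\<lambda>\<omega>. of_real v * ?p \<omega>)"
        by (rule Bochner_Integration.integral_add[OF integrable_phase_mult[OF Q1] integrable_mult_right[OF ip]])
      finally show ?thesis by simp
    qed
    have Rm: "R \<in> borel_measurable M" unfolding R_def by measurable
    have Rle: "cmod (R \<omega>) \<le> \<bar>\<tau>\<bar> ^ 3 * \<bar>Y k \<omega> * \<xi> k \<omega>\<bar> ^ 3" for \<omega>
      using norm_iexp_second_order[of "?x \<omega>"] by (simp add: R_def norm_mult norm_phase abs_mult power_mult_distrib)
    have iC: "integrable M (\<lambda>\<omega>. \<bar>\<tau>\<bar> ^ 3 * \<bar>Y k \<omega> * \<xi> k \<omega>\<bar> ^ 3)" by (rule integrable_mult_right[OF C(2)])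
    have iR: "integrable M R" by (rule integrable_dominated[OF Rm iC Rle])
    have "cmod (expectation R) \<le> expectation (\<lambda>\<omega>. \<bar>\<tau>\<bar> ^ 3 * \<bar>Y k \<omega> * \<xi> k \<omega>\<bar> ^ 3)"
      by (rule norm_integral_le[OF Rm iC Rle])
    also have "\<dots> = \<bar>\<tau>\<bar> ^ 3 * expectation (\<lambda>\<omega>. \<bar>Y k \<omega> * \<xi> k \<omega>\<bar> ^ 3)" by simp
    also have "\<dots> \<le> \<bar>\<tau>\<bar> ^ 3 * C" by (intro mult_left_mono C(3)) simp
    finally have ER: "cmod (expectation R) \<le> \<bar>\<tau>\<bar> ^ 3 * C" .
    let ?L = "\<lambda>\<omega>. (\<i> * of_real \<tau>) * (?p \<omega> * of_real (Y k \<omega>) * of_real (\<xi> k \<omega>))"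
    let ?S = "\<lambda>\<omega>. of_real (\<tau>\<^sup>2 / 2) * (?p \<omega> * of_real ((Y k \<omega>)\<^sup>2) * of_real ((\<xi> k \<omega>)\<^sup>2))"
    have "phase t n (Suc k) \<omega> = ((?p \<omega> + ?L \<omega>) - ?S \<omega>) + R \<omega>" for \<omega>
      by (simp add: phase_Suc R_def \<tau>_def[symmetric] r_def[symmetric] algebra_simps power2_eq_square)
    then have "expectation (phase t n (Suc k)) = expectation (\<lambda>\<omega>. ((?p \<omega> + ?L \<omega>) - ?S \<omega>) + R \<omega>)" by presburger
    also have "\<dots> = expectation ?p + expectation ?L - expectation ?S + expectation R"
      using ip integrable_mult_right[OF lin(1), of "\<i> * of_real \<tau>"]
        integrable_mult_right[OF quad(1), of "of_real (\<tau>\<^sup>2 / 2)"] iR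
      by (simp only: Bochner_Integration.integral_add Bochner_Integration.integral_diff
          Bochner_Integration.integrable_add Bochner_Integration.integrable_diff)
    also have "expectation ?L = 0"
      unfolding integral_mult_right_zero lin(2) E1 by simp
    also have "expectation ?S = of_real (\<tau>\<^sup>2 / 2 * \<sigma>\<^sup>2) * (expectation (\<lambda>\<omega>. ?p \<omega> * of_real (?Q k \<omega>)) + of_real v * expectation ?p)"
      unfolding integral_mult_right_zero quad(2) E2 EY by simp
    finally have "expectation (phase t n (Suc k)) - of_real (1 - \<tau>\<^sup>2 / 2 * \<sigma>\<^sup>2 * v) * expectation ?p
        = - of_real (\<tau>\<^sup>2 / 2 * \<sigma>\<^sup>2) * expectation (\<lambda>\<omega>. ?p \<omega> * of_real (?Q k \<omega>)) + expectation R"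
      by (simp add: algebra_simps)
    also have "cmod \<dots> \<le> \<tau>\<^sup>2 / 2 * \<sigma>\<^sup>2 * phase_corr t n ?Q k + \<bar>\<tau>\<bar> ^ 3 * C"
      by (rule order_trans[OF norm_triangle_ineq])
        (intro add_mono ER, simp add: norm_mult phase_corr_def norm_power norm_divide)
    finally show ?thesis
      using r by (simp add: \<tau>_def r_def[symmetric] power_divide power3_eq_cube power2_eq_square abs_mult mult_ac)
  qed
  with C(1) show ?thesis by blast
qed

text \<open>Each step multiplies the characteristic function by \<open>1 - a / n\<close>, up to errors whose sum over the
  \<open>n\<close> steps is the average phase correlation of \<open>(Y k)\<^sup>2 - v\<close> plus a term of order \<open>1 / sqrt n\<close>.
  Nullity makes both disappear and the product tends to \<open>exp (- a)\<close>.\<close>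

theorem char_tendsto:
  assumes null: "null (\<lambda>k \<omega>. (Y k \<omega>)\<^sup>2 - v)" and "v \<ge> 0"
  shows "(\<lambda>n. expectation (\<lambda>\<omega>. iexp (t * ((\<Sum>k<n. Y k \<omega> * \<xi> k \<omega>) / sqrt (real n)))))
    \<longlonglongrightarrow> of_real (exp (- (t\<^sup>2 * (\<sigma>\<^sup>2 * v) / 2)))"
proof -
  let ?Q = "\<lambda>k \<omega>. (Y k \<omega>)\<^sup>2 - v"
  define a where "a = t\<^sup>2 * \<sigma>\<^sup>2 * v / 2"
  have "a \<ge> 0" using \<open>v \<ge> 0\<close> by (simp add: a_def)
  obtain C where C: "C \<ge> 0" "\<And>n k. n > 0 \<Longrightarrow> cmod (expectation (phase t n (Suc k)) -
      of_real (1 - t\<^sup>2 * \<sigma>\<^sup>2 * v / (2 * real n)) * expectation (phase t n k))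
    \<le> t\<^sup>2 * \<sigma>\<^sup>2 / (2 * real n) * phase_corr t n ?Q k + \<bar>t\<bar> ^ 3 * C / (real n * sqrt (real n))"
    using char_step[OF null_L2[OF null]] by blast
  define f where "f n k = expectation (phase t n k)" for n k
  have "phase t n 0 = (\<lambda>_. 1)" for n by (simp add: phase_def fun_eq_iff)
  then have f0: "f n 0 = 1" for n by (simp add: f_def prob_space)
  have le: "cmod (f n n - of_real ((1 + - a / real n) ^ n))
      \<le> t\<^sup>2 * \<sigma>\<^sup>2 / 2 * ((\<Sum>k<n. phase_corr t n ?Q k) / real n) + \<bar>t\<bar> ^ 3 * C / sqrt (real n)"
    if "n > 0" "real n \<ge> a" for n
  proof -
    let ?c = "1 + - a / real n"
    have c: "1 - t\<^sup>2 * \<sigma>\<^sup>2 * v / (2 * real n) = ?c" by (simp add: a_def)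
    have "0 \<le> a / real n" "a / real n \<le> 1" using that \<open>a \<ge> 0\<close> by simp_all
    then have "\<bar>?c\<bar> \<le> 1" by (simp add: abs_le_iff)
    then have "cmod (f n n - of_real ?c ^ n * f n 0)
      \<le> (\<Sum>k<n. t\<^sup>2 * \<sigma>\<^sup>2 / (2 * real n) * phase_corr t n ?Q k + \<bar>t\<bar> ^ 3 * C / (real n * sqrt (real n)))"
      using C(2)[OF that(1)] unfolding c f_def by (intro perturbed_geometric) (simp_all only: norm_of_real)
    also have "\<dots> = t\<^sup>2 * \<sigma>\<^sup>2 / (2 * real n) * (\<Sum>k<n. phase_corr t n ?Q k)
        + real n * (\<bar>t\<bar> ^ 3 * C / (real n * sqrt (real n)))"
      by (simp only: sum.distrib sum_distrib_left sum_constant card_lessThan)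
    also have "\<dots> = t\<^sup>2 * \<sigma>\<^sup>2 / 2 * ((\<Sum>k<n. phase_corr t n ?Q k) / real n) + \<bar>t\<bar> ^ 3 * C / sqrt (real n)"
      using that by simp
    finally show ?thesis by (simp add: f0)
  qed
  have "(\<lambda>n. f n n - of_real ((1 + - a / real n) ^ n)) \<longlonglongrightarrow> 0"
  proof (rule Lim_null_comparison)
    show "\<forall>\<^sub>F n in sequentially. cmod (f n n - of_real ((1 + - a / real n) ^ n))
      \<le> t\<^sup>2 * \<sigma>\<^sup>2 / 2 * ((\<Sum>k<n. phase_corr t n ?Q k) / real n) + \<bar>t\<bar> ^ 3 * C / sqrt (real n)"
      using eventually_gt_at_top[of 0] eventually_ge_at_top[of "nat \<lceil>a\<rceil>"]
      by eventually_elim (rule le, auto simp: nat_le_iff ceiling_le_iff)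
    have "(\<lambda>n. t\<^sup>2 * \<sigma>\<^sup>2 / 2 * ((\<Sum>k<n. phase_corr t n ?Q k) / real n) + \<bar>t\<bar> ^ 3 * C / sqrt (real n))
      \<longlonglongrightarrow> t\<^sup>2 * \<sigma>\<^sup>2 / 2 * 0 + 0"
      by (intro tendsto_add tendsto_mult_left tendsto_0_sqrt null_phase_corr null)
    then show "(\<lambda>n. t\<^sup>2 * \<sigma>\<^sup>2 / 2 * ((\<Sum>k<n. phase_corr t n ?Q k) / real n) + \<bar>t\<bar> ^ 3 * C / sqrt (real n)) \<longlonglongrightarrow> 0"
      by simp
  qed
  moreover have "(\<lambda>n. complex_of_real ((1 + - a / real n) ^ n)) \<longlonglongrightarrow> of_real (exp (- a))"
    by (intro tendsto_of_real tendsto_exp_limit_sequentially)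
  ultimately have "(\<lambda>n. f n n) \<longlonglongrightarrow> of_real (exp (- a))"
    using tendsto_add by fastforce
  moreover have "f n n = expectation (\<lambda>\<omega>. iexp (t * ((\<Sum>k<n. Y k \<omega> * \<xi> k \<omega>) / sqrt (real n))))" for n
  proof -
    have "phase t n n = (\<lambda>\<omega>. iexp (t * ((\<Sum>k<n. Y k \<omega> * \<xi> k \<omega>) / sqrt (real n))))"
      by (simp add: phase_def fun_eq_iff)
    then show ?thesis by (simp only: f_def)
  qed
  ultimately show ?thesis by (simp add: a_def mult.assoc)
qed

end

section \<open>The autoregression started at zero\<close>

lemma summable_compose_pred: "summable (\<lambda>k. f (k - 1))" if "summable f" for f :: "nat \<Rightarrow> real"
  using that summable_Suc_iff[of "\<lambda>k. f (k - 1)"] by simp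

locale ar_process = iid_noise +
  fixes \<theta> \<rho> :: real
  assumes theta: "\<bar>\<theta>\<bar> < 1" and rho: "\<bar>\<rho>\<bar> < 1"
begin

text \<open>The error process and the observed process, both started at 0. Their values depend on the noise
  alone, so they are adapted with bounded fourth moments whatever the given initial values are.\<close>

primrec e :: "nat \<Rightarrow> 'a \<Rightarrow> real" where
  "e 0 = (\<lambda>\<omega>. 0)"
| "e (Suc k) = (\<lambda>\<omega>. \<rho> * e k \<omega> + \<xi> k \<omega>)"

primrec x :: "nat \<Rightarrow> 'a \<Rightarrow> real" where
  "x 0 = (\<lambda>\<omega>. 0)"
| "x (Suc k) = (\<lambda>\<omega>. \<theta> * x k \<omega> + (\<rho> * e k \<omega> + \<xi> k \<omega>))"

lemma e_eq: "e k \<omega> = x k \<omega> - \<theta> * x (k - 1) \<omega>"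
  by (cases k) auto

text \<open>This holds from \<open>k = 0\<close> on, because \<open>x (0 - 1) = x 0 = 0\<close>.\<close>

lemma x_second_order: "x (Suc k) \<omega> = (\<theta> + \<rho>) * x k \<omega> - \<theta> * \<rho> * x (k - 1) \<omega> + \<xi> k \<omega>"
  by (simp add: e_eq algebra_simps)

lemma e_adapted: "adapted e" and e_L4: "L_bounded 4 e"
  by (rule adapted_autoregression[of e \<rho> \<xi>], auto intro: noise_past)
    (rule L4_bounded_autoregression[of e \<rho> \<xi>], auto simp: rho L_bounded_noise)

lemma x_adapted: "adapted x"
proof (rule adapted_autoregression[of x \<theta> "\<lambda>k. e (Suc k)"])
  show "e (Suc k) \<in> borel_measurable (past (Suc k))" for k by (rule adapted_measurable[OF e_adapted])
qed auto

lemma x_L4: "L_bounded 4 x"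
proof (rule L4_bounded_autoregression[of x \<theta> "\<lambda>k. e (Suc k)"])
  show "L_bounded 4 (\<lambda>k. e (Suc k))" by (rule L_bounded_reindex[OF e_L4])
qed (auto simp: theta)

text \<open>The moments \<open>E e\<^sup>2\<close>, \<open>E x e\<close>, \<open>E x\<^sup>2\<close> and \<open>E x(k) x(k - 1)\<close> of the stationary process, as the fixed
  point of the moment recursion.\<close>

definition "\<gamma>\<^sub>e = \<sigma>\<^sup>2 / (1 - \<rho>\<^sup>2)"
definition "\<gamma>\<^sub>x\<^sub>e = \<gamma>\<^sub>e / (1 - \<theta> * \<rho>)"
definition "\<gamma>\<^sub>0 = (2 * (\<theta> * \<rho>) * \<gamma>\<^sub>x\<^sub>e + \<gamma>\<^sub>e) / (1 - \<theta>\<^sup>2)"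
definition "\<gamma>\<^sub>1 = \<theta> * \<gamma>\<^sub>0 + \<rho> * \<gamma>\<^sub>x\<^sub>e"

lemma abs_products_less_one: "\<bar>\<theta> * \<rho>\<bar> < 1" "\<bar>\<theta>\<^sup>2\<bar> < 1" "\<bar>\<rho>\<^sup>2\<bar> < 1"
proof -
  have "\<bar>a * b\<bar> < 1" if "\<bar>a\<bar> < 1" "\<bar>b\<bar> < 1" for a b :: real
    using mult_strict_mono'[OF that] by (simp add: abs_mult)
  then show "\<bar>\<theta> * \<rho>\<bar> < 1" "\<bar>\<theta>\<^sup>2\<bar> < 1" "\<bar>\<rho>\<^sup>2\<bar> < 1"
    using theta rho unfolding power2_eq_square by blast+
qed

lemma stationarity:
  "\<gamma>\<^sub>e = \<rho>\<^sup>2 * \<gamma>\<^sub>e + \<sigma>\<^sup>2" "\<gamma>\<^sub>x\<^sub>e = \<theta> * \<rho> * \<gamma>\<^sub>x\<^sub>e + \<gamma>\<^sub>e" "\<gamma>\<^sub>0 = \<theta>\<^sup>2 * \<gamma>\<^sub>0 + 2 * (\<theta> * \<rho>) * \<gamma>\<^sub>x\<^sub>e + \<gamma>\<^sub>e"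
proof -
  have "1 - \<rho>\<^sup>2 \<noteq> 0" "1 - \<theta> * \<rho> \<noteq> 0" "1 - \<theta>\<^sup>2 \<noteq> 0" using abs_products_less_one by linarith+
  then have "\<gamma>\<^sub>e * (1 - \<rho>\<^sup>2) = \<sigma>\<^sup>2" "\<gamma>\<^sub>x\<^sub>e * (1 - \<theta> * \<rho>) = \<gamma>\<^sub>e" "\<gamma>\<^sub>0 * (1 - \<theta>\<^sup>2) = 2 * (\<theta> * \<rho>) * \<gamma>\<^sub>x\<^sub>e + \<gamma>\<^sub>e"
    by (simp_all add: \<gamma>\<^sub>e_def \<gamma>\<^sub>x\<^sub>e_def \<gamma>\<^sub>0_def)
  then show "\<gamma>\<^sub>e = \<rho>\<^sup>2 * \<gamma>\<^sub>e + \<sigma>\<^sup>2" "\<gamma>\<^sub>x\<^sub>e = \<theta> * \<rho> * \<gamma>\<^sub>x\<^sub>e + \<gamma>\<^sub>e" "\<gamma>\<^sub>0 = \<theta>\<^sup>2 * \<gamma>\<^sub>0 + 2 * (\<theta> * \<rho>) * \<gamma>\<^sub>x\<^sub>e + \<gamma>\<^sub>e"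
    by (simp_all add: algebra_simps)
qed

lemma L2_products:
  "L_bounded 2 (\<lambda>k \<omega>. (e k \<omega>)\<^sup>2 - c)" "L_bounded 2 (\<lambda>k \<omega>. x k \<omega> * e k \<omega> - c)"
  "L_bounded 2 (\<lambda>k \<omega>. (x k \<omega>)\<^sup>2 - c)" "L_bounded 2 (\<lambda>k \<omega>. x k \<omega> * x (k - 1) \<omega> - c)"
  "L_bounded 2 (\<lambda>k \<omega>. (x (k - 1) \<omega>)\<^sup>2 - c)"
  unfolding diff_conv_add_uminus power2_eq_square
  by (intro L2_bounded_add L_bounded_const L4_bounded_mult e_L4 x_L4 L_bounded_reindex[OF x_L4])+

context
  fixes Y :: "nat \<Rightarrow> 'a \<Rightarrow> real"
  assumes Y: "adapted Y" "L_bounded 4 Y"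
begin

interpretation noise_transform M \<xi> \<sigma> Y
  by standard (rule Y)+

text \<open>These are the driving terms of the recursions for the products of \<open>e\<close> and \<open>x\<close>. That recursion is
  triangular with coefficients \<open>\<rho>\<^sup>2\<close>, \<open>\<theta> * \<rho>\<close> and \<open>\<theta>\<^sup>2\<close>, all of modulus less than 1, so the
  following lemmas settle \<open>e\<^sup>2\<close>, \<open>x e\<close> and \<open>x\<^sup>2\<close> in this order.\<close>

lemma null_noise:
  "null (\<lambda>k \<omega>. x k \<omega> * \<xi> k \<omega>)" "null (\<lambda>k \<omega>. e k \<omega> * \<xi> k \<omega>)" "null (\<lambda>k \<omega>. (\<xi> k \<omega>)\<^sup>2 - \<sigma>\<^sup>2)"
proof -
  have x2: "L_bounded 2 x" and e2: "L_bounded 2 e" and n2: "L_bounded 2 \<xi>"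
    using L_bounded_lower[OF x_L4, of 2] L_bounded_lower[OF e_L4, of 2] L_bounded_lower[OF L_bounded_noise, of 2] by auto
  have i2: "integrable M (\<lambda>\<omega>. \<bar>\<xi> 0 \<omega>\<bar>\<^sup>2)" using L_boundedD[OF n2] by blast
  show "null (\<lambda>k \<omega>. x k \<omega> * \<xi> k \<omega>)" "null (\<lambda>k \<omega>. e k \<omega> * \<xi> k \<omega>)"
    using null_innovation[OF x_adapted x2, of "\<lambda>y. y"] null_innovation[OF e_adapted e2, of "\<lambda>y. y"] i2 mean by auto
  have "L_bounded 2 (\<lambda>k \<omega>. (\<xi> k \<omega>)\<^sup>2 + - \<sigma>\<^sup>2)"
    unfolding power2_eq_square[of "\<xi> _ _"]
    by (intro L2_bounded_add L_bounded_const L4_bounded_mult L_bounded_noise)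
  from L_boundedD[OF this] have i4: "integrable M (\<lambda>\<omega>. \<bar>(\<xi> 0 \<omega>)\<^sup>2 - \<sigma>\<^sup>2\<bar>\<^sup>2)"
    unfolding diff_conv_add_uminus by blast
  have "integrable M (\<lambda>\<omega>. (\<xi> 0 \<omega>)\<^sup>2)" using i2 by simp
  then have "expectation (\<lambda>\<omega>. (\<xi> 0 \<omega>)\<^sup>2 - \<sigma>\<^sup>2) = 0" by (simp add: second prob_space)
  then have "null (\<lambda>k \<omega>. 1 * ((\<xi> k \<omega>)\<^sup>2 - \<sigma>\<^sup>2))"
    using i4 by (intro null_innovation[where Z="\<lambda>k \<omega>. 1" and g="\<lambda>y. y\<^sup>2 - \<sigma>\<^sup>2"])
      (auto simp: adapted_def L_bounded_const)
  then show "null (\<lambda>k \<omega>. (\<xi> k \<omega>)\<^sup>2 - \<sigma>\<^sup>2)" by simp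
qed

lemma null_e_e: "null (\<lambda>k \<omega>. (e k \<omega>)\<^sup>2 - \<gamma>\<^sub>e)"
proof (rule null_recursion[where l="\<rho>\<^sup>2"])
  show "null (\<lambda>k \<omega>. 2 * \<rho> * (e k \<omega> * \<xi> k \<omega>) + ((\<xi> k \<omega>)\<^sup>2 - \<sigma>\<^sup>2))"
    by (intro null_add null_scale null_noise)
  show "(e (Suc k) \<omega>)\<^sup>2 - \<gamma>\<^sub>e = \<rho>\<^sup>2 * ((e k \<omega>)\<^sup>2 - \<gamma>\<^sub>e)
      + (2 * \<rho> * (e k \<omega> * \<xi> k \<omega>) + ((\<xi> k \<omega>)\<^sup>2 - \<sigma>\<^sup>2))" for k \<omega>
    by (subst (1) stationarity(1)) (simp add: power2_eq_square algebra_simps)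
qed (rule abs_products_less_one L2_products)+

lemma null_x_e: "null (\<lambda>k \<omega>. x k \<omega> * e k \<omega> - \<gamma>\<^sub>x\<^sub>e)"
proof (rule null_recursion[where l="\<theta> * \<rho>"])
  show "null (\<lambda>k \<omega>. \<theta> * (x k \<omega> * \<xi> k \<omega>) + (\<rho>\<^sup>2 * ((e k \<omega>)\<^sup>2 - \<gamma>\<^sub>e)
      + (2 * \<rho> * (e k \<omega> * \<xi> k \<omega>) + ((\<xi> k \<omega>)\<^sup>2 - \<sigma>\<^sup>2))))"
    by (intro null_add null_scale null_noise null_e_e)
  show "x (Suc k) \<omega> * e (Suc k) \<omega> - \<gamma>\<^sub>x\<^sub>e = \<theta> * \<rho> * (x k \<omega> * e k \<omega> - \<gamma>\<^sub>x\<^sub>e)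
      + (\<theta> * (x k \<omega> * \<xi> k \<omega>) + (\<rho>\<^sup>2 * ((e k \<omega>)\<^sup>2 - \<gamma>\<^sub>e) + (2 * \<rho> * (e k \<omega> * \<xi> k \<omega>) + ((\<xi> k \<omega>)\<^sup>2 - \<sigma>\<^sup>2))))" for k \<omega>
    using stationarity(1,2) by (simp add: power2_eq_square algebra_simps)
qed (rule abs_products_less_one L2_products)+

lemma null_x_x: "null (\<lambda>k \<omega>. (x k \<omega>)\<^sup>2 - \<gamma>\<^sub>0)"
proof (rule null_recursion[where l="\<theta>\<^sup>2"])
  show "null (\<lambda>k \<omega>. 2 * \<theta> * \<rho> * (x k \<omega> * e k \<omega> - \<gamma>\<^sub>x\<^sub>e) + (2 * \<theta> * (x k \<omega> * \<xi> k \<omega>) + (\<rho>\<^sup>2 * ((e k \<omega>)\<^sup>2 - \<gamma>\<^sub>e)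
      + (2 * \<rho> * (e k \<omega> * \<xi> k \<omega>) + ((\<xi> k \<omega>)\<^sup>2 - \<sigma>\<^sup>2)))))"
    by (intro null_add null_scale null_noise null_e_e null_x_e)
  show "(x (Suc k) \<omega>)\<^sup>2 - \<gamma>\<^sub>0 = \<theta>\<^sup>2 * ((x k \<omega>)\<^sup>2 - \<gamma>\<^sub>0)
      + (2 * \<theta> * \<rho> * (x k \<omega> * e k \<omega> - \<gamma>\<^sub>x\<^sub>e) + (2 * \<theta> * (x k \<omega> * \<xi> k \<omega>) + (\<rho>\<^sup>2 * ((e k \<omega>)\<^sup>2 - \<gamma>\<^sub>e)
      + (2 * \<rho> * (e k \<omega> * \<xi> k \<omega>) + ((\<xi> k \<omega>)\<^sup>2 - \<sigma>\<^sup>2)))))" for k \<omega>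
    using stationarity(1,3) by (simp add: power2_eq_square algebra_simps)
qed (rule abs_products_less_one L2_products)+

text \<open>The lagged products need no contraction: they are combinations of settled terms one step earlier,
  so the coefficient is 0.\<close>

lemma null_x_lag: "null (\<lambda>k \<omega>. x k \<omega> * x (k - 1) \<omega> - \<gamma>\<^sub>1)"
proof (rule null_recursion[where l=0])
  show "null (\<lambda>k \<omega>. \<theta> * ((x k \<omega>)\<^sup>2 - \<gamma>\<^sub>0) + (\<rho> * (x k \<omega> * e k \<omega> - \<gamma>\<^sub>x\<^sub>e) + x k \<omega> * \<xi> k \<omega>))"
    by (intro null_add null_scale null_noise null_x_x null_x_e)
  show "x (Suc k) \<omega> * x (Suc k - 1) \<omega> - \<gamma>\<^sub>1 = 0 * (x k \<omega> * x (k - 1) \<omega> - \<gamma>\<^sub>1)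
      + (\<theta> * ((x k \<omega>)\<^sup>2 - \<gamma>\<^sub>0) + (\<rho> * (x k \<omega> * e k \<omega> - \<gamma>\<^sub>x\<^sub>e) + x k \<omega> * \<xi> k \<omega>))" for k \<omega>
    by (simp add: \<gamma>\<^sub>1_def power2_eq_square algebra_simps)
  show "\<bar>0::real\<bar> < 1" by simp
qed (rule L2_products)

lemma null_lag_lag: "null (\<lambda>k \<omega>. (x (k - 1) \<omega>)\<^sup>2 - \<gamma>\<^sub>0)"
proof (rule null_recursion[where l=0])
  show "(x (Suc k - 1) \<omega>)\<^sup>2 - \<gamma>\<^sub>0 = 0 * ((x (k - 1) \<omega>)\<^sup>2 - \<gamma>\<^sub>0) + ((x k \<omega>)\<^sup>2 - \<gamma>\<^sub>0)" for k \<omega>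
    by simp
  show "\<bar>0::real\<bar> < 1" by simp
qed (rule L2_products null_x_x)+

text \<open>The case of interest has for \<open>Y\<close> the same linear form that is squared here.\<close>

lemma null_quadratic_form:
  "null (\<lambda>k \<omega>. (p * x k \<omega> + q * x (k - 1) \<omega>)\<^sup>2 - (p\<^sup>2 * \<gamma>\<^sub>0 + 2 * p * q * \<gamma>\<^sub>1 + q\<^sup>2 * \<gamma>\<^sub>0))"
proof -
  have "null (\<lambda>k \<omega>. p\<^sup>2 * ((x k \<omega>)\<^sup>2 - \<gamma>\<^sub>0) + (2 * p * q * (x k \<omega> * x (k - 1) \<omega> - \<gamma>\<^sub>1)
      + q\<^sup>2 * ((x (k - 1) \<omega>)\<^sup>2 - \<gamma>\<^sub>0)))"
    by (intro null_add null_scale null_x_x null_x_lag null_lag_lag)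
  also have "(\<lambda>k \<omega>. p\<^sup>2 * ((x k \<omega>)\<^sup>2 - \<gamma>\<^sub>0) + (2 * p * q * (x k \<omega> * x (k - 1) \<omega> - \<gamma>\<^sub>1)
      + q\<^sup>2 * ((x (k - 1) \<omega>)\<^sup>2 - \<gamma>\<^sub>0)))
    = (\<lambda>k \<omega>. (p * x k \<omega> + q * x (k - 1) \<omega>)\<^sup>2 - (p\<^sup>2 * \<gamma>\<^sub>0 + 2 * p * q * \<gamma>\<^sub>1 + q\<^sup>2 * \<gamma>\<^sub>0))"
    by (intro ext) (simp add: power2_eq_square algebra_simps)
  finally show ?thesis .
qed

end

lemma lag_adapted: "adapted (\<lambda>k. x (k - 1))"
  unfolding adapted_def using past_mono[OF _ adapted_measurable[OF x_adapted]] by (meson diff_le_self)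

lemma law_of_large_numbers: "o_prob (\<lambda>n \<omega>. sum0 (\<lambda>k. x k \<omega>) n / real n - \<gamma>\<^sub>0)"
proof -
  interpret noise_transform M \<xi> \<sigma> x by standard (rule x_adapted x_L4)+
  note null = null_x_x[OF x_adapted x_L4]
  have int: "integrable M (\<lambda>\<omega>. (\<Sum>k<n. (x k \<omega>)\<^sup>2 - \<gamma>\<^sub>0) / real n)" for n
    by (intro Bochner_Integration.integrable_divide Bochner_Integration.integrable_sum null_integrable[OF null])
  have "o_prob (\<lambda>n \<omega>. (\<Sum>k<n. (x k \<omega>)\<^sup>2 - \<gamma>\<^sub>0) / real n)"
  proof (rule o_prob_of_expectation[OF int])
    show "(\<lambda>n. expectation (\<lambda>\<omega>. \<bar>(\<Sum>k<n. (x k \<omega>)\<^sup>2 - \<gamma>\<^sub>0) / real n\<bar>)) \<longlonglongrightarrow> 0"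
      using null_mean[OF null] by (simp only: abs_divide abs_of_nat integral_divide_zero)
  qed
  then show ?thesis
  proof (rule o_prob_cong, intro likely_mono[OF likely_gt0])
    fix n \<omega> assume "n > (0::nat)"
    then show "sum0 (\<lambda>k. x k \<omega>) n / real n - \<gamma>\<^sub>0 = (\<Sum>k<n. (x k \<omega>)\<^sup>2 - \<gamma>\<^sub>0) / real n"
      by (simp add: sum0_def sum_subtractf diff_divide_distrib)
  qed
qed

text \<open>The two martingales that carry the fluctuations of the lag sums.\<close>

definition N1 :: "nat \<Rightarrow> 'a \<Rightarrow> real" where "N1 n \<omega> = (\<Sum>k<n. x k \<omega> * \<xi> k \<omega>)"
definition N2 :: "nat \<Rightarrow> 'a \<Rightarrow> real" where "N2 n \<omega> = (\<Sum>k<n. x (k - 1) \<omega> * \<xi> k \<omega>)"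

lemma N_measurable [measurable]: "N1 n \<in> borel_measurable M" "N2 n \<in> borel_measurable M"
proof -
  have "N1 n \<in> borel_measurable (past n)" "N2 n \<in> borel_measurable (past n)"
    unfolding N1_def[abs_def] N2_def[abs_def]
    using innovation_sum_measurable[OF x_adapted, of "\<lambda>y. y" n] innovation_sum_measurable[OF lag_adapted, of "\<lambda>y. y" n]
    by simp_all
  then show "N1 n \<in> borel_measurable M" "N2 n \<in> borel_measurable M" by (simp_all add: past_measurable)
qed

lemma central_limit:
  "(\<lambda>n. expectation (\<lambda>\<omega>. iexp (t * ((p * N1 n \<omega> + q * N2 n \<omega>) / sqrt (real n)))))
    \<longlonglongrightarrow> of_real (exp (- (t\<^sup>2 * (\<sigma>\<^sup>2 * (p\<^sup>2 * \<gamma>\<^sub>0 + 2 * p * q * \<gamma>\<^sub>1 + q\<^sup>2 * \<gamma>\<^sub>0)) / 2)))"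
  if v: "p\<^sup>2 * \<gamma>\<^sub>0 + 2 * p * q * \<gamma>\<^sub>1 + q\<^sup>2 * \<gamma>\<^sub>0 \<ge> 0"
proof -
  let ?Y = "\<lambda>k \<omega>. p * x k \<omega> + q * x (k - 1) \<omega>"
  have Y: "adapted ?Y" "L_bounded 4 ?Y"
  proof -
    show "adapted ?Y"
      using adapted_measurable[OF x_adapted] adapted_measurable[OF lag_adapted]
      by (auto simp: adapted_def intro!: borel_measurable_add borel_measurable_times)
    show "L_bounded 4 ?Y" by (intro L4_bounded_add L_bounded_scale x_L4 L_bounded_reindex[OF x_L4])
  qed
  interpret noise_transform M \<xi> \<sigma> ?Y by standard (rule Y)+
  have eq: "(\<Sum>k<n. ?Y k \<omega> * \<xi> k \<omega>) = p * N1 n \<omega> + q * N2 n \<omega>" for n \<omega>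
    by (simp add: N1_def N2_def sum_distrib_left sum.distrib[symmetric] algebra_simps)
  show ?thesis
    using char_tendsto[OF null_quadratic_form[OF Y, of p q] v, of t] unfolding eq .
qed

lemma N_O_prob: "O_prob (\<lambda>n \<omega>. N1 n \<omega> / sqrt (real n))" "O_prob (\<lambda>n \<omega>. N2 n \<omega> / sqrt (real n))"
proof -
  have "O_prob (\<lambda>n \<omega>. (\<Sum>k<n. Z k \<omega> * \<xi> k \<omega>) / sqrt (real n))" if Z: "adapted Z" "L_bounded 4 Z" for Z
  proof -
    have Z2: "L_bounded 2 Z" by (rule L_bounded_lower[OF Z(2)]) simp
    have "L_bounded 2 \<xi>" by (rule L_bounded_lower[OF L_bounded_noise]) simp
    from L_boundedD[OF this] have i2: "integrable M (\<lambda>\<omega>. \<bar>\<xi> 0 \<omega>\<bar>\<^sup>2)" by blast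
    let ?T = "\<lambda>n \<omega>. \<Sum>k<n. Z k \<omega> * \<xi> k \<omega>"
    obtain K where K: "K \<ge> 0" "\<And>n. integrable M (\<lambda>\<omega>. (?T n \<omega>)\<^sup>2)" "\<And>n. expectation (\<lambda>\<omega>. (?T n \<omega>)\<^sup>2) \<le> real n * K"
      using innovation_sum_second_moment[OF Z(1) Z2, of "\<lambda>y. y"] i2 mean by auto
    have Tm: "?T n \<in> borel_measurable M" for n
      using innovation_sum_measurable[OF Z(1), of "\<lambda>y. y" n] by (simp add: past_measurable)
    have *: "integrable M (\<lambda>\<omega>. ?T n \<omega> / sqrt (real n)) \<and> expectation (\<lambda>\<omega>. \<bar>?T n \<omega> / sqrt (real n)\<bar>) \<le> K + 1" for n
    proof (cases "n > 0")
      case True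
      note T = L1_le_of_second_moment[OF Tm K(2,3) True]
      have "expectation (\<lambda>\<omega>. \<bar>?T n \<omega> / sqrt (real n)\<bar>) = expectation (\<lambda>\<omega>. \<bar>?T n \<omega>\<bar>) / sqrt (real n)"
        by (simp add: abs_divide)
      also have "\<dots> \<le> K + 1" using T(2) True by (simp add: pos_divide_le_eq)
      finally show ?thesis using T(1) by simp
    qed (use K(1) in simp)
    then show ?thesis by (intro O_prob_of_expectation[where K="K + 1"]) auto
  qed
  from this[OF x_adapted x_L4] this[OF lag_adapted L_bounded_reindex[OF x_L4]]
  show "O_prob (\<lambda>n \<omega>. N1 n \<omega> / sqrt (real n))" "O_prob (\<lambda>n \<omega>. N2 n \<omega> / sqrt (real n))"
    unfolding N1_def N2_def .
qed

text \<open>The second order recursion multiplied by \<open>x k\<close> and summed; in \<open>sum2_x\<close> the multiplier is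
  \<open>x (k - 1)\<close>.\<close>

lemma sum1_x: "(1 + \<theta> * \<rho>) * sum1 (\<lambda>k. x k \<omega>) n
    = (\<theta> + \<rho>) * sum0 (\<lambda>k. x k \<omega>) n + \<theta> * \<rho> * (x n \<omega> * x (n - 1) \<omega>) + N1 n \<omega>"
proof -
  have "sum1 (\<lambda>k. x k \<omega>) n = (\<theta> + \<rho>) * sum0 (\<lambda>k. x k \<omega>) n
      - \<theta> * \<rho> * (\<Sum>k<n. x k \<omega> * x (k - 1) \<omega>) + N1 n \<omega>"
    unfolding sum0_def sum1_def N1_def sum_distrib_left sum_subtractf[symmetric] sum.distrib[symmetric]
    by (rule sum.cong) (auto simp: x_second_order power2_eq_square algebra_simps simp del: x.simps)
  moreover have S: "(\<Sum>k<n. x k \<omega> * x (k - 1) \<omega>) = sum1 (\<lambda>k. x k \<omega>) n - x n \<omega> * x (n - 1) \<omega>"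
    using sum_lessThan_shift[of "\<lambda>k. x k \<omega> * x (k - 1) \<omega>" n] by (simp add: sum1_def del: x.simps(2))
  ultimately show ?thesis unfolding S by (simp add: algebra_simps)
qed

lemma sum2_x: "sum2 (\<lambda>k. x k \<omega>) n = (\<theta> + \<rho>) * (sum1 (\<lambda>k. x k \<omega>) n - x n \<omega> * x (n - 1) \<omega>)
    - \<theta> * \<rho> * (sum0 (\<lambda>k. x k \<omega>) n - (x (n - 1) \<omega>)\<^sup>2) + N2 n \<omega>"
proof -
  have "sum2 (\<lambda>k. x k \<omega>) n = (\<theta> + \<rho>) * (\<Sum>k<n. x k \<omega> * x (k - 1) \<omega>)
      - \<theta> * \<rho> * (\<Sum>k<n. (x (k - 1) \<omega>)\<^sup>2) + N2 n \<omega>"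
    unfolding sum2_def N2_def sum_distrib_left sum_subtractf[symmetric] sum.distrib[symmetric]
    by (rule sum.cong) (auto simp: x_second_order power2_eq_square algebra_simps simp del: x.simps)
  moreover have "(\<Sum>k<n. x k \<omega> * x (k - 1) \<omega>) = sum1 (\<lambda>k. x k \<omega>) n - x n \<omega> * x (n - 1) \<omega>"
    using sum_lessThan_shift[of "\<lambda>k. x k \<omega> * x (k - 1) \<omega>" n] by (simp add: sum1_def del: x.simps(2))
  moreover have "(\<Sum>k<n. (x (k - 1) \<omega>)\<^sup>2) = sum0 (\<lambda>k. x k \<omega>) n - (x (n - 1) \<omega>)\<^sup>2"
    using sum_lessThan_shift[of "\<lambda>k. (x (k - 1) \<omega>)\<^sup>2" n] by (simp add: sum0_def del: x.simps(2))
  ultimately show ?thesis by simp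
qed

section \<open>Influence of the initial values\<close>

text \<open>The decay of the influence of the initial values. The errors forget \<open>\<epsilon> 0\<close> at the rate \<open>\<bar>\<rho>\<bar> ^ k\<close>, and
  feed into \<open>X\<close>; the recursive form covers the resonant case \<open>\<bar>\<theta>\<bar> = \<bar>\<rho>\<bar>\<close>, where \<open>w k\<close> is of order
  \<open>k * \<bar>\<rho>\<bar> ^ k\<close>, along with all others.\<close>

primrec w :: "nat \<Rightarrow> real" where
  "w 0 = 1"
| "w (Suc k) = \<bar>\<theta>\<bar> * w k + \<bar>\<rho>\<bar> ^ Suc k"

lemma w_nonneg: "w k \<ge> 0"
  by (induction k) auto

lemma w_summable: "summable w"
proof (rule summableI_nonneg_bounded)
  define K where "K = 1 / (1 - \<bar>\<rho>\<bar>) / (1 - \<bar>\<theta>\<bar>)"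
  have K: "K \<ge> 0" "1 / (1 - \<bar>\<rho>\<bar>) = (1 - \<bar>\<theta>\<bar>) * K" using theta rho by (simp_all add: K_def)
  have S: "(\<Sum>k<Suc n. w k) = \<bar>\<theta>\<bar> * (\<Sum>k<n. w k) + (\<Sum>k<Suc n. \<bar>\<rho>\<bar> ^ k)" for n
    unfolding sum.lessThan_Suc_shift by (simp add: sum.distrib sum_distrib_left)
  show "(\<Sum>k<n. w k) \<le> K" for n
  proof (induction n)
    case (Suc n)
    have "(\<Sum>k<Suc n. \<bar>\<rho>\<bar> ^ k) \<le> 1 / (1 - \<bar>\<rho>\<bar>)"
      unfolding sum_gp_strict using rho by (simp add: divide_right_mono)
    then have "(\<Sum>k<Suc n. w k) \<le> \<bar>\<theta>\<bar> * K + (1 - \<bar>\<theta>\<bar>) * K"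
      unfolding S K(2) using Suc by (intro add_mono mult_left_mono) auto
    then show ?case by (simp add: algebra_simps)
  qed (use K(1) in simp)
qed (rule w_nonneg)

text \<open>Summable weights leave the sum bounded in mean, regardless of any dependence between its terms.\<close>

lemma O_prob_weighted_sum:
  assumes v: "summable v" "\<And>k. v k \<ge> 0" and Z: "L_bounded 1 Z"
  shows "O_prob (\<lambda>n \<omega>. \<Sum>k<n. v k * \<bar>Z k \<omega>\<bar>)"
proof -
  obtain K where K: "K \<ge> 0" "\<And>k. integrable M (\<lambda>\<omega>. \<bar>Z k \<omega>\<bar>)" "\<And>k. expectation (\<lambda>\<omega>. \<bar>Z k \<omega>\<bar>) \<le> K"
    using L_boundedD[OF Z] unfolding power_one_right by blast
  have int: "integrable M (\<lambda>\<omega>. \<Sum>k<n. v k * \<bar>Z k \<omega>\<bar>)" for n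
    by (intro Bochner_Integration.integrable_sum integrable_mult_right K)
  show ?thesis
  proof (rule O_prob_of_expectation[OF int])
    fix n
    have "expectation (\<lambda>\<omega>. \<bar>\<Sum>k<n. v k * \<bar>Z k \<omega>\<bar>\<bar>) = expectation (\<lambda>\<omega>. \<Sum>k<n. v k * \<bar>Z k \<omega>\<bar>)"
      using v(2) by (simp add: sum_nonneg)
    also have "\<dots> = (\<Sum>k<n. v k * expectation (\<lambda>\<omega>. \<bar>Z k \<omega>\<bar>))"
      using K(2) by (subst Bochner_Integration.integral_sum) auto
    also have "\<dots> \<le> (\<Sum>k<n. v k * K)" using v(2) K(3) by (intro sum_mono mult_left_mono) auto
    also have "\<dots> = (\<Sum>k<n. v k) * K" by (simp add: sum_distrib_right)
    also have "\<dots> \<le> suminf v * K" using v K(1) by (intro mult_right_mono sum_le_suminf) auto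
    finally show "expectation (\<lambda>\<omega>. \<bar>\<Sum>k<n. v k * \<bar>Z k \<omega>\<bar>\<bar>) \<le> suminf v * K" .
  qed
qed

lemma x_O_prob: "O_prob (\<lambda>n \<omega>. x (f n) \<omega>)"
proof -
  have "L_bounded 1 (\<lambda>k. x (f k))" by (rule L_bounded_reindex[OF L_bounded_lower[OF x_L4]]) simp
  then show ?thesis
    using O_prob_of_expectation[of "\<lambda>k. x (f k)"] L_bounded_integrable[OF x_L4] L_boundedD[of 1 "\<lambda>k. x (f k)"]
    by auto
qed

text \<open>Arbitrary initial values. They may depend on the noise and need not have moments, so they enter
  only through the factor \<open>W\<close>, which is a single random variable and thus bounded in probability.\<close>

context
  fixes X \<epsilon> :: "nat \<Rightarrow> 'a \<Rightarrow> real"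
  assumes init [measurable]: "X 0 \<in> borel_measurable M" "\<epsilon> 0 \<in> borel_measurable M"
    and X_Suc: "\<And>k \<omega>. \<omega> \<in> space M \<Longrightarrow> X (Suc k) \<omega> = \<theta> * X k \<omega> + \<epsilon> (Suc k) \<omega>"
    and \<epsilon>_Suc: "\<And>k \<omega>. \<omega> \<in> space M \<Longrightarrow> \<epsilon> (Suc k) \<omega> = \<rho> * \<epsilon> k \<omega> + \<xi> k \<omega>"
begin

definition "W \<omega> = \<bar>X 0 \<omega>\<bar> + \<bar>\<epsilon> 0 \<omega>\<bar>"

lemma W_O_prob: "O_prob (\<lambda>n. W)"
  by (rule O_prob_random_variable) (simp add: W_def[abs_def])

lemma X_measurable: "X k \<in> borel_measurable M"
proof -
  have [measurable]: "\<epsilon> k \<in> borel_measurable M" for k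
  proof (induction k)
    case (Suc k)
    then have "(\<lambda>\<omega>. \<rho> * \<epsilon> k \<omega> + \<xi> k \<omega>) \<in> borel_measurable M" by measurable
    then show ?case by (rule measurable_cong[THEN iffD2, rotated]) (rule \<epsilon>_Suc)
  qed measurable
  show ?thesis
  proof (induction k)
    case (Suc k)
    then have "(\<lambda>\<omega>. \<theta> * X k \<omega> + \<epsilon> (Suc k) \<omega>) \<in> borel_measurable M" by measurable
    then show ?case by (rule measurable_cong[THEN iffD2, rotated]) (rule X_Suc)
  qed measurable
qed

lemma X_diff_x: "\<bar>X k \<omega> - x k \<omega>\<bar> \<le> W \<omega> * w k" if \<omega>: "\<omega> \<in> space M"
proof (induction k)
  case 0 then show ?case by (simp add: W_def)
next
  case (Suc k)
  have \<epsilon>: "\<epsilon> k \<omega> - e k \<omega> = \<rho> ^ k * \<epsilon> 0 \<omega>" for k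
    by (induction k) (auto simp: \<epsilon>_Suc[OF \<omega>] algebra_simps)
  have "X (Suc k) \<omega> - x (Suc k) \<omega> = \<theta> * (X k \<omega> - x k \<omega>) + \<rho> ^ Suc k * \<epsilon> 0 \<omega>"
    using \<epsilon>[of "Suc k"] by (simp add: X_Suc[OF \<omega>] algebra_simps)
  also have "\<bar>\<dots>\<bar> \<le> \<bar>\<theta>\<bar> * \<bar>X k \<omega> - x k \<omega>\<bar> + \<bar>\<rho>\<bar> ^ Suc k * \<bar>\<epsilon> 0 \<omega>\<bar>"
    by (rule order_trans[OF abs_triangle_ineq]) (simp only: abs_mult power_abs order_refl)
  also have "\<dots> \<le> \<bar>\<theta>\<bar> * (W \<omega> * w k) + \<bar>\<rho>\<bar> ^ Suc k * W \<omega>"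
    using Suc by (intro add_mono mult_left_mono) (auto simp: W_def)
  finally show ?case by (simp add: algebra_simps)
qed

text \<open>Written with the difference \<open>d = X - x\<close>, the products differ by \<open>x d + d x + d d\<close>, and
  \<open>\<bar>d k\<bar> \<le> W * w k\<close> turns this into weighted sums with summable weights.\<close>

lemma product_sums_diff:
  assumes f: "summable (\<lambda>k. w (f k))" and g: "summable (\<lambda>k. w (g k))"
  shows "O_prob (\<lambda>n \<omega>. (\<Sum>k<n. X (f k) \<omega> * X (g k) \<omega>) - (\<Sum>k<n. x (f k) \<omega> * x (g k) \<omega>))"
proof -
  have x1: "L_bounded 1 (\<lambda>k. x (f k))" for f :: "nat \<Rightarrow> nat"
    by (rule L_bounded_reindex[OF L_bounded_lower[OF x_L4]]) simp
  have wle: "w k \<le> suminf w" for k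
    using sum_le_suminf[OF w_summable, of "{k}"] w_nonneg by simp
  let ?c = "suminf (\<lambda>k. w (f k)) * suminf w"
  have "O_prob (\<lambda>n \<omega>. W \<omega> * ((\<Sum>k<n. w (g k) * \<bar>x (f k) \<omega>\<bar>) + (\<Sum>k<n. w (f k) * \<bar>x (g k) \<omega>\<bar>)) + (W \<omega>)\<^sup>2 * ?c)"
    by (intro O_prob_add O_prob_mult W_O_prob O_prob_weighted_sum f g w_nonneg x1 O_prob_power2 O_prob_const)
  then show ?thesis
  proof (rule O_prob_le)
    fix n \<omega> assume \<omega>: "\<omega> \<in> space M"
    have W: "W \<omega> \<ge> 0" by (simp add: W_def)
    have "\<bar>(\<Sum>k<n. X (f k) \<omega> * X (g k) \<omega>) - (\<Sum>k<n. x (f k) \<omega> * x (g k) \<omega>)\<bar>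
        \<le> (\<Sum>k<n. \<bar>X (f k) \<omega> * X (g k) \<omega> - x (f k) \<omega> * x (g k) \<omega>\<bar>)"
      unfolding sum_subtractf[symmetric] by (rule sum_abs)
    also have "\<dots> \<le> (\<Sum>k<n. W \<omega> * (w (g k) * \<bar>x (f k) \<omega>\<bar>) + W \<omega> * (w (f k) * \<bar>x (g k) \<omega>\<bar>) + (W \<omega>)\<^sup>2 * (w (f k) * suminf w))"
    proof (rule sum_mono)
      fix k
      let ?a = "X (f k) \<omega> - x (f k) \<omega>" and ?b = "X (g k) \<omega> - x (g k) \<omega>"
      have a: "\<bar>?a\<bar> \<le> W \<omega> * w (f k)" and b: "\<bar>?b\<bar> \<le> W \<omega> * w (g k)" by (rule X_diff_x[OF \<omega>])+
      have "X (f k) \<omega> * X (g k) \<omega> - x (f k) \<omega> * x (g k) \<omega> = ?b * x (f k) \<omega> + ?a * x (g k) \<omega> + ?a * ?b"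
        by (simp add: algebra_simps)
      also have "\<bar>\<dots>\<bar> \<le> \<bar>?b\<bar> * \<bar>x (f k) \<omega>\<bar> + \<bar>?a\<bar> * \<bar>x (g k) \<omega>\<bar> + \<bar>?a\<bar> * \<bar>?b\<bar>"
        by (intro order_trans[OF abs_triangle_ineq] add_mono) (auto simp: abs_mult intro: order_trans[OF abs_triangle_ineq])
      also have "\<dots> \<le> (W \<omega> * w (g k)) * \<bar>x (f k) \<omega>\<bar> + (W \<omega> * w (f k)) * \<bar>x (g k) \<omega>\<bar> + (W \<omega> * w (f k)) * (W \<omega> * suminf w)"
        by (intro add_mono mult_mono a order_trans[OF b mult_left_mono[OF wle W]] b) (auto intro!: mult_nonneg_nonneg W w_nonneg)
      finally show "\<bar>X (f k) \<omega> * X (g k) \<omega> - x (f k) \<omega> * x (g k) \<omega>\<bar>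
          \<le> W \<omega> * (w (g k) * \<bar>x (f k) \<omega>\<bar>) + W \<omega> * (w (f k) * \<bar>x (g k) \<omega>\<bar>) + (W \<omega>)\<^sup>2 * (w (f k) * suminf w)"
        by (simp add: power2_eq_square mult_ac)
    qed
    also have "\<dots> = W \<omega> * ((\<Sum>k<n. w (g k) * \<bar>x (f k) \<omega>\<bar>) + (\<Sum>k<n. w (f k) * \<bar>x (g k) \<omega>\<bar>))
        + (W \<omega>)\<^sup>2 * ((\<Sum>k<n. w (f k)) * suminf w)"
      by (simp add: sum.distrib sum_distrib_left sum_distrib_right distrib_left)
    also have "\<dots> \<le> W \<omega> * ((\<Sum>k<n. w (g k) * \<bar>x (f k) \<omega>\<bar>) + (\<Sum>k<n. w (f k) * \<bar>x (g k) \<omega>\<bar>)) + (W \<omega>)\<^sup>2 * ?c"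
      using sum_le_suminf[OF f, of "{..<n}"] w_nonneg suminf_nonneg[OF w_summable w_nonneg]
      by (intro add_left_mono mult_left_mono mult_right_mono) auto
    finally show "\<bar>(\<Sum>k<n. X (f k) \<omega> * X (g k) \<omega>) - (\<Sum>k<n. x (f k) \<omega> * x (g k) \<omega>)\<bar>
        \<le> \<bar>W \<omega> * ((\<Sum>k<n. w (g k) * \<bar>x (f k) \<omega>\<bar>) + (\<Sum>k<n. w (f k) * \<bar>x (g k) \<omega>\<bar>)) + (W \<omega>)\<^sup>2 * ?c\<bar>"
      by linarith
  qed
qed

lemma sums_diff:
  "O_prob (\<lambda>n \<omega>. sum0 (\<lambda>k. X k \<omega>) n - sum0 (\<lambda>k. x k \<omega>) n)"
  "O_prob (\<lambda>n \<omega>. sum1 (\<lambda>k. X k \<omega>) n - sum1 (\<lambda>k. x k \<omega>) n)"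
  "O_prob (\<lambda>n \<omega>. sum2 (\<lambda>k. X k \<omega>) n - sum2 (\<lambda>k. x k \<omega>) n)"
proof -
  have s: "summable (\<lambda>k. w k)" "summable (\<lambda>k. w (Suc k))" "summable (\<lambda>k. w (k - 1))"
    using w_summable summable_compose_pred[OF w_summable] summable_Suc_iff[of w] by simp_all
  from product_sums_diff[OF s(1) s(1)] product_sums_diff[OF s(2) s(1)] product_sums_diff[OF s(2) s(3)]
  show "O_prob (\<lambda>n \<omega>. sum0 (\<lambda>k. X k \<omega>) n - sum0 (\<lambda>k. x k \<omega>) n)"
    "O_prob (\<lambda>n \<omega>. sum1 (\<lambda>k. X k \<omega>) n - sum1 (\<lambda>k. x k \<omega>) n)"
    "O_prob (\<lambda>n \<omega>. sum2 (\<lambda>k. X k \<omega>) n - sum2 (\<lambda>k. x k \<omega>) n)"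
    unfolding sum0_def sum1_def sum2_def power2_eq_square .
qed

lemma X_O_prob: "O_prob (\<lambda>n \<omega>. X (f n) \<omega>)"
proof -
  have wle: "w k \<le> suminf w" for k
    using sum_le_suminf[OF w_summable, of "{k}"] w_nonneg by simp
  have "O_prob (\<lambda>n \<omega>. W \<omega> * suminf w)" by (intro O_prob_mult W_O_prob O_prob_const)
  then have "O_prob (\<lambda>n \<omega>. X (f n) \<omega> - x (f n) \<omega>)"
  proof (rule O_prob_le)
    fix n \<omega> assume "\<omega> \<in> space M"
    then have "\<bar>X (f n) \<omega> - x (f n) \<omega>\<bar> \<le> W \<omega> * w (f n)" by (rule X_diff_x)
    also have "\<dots> \<le> W \<omega> * suminf w" by (intro mult_left_mono wle) (simp add: W_def)
    finally show "\<bar>X (f n) \<omega> - x (f n) \<omega>\<bar> \<le> \<bar>W \<omega> * suminf w\<bar>" by linarith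
  qed
  from O_prob_add[OF this x_O_prob[of f]] show ?thesis by simp
qed

end

end

section \<open>The limit law\<close>

context ar_process
begin

lemma stationary_variance: "\<gamma>\<^sub>0 * ((1 - \<theta> * \<rho>) * ((1 - \<theta>\<^sup>2) * (1 - \<rho>\<^sup>2))) = \<sigma>\<^sup>2 * (1 + \<theta> * \<rho>)"
proof -
  have 1: "\<gamma>\<^sub>0 * (1 - \<theta>\<^sup>2) = (1 + \<theta> * \<rho>) * \<gamma>\<^sub>x\<^sub>e" using stationarity(2,3) by (simp add: algebra_simps)
  have 2: "\<gamma>\<^sub>x\<^sub>e * (1 - \<theta> * \<rho>) = \<gamma>\<^sub>e" using stationarity(2) by (simp add: algebra_simps)
  have 3: "\<gamma>\<^sub>e * (1 - \<rho>\<^sup>2) = \<sigma>\<^sup>2" using stationarity(1) by (simp add: algebra_simps)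
  have "\<gamma>\<^sub>0 * ((1 - \<theta> * \<rho>) * ((1 - \<theta>\<^sup>2) * (1 - \<rho>\<^sup>2))) = (\<gamma>\<^sub>0 * (1 - \<theta>\<^sup>2)) * ((1 - \<theta> * \<rho>) * (1 - \<rho>\<^sup>2))"
    by (simp only: mult_ac)
  also have "\<dots> = (1 + \<theta> * \<rho>) * ((\<gamma>\<^sub>x\<^sub>e * (1 - \<theta> * \<rho>)) * (1 - \<rho>\<^sup>2))"
    unfolding 1 by (simp only: mult_ac)
  also have "\<dots> = \<sigma>\<^sup>2 * (1 + \<theta> * \<rho>)" unfolding 2 3 by (simp only: mult_ac)
  finally show ?thesis .
qed

lemma stationary_autocovariance: "(1 + \<theta> * \<rho>) * \<gamma>\<^sub>1 = (\<theta> + \<rho>) * \<gamma>\<^sub>0"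
proof -
  have 1: "\<gamma>\<^sub>0 * (1 - \<theta>\<^sup>2) = (1 + \<theta> * \<rho>) * \<gamma>\<^sub>x\<^sub>e" using stationarity(2,3) by (simp add: algebra_simps)
  have "(1 + \<theta> * \<rho>) * \<gamma>\<^sub>1 = (1 + \<theta> * \<rho>) * \<theta> * \<gamma>\<^sub>0 + \<rho> * ((1 + \<theta> * \<rho>) * \<gamma>\<^sub>x\<^sub>e)"
    by (simp add: \<gamma>\<^sub>1_def algebra_simps)
  then show ?thesis unfolding 1[symmetric] by (simp add: power2_eq_square algebra_simps)
qed

end

text \<open>The coefficients \<open>p\<close> and \<open>q\<close> are those of the linearization, and the quadratic form in them is the
  variance of the linear form \<open>p x(k) + q x(k - 1)\<close> in the stationary regime. With \<open>w = \<theta> * \<rho>\<close>,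
  \<open>a = 1 + w\<close> and \<open>u = 1 - r\<^sub>1\<^sup>2\<close> the derivative simplifies to \<open>p = - 2 * k / j\<close>, \<open>q = 2 * r\<^sub>1 / j\<close>
  where \<open>k = (r\<^sub>1\<^sup>2 + w) / a\<close>. Completing the square and
  \<open>k - r\<^sub>1\<^sup>2 = w * u / a\<close> give the two summands of the variance, and
  \<open>(1 - \<theta>\<^sup>2) * (1 - \<rho>\<^sup>2) = a\<^sup>2 - (\<theta> + \<rho>)\<^sup>2\<close> relates \<open>u\<close> to the stationary variance \<open>g\<close>.\<close>

lemma asymptotic_variance:
  fixes \<theta> \<rho> \<sigma> g g\<^sub>1 :: real
  assumes small: "\<bar>\<theta>\<bar> < 1" "\<bar>\<rho>\<bar> < 1" "1 + \<theta> * \<rho> > 0" and "g > 0"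
    and g: "g * ((1 - \<theta> * \<rho>) * ((1 - \<theta>\<^sup>2) * (1 - \<rho>\<^sup>2))) = \<sigma>\<^sup>2 * (1 + \<theta> * \<rho>)"
    and g1: "(1 + \<theta> * \<rho>) * g\<^sub>1 = (\<theta> + \<rho>) * g"
  defines "r\<^sub>1 \<equiv> (\<theta> + \<rho>) / (1 + \<theta> * \<rho>)"
  defines "r\<^sub>2 \<equiv> (\<theta> + \<rho>) * r\<^sub>1 - \<theta> * \<rho>" and "r \<equiv> rho_star \<theta> \<rho>" and "j \<equiv> g * (1 - r\<^sub>1\<^sup>2)"
  defines "p \<equiv> - 2 * ((3 * r\<^sub>1\<^sup>2 + 2 * r * r\<^sub>1 - r\<^sub>2) * (1 / (1 + \<theta> * \<rho>)) - r\<^sub>1 * ((\<theta> + \<rho>) / (1 + \<theta> * \<rho>))) / j"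
    and "q \<equiv> 2 * r\<^sub>1 / j"
  shows "r\<^sub>1\<^sup>2 < 1" "r\<^sub>1 ^ 3 - r\<^sub>1 * r\<^sub>2 = r * (1 - r\<^sub>1\<^sup>2)"
    "p\<^sup>2 * g + 2 * p * q * g\<^sub>1 + q\<^sup>2 * g \<ge> 0"
    "\<sigma>\<^sup>2 * (p\<^sup>2 * g + 2 * p * q * g\<^sub>1 + q\<^sup>2 * g) = sigma2_D \<theta> \<rho>"
proof -
  define w where "w = \<theta> * \<rho>"
  define s where "s = \<theta> + \<rho>"
  define a where "a = 1 + w"
  define m where "m = (1 - \<theta>\<^sup>2) * (1 - \<rho>\<^sup>2)"
  have a: "a > 0" "w = a - 1" using small(3) by (simp_all add: a_def w_def)
  have "\<theta>\<^sup>2 < 1" "\<rho>\<^sup>2 < 1" using small by (simp_all add: abs_square_less_1)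
  then have m0: "m > 0" by (simp add: m_def)
  have m: "m = a\<^sup>2 - s\<^sup>2" by (simp add: m_def a_def w_def s_def power2_eq_square algebra_simps)
  have r1: "r\<^sub>1 = s / a" and r: "r = w * r\<^sub>1" and r2: "r\<^sub>2 = s * r\<^sub>1 - w" and s: "s = a * r\<^sub>1"
    using a by (simp_all add: r\<^sub>1_def r_def rho_star_def r\<^sub>2_def s_def a_def w_def)
  define u where "u = 1 - r\<^sub>1\<^sup>2"
  have u: "u = m / a\<^sup>2" using a(1) by (simp add: u_def m r1 power_divide diff_divide_distrib)
  then have "u > 0" using m0 a(1) by simp
  then show "r\<^sub>1\<^sup>2 < 1" by (simp add: u_def)
  show "r\<^sub>1 ^ 3 - r\<^sub>1 * r\<^sub>2 = r * (1 - r\<^sub>1\<^sup>2)"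
    unfolding r r2 s a(2) by (simp add: power2_eq_square power3_eq_cube algebra_simps)
  have g1: "g\<^sub>1 = r\<^sub>1 * g" 
  proof -
    have "a * g\<^sub>1 = s * g" using g1 by (simp add: a_def s_def w_def)
    then show ?thesis using a(1) by (simp add: r1 field_simps)
  qed
  define k where "k = (r\<^sub>1\<^sup>2 + w) / a"
  have j: "j = g * u" by (simp add: j_def u_def)
  have p: "p = - 2 * k / j"
  proof -
    have "3 * r\<^sub>1\<^sup>2 + 2 * r * r\<^sub>1 - r\<^sub>2 - r\<^sub>1 * s = r\<^sub>1\<^sup>2 + w"
      unfolding r r2 s a(2) by (simp add: power2_eq_square algebra_simps)
    then have "k = (3 * r\<^sub>1\<^sup>2 + 2 * r * r\<^sub>1 - r\<^sub>2) * (1 / a) - r\<^sub>1 * (s / a)"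
      by (simp add: k_def diff_divide_distrib[symmetric])
    then show ?thesis by (simp add: p_def a_def w_def s_def)
  qed
  have ku: "k - r\<^sub>1\<^sup>2 = w * u / a"
  proof -
    have "k - r\<^sub>1\<^sup>2 = (r\<^sub>1\<^sup>2 + w - a * r\<^sub>1\<^sup>2) / a" using a(1) by (simp add: k_def diff_divide_distrib)
    also have "r\<^sub>1\<^sup>2 + w - a * r\<^sub>1\<^sup>2 = w * u" by (simp add: a(2) u_def algebra_simps)
    finally show ?thesis .
  qed
  have v: "p\<^sup>2 * g + 2 * p * q * g\<^sub>1 + q\<^sup>2 * g = 4 / (g * u\<^sup>2) * ((k - r\<^sub>1\<^sup>2)\<^sup>2 + r\<^sub>1\<^sup>2 * u)"
  proof -
    have "p\<^sup>2 * g + 2 * p * q * g\<^sub>1 + q\<^sup>2 * g = 4 * g / j\<^sup>2 * (k\<^sup>2 - 2 * k * r\<^sub>1 * r\<^sub>1 + r\<^sub>1\<^sup>2)"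
      unfolding p q_def g1 by (simp add: power_divide add_divide_distrib diff_divide_distrib power2_eq_square algebra_simps)
    also have "k\<^sup>2 - 2 * k * r\<^sub>1 * r\<^sub>1 + r\<^sub>1\<^sup>2 = (k - r\<^sub>1\<^sup>2)\<^sup>2 + r\<^sub>1\<^sup>2 * u"
      by (simp add: u_def power2_eq_square algebra_simps)
    also have "4 * g / j\<^sup>2 = 4 / (g * u\<^sup>2)" using \<open>g > 0\<close> \<open>u > 0\<close> by (simp add: j power2_eq_square)
    finally show ?thesis .
  qed
  show "p\<^sup>2 * g + 2 * p * q * g\<^sub>1 + q\<^sup>2 * g \<ge> 0"
    unfolding v using \<open>g > 0\<close> \<open>u > 0\<close> by simp
  have sg: "\<sigma>\<^sup>2 = g * (1 - w) * m / a"
    using g a(1) by (simp add: w_def m_def a_def field_simps)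
  have "\<sigma>\<^sup>2 * (p\<^sup>2 * g + 2 * p * q * g\<^sub>1 + q\<^sup>2 * g) = 4 * (1 - w) * m / (a * u\<^sup>2) * ((w * u / a)\<^sup>2 + (s / a)\<^sup>2 * u)"
  proof -
    have "g * c / a * (4 / (g * u\<^sup>2) * b) = 4 * c / (a * u\<^sup>2) * b" for b c
      using \<open>g > 0\<close> by simp
    from this[of "(1 - w) * m"] show ?thesis unfolding v sg ku r1[symmetric] by (simp only: mult.assoc)
  qed
  also have "\<dots> = 4 * (1 - w) / a ^ 3 * (s\<^sup>2 * a\<^sup>2 + w\<^sup>2 * m)"
  proof -
    have "4 * c * m / (a * u\<^sup>2) * ((w * u / a)\<^sup>2 + (s / a)\<^sup>2 * u) = 4 * c / a ^ 3 * (s\<^sup>2 * a\<^sup>2 + w\<^sup>2 * m)" for c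
      unfolding u using m0 a(1) by (simp add: field_simps power2_eq_square power3_eq_cube)
    then show ?thesis .
  qed
  also have "\<dots> = sigma2_D \<theta> \<rho>"
    by (simp add: sigma2_D_def w_def a_def s_def m_def mult_ac)
  finally show "\<sigma>\<^sup>2 * (p\<^sup>2 * g + 2 * p * q * g\<^sub>1 + q\<^sup>2 * g) = sigma2_D \<theta> \<rho>" .
qed

context ar_process
begin

lemma durbin_watson_measurable:
  assumes [measurable]: "\<And>k. X k \<in> borel_measurable M"
  shows "(\<lambda>\<omega>. durbin_watson (\<lambda>k. X k \<omega>) n) \<in> borel_measurable M"
proof -
  have [measurable]: "(\<lambda>\<omega>. residual (\<lambda>k. X k \<omega>) n k) \<in> borel_measurable M" for k
    unfolding residual_def theta_hat_def by (cases "k = 0") (simp_all, measurable)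
  show ?thesis unfolding durbin_watson_def by measurable
qed

text \<open>The lag sums of \<open>x\<close>, centred at their limiting ratios, are linear in the two martingales up to
  terms in the last two values only.\<close>

lemma linear_parts:
  defines "r\<^sub>1 \<equiv> (\<theta> + \<rho>) / (1 + \<theta> * \<rho>)"
  defines "r\<^sub>2 \<equiv> (\<theta> + \<rho>) * r\<^sub>1 - \<theta> * \<rho>"
  shows "sum1 (\<lambda>k. x k \<omega>) n - r\<^sub>1 * sum0 (\<lambda>k. x k \<omega>) n - 1 / (1 + \<theta> * \<rho>) * N1 n \<omega>
      = \<theta> * \<rho> / (1 + \<theta> * \<rho>) * (x n \<omega> * x (n - 1) \<omega>)" (is ?one)
    and "sum2 (\<lambda>k. x k \<omega>) n - r\<^sub>2 * sum0 (\<lambda>k. x k \<omega>) n - ((\<theta> + \<rho>) / (1 + \<theta> * \<rho>) * N1 n \<omega> + N2 n \<omega>)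
      = (\<theta> + \<rho>) * (\<theta> * \<rho> / (1 + \<theta> * \<rho>) - 1) * (x n \<omega> * x (n - 1) \<omega>) + \<theta> * \<rho> * (x (n - 1) \<omega>)\<^sup>2"
proof -
  have "1 + \<theta> * \<rho> \<noteq> 0" using abs_products_less_one(1) by linarith
  then have B: "sum1 (\<lambda>k. x k \<omega>) n = (\<theta> + \<rho>) / (1 + \<theta> * \<rho>) * sum0 (\<lambda>k. x k \<omega>) n
      + \<theta> * \<rho> / (1 + \<theta> * \<rho>) * (x n \<omega> * x (n - 1) \<omega>) + 1 / (1 + \<theta> * \<rho>) * N1 n \<omega>"
    using sum1_x[of \<omega> n] by (simp add: add_divide_distrib[symmetric] nonzero_eq_divide_eq mult.commute)
  then show ?one by (simp add: r\<^sub>1_def)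
  show "sum2 (\<lambda>k. x k \<omega>) n - r\<^sub>2 * sum0 (\<lambda>k. x k \<omega>) n - ((\<theta> + \<rho>) / (1 + \<theta> * \<rho>) * N1 n \<omega> + N2 n \<omega>)
      = (\<theta> + \<rho>) * (\<theta> * \<rho> / (1 + \<theta> * \<rho>) - 1) * (x n \<omega> * x (n - 1) \<omega>) + \<theta> * \<rho> * (x (n - 1) \<omega>)\<^sup>2"
    unfolding sum2_x B r\<^sub>2_def r\<^sub>1_def
    by (simp add: algebra_simps add_divide_distrib)
qed

text \<open>All three lag sums of \<open>X\<close> differ from those of \<open>x\<close> by \<open>O\<^sub>P(1)\<close>, so the linearization
  applies to \<open>X\<close> with the martingales of \<open>x\<close>. The central limit theorem for these and Levy's
  continuity theorem conclude.\<close>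

theorem durbin_watson_central_limit:
  fixes X \<epsilon> :: "nat \<Rightarrow> 'a \<Rightarrow> real"
  assumes "\<sigma>\<^sup>2 > 0" and init: "X 0 \<in> borel_measurable M" "\<epsilon> 0 \<in> borel_measurable M"
    and X_Suc: "\<And>k \<omega>. \<omega> \<in> space M \<Longrightarrow> X (Suc k) \<omega> = \<theta> * X k \<omega> + \<epsilon> (Suc k) \<omega>"
    and \<epsilon>_Suc: "\<And>k \<omega>. \<omega> \<in> space M \<Longrightarrow> \<epsilon> (Suc k) \<omega> = \<rho> * \<epsilon> k \<omega> + \<xi> k \<omega>"
  shows "weak_conv_m
    (\<lambda>n. distr M borel (\<lambda>\<omega>. sqrt (real n) * (durbin_watson (\<lambda>k. X k \<omega>) n - D_star \<theta> \<rho>)))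
    (centered_normal (sigma2_D \<theta> \<rho>))"
proof -
  define r\<^sub>1 where "r\<^sub>1 = (\<theta> + \<rho>) / (1 + \<theta> * \<rho>)"
  define r\<^sub>2 where "r\<^sub>2 = (\<theta> + \<rho>) * r\<^sub>1 - \<theta> * \<rho>"
  define r where "r = rho_star \<theta> \<rho>"
  define j where "j = \<gamma>\<^sub>0 * (1 - r\<^sub>1\<^sup>2)"
  define p where "p = - 2 * ((3 * r\<^sub>1\<^sup>2 + 2 * r * r\<^sub>1 - r\<^sub>2) * (1 / (1 + \<theta> * \<rho>)) - r\<^sub>1 * ((\<theta> + \<rho>) / (1 + \<theta> * \<rho>))) / j"
  define q where "q = 2 * r\<^sub>1 / j"
  have pos: "1 + \<theta> * \<rho> > 0" "1 - \<theta> * \<rho> > 0" "1 - \<theta>\<^sup>2 > 0" "1 - \<rho>\<^sup>2 > 0"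
    using abs_products_less_one by linarith+
  have "\<gamma>\<^sub>0 * ((1 - \<theta> * \<rho>) * ((1 - \<theta>\<^sup>2) * (1 - \<rho>\<^sup>2))) > 0"
    unfolding stationary_variance using assms(1) pos by simp
  then have g: "\<gamma>\<^sub>0 > 0" by (rule zero_less_mult_pos2) (use pos in simp)
  have av: "r\<^sub>1\<^sup>2 < 1" "r\<^sub>1 ^ 3 - r\<^sub>1 * r\<^sub>2 = r * (1 - r\<^sub>1\<^sup>2)"
    "p\<^sup>2 * \<gamma>\<^sub>0 + 2 * p * q * \<gamma>\<^sub>1 + q\<^sup>2 * \<gamma>\<^sub>0 \<ge> 0"
    "\<sigma>\<^sup>2 * (p\<^sup>2 * \<gamma>\<^sub>0 + 2 * p * q * \<gamma>\<^sub>1 + q\<^sup>2 * \<gamma>\<^sub>0) = sigma2_D \<theta> \<rho>"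
    unfolding p_def q_def j_def r_def r\<^sub>2_def r\<^sub>1_def
    by (rule asymptotic_variance[OF theta rho pos(1) g stationary_variance stationary_autocovariance])+
  note asm = init X_Suc \<epsilon>_Suc
  have X: "O_prob (\<lambda>n \<omega>. X (f n) \<omega>)" for f
    by (rule X_O_prob[where \<epsilon>=\<epsilon>]) (rule asm, assumption?)+
  have Xm: "X k \<in> borel_measurable M" for k
    by (rule X_measurable[where \<epsilon>=\<epsilon>]) (rule asm, assumption?)+
  have diff: "O_prob (\<lambda>n \<omega>. sum0 (\<lambda>k. X k \<omega>) n - sum0 (\<lambda>k. x k \<omega>) n)"
    "O_prob (\<lambda>n \<omega>. sum1 (\<lambda>k. X k \<omega>) n - sum1 (\<lambda>k. x k \<omega>) n)"
    "O_prob (\<lambda>n \<omega>. sum2 (\<lambda>k. X k \<omega>) n - sum2 (\<lambda>k. x k \<omega>) n)"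
    by (rule sums_diff[where \<epsilon>=\<epsilon>]; (rule asm, assumption?)+)+
  have lln: "o_prob (\<lambda>n \<omega>. sum0 (\<lambda>k. X k \<omega>) n / real n - \<gamma>\<^sub>0)"
    using o_prob_add[OF O_prob_div_real[OF diff(1)] law_of_large_numbers] by (simp add: diff_divide_distrib)
  have B: "O_prob (\<lambda>n \<omega>. sum1 (\<lambda>k. X k \<omega>) n - r\<^sub>1 * sum0 (\<lambda>k. X k \<omega>) n - 1 / (1 + \<theta> * \<rho>) * N1 n \<omega>)"
  proof (rule O_prob_cong)
    show "O_prob (\<lambda>n \<omega>. (sum1 (\<lambda>k. X k \<omega>) n - sum1 (\<lambda>k. x k \<omega>) n) - r\<^sub>1 * (sum0 (\<lambda>k. X k \<omega>) n - sum0 (\<lambda>k. x k \<omega>) n)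
        + \<theta> * \<rho> / (1 + \<theta> * \<rho>) * (x n \<omega> * x (n - 1) \<omega>))"
      by (intro O_prob_add O_prob_diff O_prob_scale O_prob_mult diff x_O_prob)
    show "likely (\<lambda>n \<omega>. sum1 (\<lambda>k. X k \<omega>) n - r\<^sub>1 * sum0 (\<lambda>k. X k \<omega>) n - 1 / (1 + \<theta> * \<rho>) * N1 n \<omega>
      = (sum1 (\<lambda>k. X k \<omega>) n - sum1 (\<lambda>k. x k \<omega>) n) - r\<^sub>1 * (sum0 (\<lambda>k. X k \<omega>) n - sum0 (\<lambda>k. x k \<omega>) n)
        + \<theta> * \<rho> / (1 + \<theta> * \<rho>) * (x n \<omega> * x (n - 1) \<omega>))"
    proof (intro likely_eventually always_eventually allI ballI)
      fix n \<omega>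
      show "sum1 (\<lambda>k. X k \<omega>) n - r\<^sub>1 * sum0 (\<lambda>k. X k \<omega>) n - 1 / (1 + \<theta> * \<rho>) * N1 n \<omega>
        = (sum1 (\<lambda>k. X k \<omega>) n - sum1 (\<lambda>k. x k \<omega>) n) - r\<^sub>1 * (sum0 (\<lambda>k. X k \<omega>) n - sum0 (\<lambda>k. x k \<omega>) n)
          + \<theta> * \<rho> / (1 + \<theta> * \<rho>) * (x n \<omega> * x (n - 1) \<omega>)"
        using linear_parts(1)[of \<omega> n, folded r\<^sub>1_def] unfolding right_diff_distrib by linarith
    qed
  qed
  have C: "O_prob (\<lambda>n \<omega>. sum2 (\<lambda>k. X k \<omega>) n - r\<^sub>2 * sum0 (\<lambda>k. X k \<omega>) n
      - ((\<theta> + \<rho>) / (1 + \<theta> * \<rho>) * N1 n \<omega> + N2 n \<omega>))"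
  proof (rule O_prob_cong)
    show "O_prob (\<lambda>n \<omega>. (sum2 (\<lambda>k. X k \<omega>) n - sum2 (\<lambda>k. x k \<omega>) n) - r\<^sub>2 * (sum0 (\<lambda>k. X k \<omega>) n - sum0 (\<lambda>k. x k \<omega>) n)
        + ((\<theta> + \<rho>) * (\<theta> * \<rho> / (1 + \<theta> * \<rho>) - 1) * (x n \<omega> * x (n - 1) \<omega>) + \<theta> * \<rho> * (x (n - 1) \<omega>)\<^sup>2))"
      by (intro O_prob_add O_prob_diff O_prob_scale O_prob_mult O_prob_power2 diff x_O_prob)
    show "likely (\<lambda>n \<omega>. sum2 (\<lambda>k. X k \<omega>) n - r\<^sub>2 * sum0 (\<lambda>k. X k \<omega>) n
        - ((\<theta> + \<rho>) / (1 + \<theta> * \<rho>) * N1 n \<omega> + N2 n \<omega>)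
      = (sum2 (\<lambda>k. X k \<omega>) n - sum2 (\<lambda>k. x k \<omega>) n) - r\<^sub>2 * (sum0 (\<lambda>k. X k \<omega>) n - sum0 (\<lambda>k. x k \<omega>) n)
        + ((\<theta> + \<rho>) * (\<theta> * \<rho> / (1 + \<theta> * \<rho>) - 1) * (x n \<omega> * x (n - 1) \<omega>) + \<theta> * \<rho> * (x (n - 1) \<omega>)\<^sup>2))"
    proof (intro likely_eventually always_eventually allI ballI)
      fix n \<omega>
      show "sum2 (\<lambda>k. X k \<omega>) n - r\<^sub>2 * sum0 (\<lambda>k. X k \<omega>) n
          - ((\<theta> + \<rho>) / (1 + \<theta> * \<rho>) * N1 n \<omega> + N2 n \<omega>)
        = (sum2 (\<lambda>k. X k \<omega>) n - sum2 (\<lambda>k. x k \<omega>) n) - r\<^sub>2 * (sum0 (\<lambda>k. X k \<omega>) n - sum0 (\<lambda>k. x k \<omega>) n)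
          + ((\<theta> + \<rho>) * (\<theta> * \<rho> / (1 + \<theta> * \<rho>) - 1) * (x n \<omega> * x (n - 1) \<omega>) + \<theta> * \<rho> * (x (n - 1) \<omega>)\<^sup>2)"
        using linear_parts(2)[of \<omega> n, folded r\<^sub>1_def, folded r\<^sub>2_def]
        unfolding r\<^sub>1_def[symmetric] right_diff_distrib[of r\<^sub>2] by linarith
    qed
  qed
  have lin: "o_prob (\<lambda>n \<omega>. sqrt (real n) * (durbin_watson (\<lambda>k. X k \<omega>) n - D_star \<theta> \<rho>)
      - (p * N1 n \<omega> + q * N2 n \<omega>) / sqrt (real n))"
    using durbin_watson_linearization[OF X[of "\<lambda>n. n"] X[of "\<lambda>n. n - 1"] X[of "\<lambda>n. 0"] X[of "\<lambda>n. 1"] lln g _ av(2) N_O_prob B C, folded j_def, folded p_def q_def] av(1)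
    by (simp add: D_star_def r_def)
  let ?Z = "\<lambda>n \<omega>. sqrt (real n) * (durbin_watson (\<lambda>k. X k \<omega>) n - D_star \<theta> \<rho>)"
  have Zm: "?Z n \<in> borel_measurable M" for n
    using durbin_watson_measurable[of X n, OF Xm] by measurable
  have v: "sigma2_D \<theta> \<rho> \<ge> 0" using av(3) av(4)[symmetric] by simp
  show ?thesis
  proof (rule levy_continuity)
    show "real_distribution (distr M borel (?Z n))" for n by (rule real_distribution_distr[OF Zm])
    show "real_distribution (centered_normal (sigma2_D \<theta> \<rho>))" by (rule real_distribution_centered_normal[OF v])
    fix t
    have "(\<lambda>n. expectation (\<lambda>\<omega>. iexp (t * ?Z n \<omega>))) \<longlonglongrightarrow> char (centered_normal (sigma2_D \<theta> \<rho>)) t"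
    proof (rule char_tendsto_if_o_prob_diff[OF Zm _ lin])
      show "(\<lambda>\<omega>. (p * N1 n \<omega> + q * N2 n \<omega>) / sqrt (real n)) \<in> borel_measurable M" for n by measurable
      show "(\<lambda>n. expectation (\<lambda>\<omega>. iexp (t * ((p * N1 n \<omega> + q * N2 n \<omega>) / sqrt (real n)))))
          \<longlonglongrightarrow> char (centered_normal (sigma2_D \<theta> \<rho>)) t"
        using central_limit[OF av(3), of t] unfolding av(4) char_centered_normal[OF v] .
    qed
    moreover have "char (distr M borel (?Z n)) t = expectation (\<lambda>\<omega>. iexp (t * ?Z n \<omega>))" for n
      unfolding char_def by (rule integral_distr[OF Zm]) measurable
    ultimately show "(\<lambda>n. char (distr M borel (?Z n)) t) \<longlonglongrightarrow> char (centered_normal (sigma2_D \<theta> \<rho>)) t"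
      by (simp only:)
  qed
qed

end

lemma (in prob_space) indep_vars_shift:
  assumes "indep_vars (\<lambda>_. borel) (V :: nat \<Rightarrow> 'a \<Rightarrow> real) {1..}"
  shows "indep_vars (\<lambda>_. borel) (\<lambda>k. V (Suc k)) UNIV"
proof -
  let ?F = "\<lambda>k. {V k -` A \<inter> space M | A. A \<in> sets borel}"
  have F: "indep_sets ?F {1..}" and m: "\<And>k. k \<ge> 1 \<Longrightarrow> V k \<in> borel_measurable M"
    using assms unfolding indep_vars_def2 by auto
  have "indep_sets (\<lambda>k. ?F (Suc k)) UNIV"
  proof (rule indep_setsI)
    show "?F (Suc k) \<subseteq> events" for k using measurable_sets[OF m[of "Suc k"]] by auto
    fix A :: "nat \<Rightarrow> 'a set" and J assume J: "J \<noteq> {}" "finite J" "\<forall>k\<in>J. A k \<in> ?F (Suc k)"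
    have "prob (\<Inter>k\<in>Suc ` J. A (k - 1)) = (\<Prod>k\<in>Suc ` J. prob (A (k - 1)))"
      by (rule indep_setsD[OF F]) (use J in auto)
    then show "prob (\<Inter>k\<in>J. A k) = (\<Prod>k\<in>J. prob (A k))"
      by (simp add: prod.reindex image_image)
  qed
  then show ?thesis unfolding indep_vars_def2 using m by auto
qed

theorem theorem4p2:
  fixes M :: "'a measure" and \<theta> \<rho> \<sigma> :: real
    and X \<epsilon> V :: "nat \<Rightarrow> 'a \<Rightarrow> real"
  assumes "prob_space M"
    and "\<bar>\<theta>\<bar> < 1" and "\<bar>\<rho>\<bar> < 1"
    and "prob_space.indep_vars M (\<lambda>_. borel) V {1..}"
    and "\<And>n. n \<ge> 1 \<Longrightarrow> distr M borel (V n) = distr M borel (V 1)"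
    and "prob_space.expectation M (V 1) = 0"
    and "prob_space.variance M (V 1) = \<sigma>\<^sup>2" and "\<sigma>\<^sup>2 > 0"
    and "integrable M (\<lambda>\<omega>. V 1 \<omega> ^ 4)"
    and "X 0 \<in> borel_measurable M" and "\<epsilon> 0 \<in> borel_measurable M"
    and "\<And>n \<omega>. n \<ge> 1 \<Longrightarrow> \<omega> \<in> space M \<Longrightarrow> X n \<omega> = \<theta> * X (n - 1) \<omega> + \<epsilon> n \<omega>"
    and "\<And>n \<omega>. n \<ge> 1 \<Longrightarrow> \<omega> \<in> space M \<Longrightarrow> \<epsilon> n \<omega> = \<rho> * \<epsilon> (n - 1) \<omega> + V n \<omega>"
  shows "weak_conv_m
    (\<lambda>n. distr M borel (\<lambda>\<omega>. sqrt (real n) * (durbin_watson (\<lambda>k. X k \<omega>) n - D_star \<theta> \<rho>)))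
    (centered_normal (sigma2_D \<theta> \<rho>))"
proof -
  interpret prob_space M by (rule assms(1))
  interpret ar_process M "\<lambda>k. V (Suc k)" \<sigma> \<theta> \<rho>
  proof
    show "indep_vars (\<lambda>_. borel) (\<lambda>k. V (Suc k)) UNIV" by (rule indep_vars_shift[OF assms(4)])
    show "distr M borel (V (Suc k)) = distr M borel (V (Suc 0))" for k using assms(5)[of "Suc k"] by simp
    show "expectation (\<lambda>\<omega>. (V (Suc 0) \<omega>)\<^sup>2) = \<sigma>\<^sup>2" using assms(6,7) by simp
  qed (use assms(2,3,6,9) in simp_all)
  show ?thesis
    by (rule durbin_watson_central_limit[where \<epsilon>=\<epsilon>]) (use assms(8,10,11) assms(12,13)[of "Suc _"] in simp_all)
qed

end
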